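(* Assume that for every $(t,x)\in[0,T]\times X$ the set $f(t,x,U)=\{f(t,x,u):u\in U\}$ is convex, and that there exist $t_1\in[0,T]$ and an admissible control $u\in\mathcal{U}(0,t_1,x_0)$ (so that $V^*(0,x_0)\le t_1<\infty$). For $d\in\mathbb{N}^*$ let $\mathsf{val}(R_d)$ denote the value (supremum) of the problem $(R_d)$. Then $\mathsf{val}(R_d)\to V^*(0,x_0)$ as $d\to\infty$.
   Context: Setting. Let $n,m\ge 1$ be integers, $T>0$, $f:\mathbb{R}\times\mathbb{R}^n\times\mathbb{R}^m\to\mathbb{R}^n$ Lipschitz continuous, $U\subset\mathbb{R}^m$ a nonempty compact set, $X\subset\mathbb{R}^n$ and $K\subset X$ compact sets, and $x_0\in X$. Consider the system $\dot x(t)=f(t,x(t),u(t))$, where controls are bounded measurable functions defined on intervals $[t_0,t_1]\subset[0,T]$ with values in $U$. For $0\le t_0\le t_1\le T$ and $\xi\in\mathbb{R}^n$, $\mathcal{U}(t_0,t_1,\xi)$ is the set of admissible controls: those $u$ on $[t_0,t_1]$ such that the (absolutely continuous) solution $x(\cdot)$ with $x(t_0)=\xi$ is well defined on $[t_0,t_1]$, satisfies $(x(t),u(t))\in X\times U$ for a.e. $t\in[t_0,t_1]$, and $x(t_1)\in K$. The value function is $$V^*(t_0,\xi)=\inf\{t_1-t_0 : t_1\in[t_0,T],\ u\in\mathcal{U}(t_0,t_1,\xi)\},$$ equal to $+\infty$ if there is no admissible control. For $d\in\mathbb{N}^*$, $\mathbb{R}_d[t,x_1,\dots,x_n]$ is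 the space of real polynomials of degree at most $d$, and $(R_d)$ is the problem: maximize (supremum) $V(0,x_0)$ over $V\in\mathbb{R}_d[t,x_1,\dots,x_n]$ subject to $$\partial_tV(t,x)+1+\nabla_xV(t,x)^\top f(t,x,u)\ge 0\quad\forall(t,x,u)\in[0,T]\times X\times U,$$ $$V(t,x)\le 0\quad\forall (t,x)\in[0,T]\times K.$$ *)

theory Defs
  imports "HOL-Analysis.Analysis"
begin

text \<open>The absolute continuity of HOL-Analysis is a relation between measures; this is the
  \<open>\<epsilon>\<close>-\<open>\<delta>\<close> notion for a function on an interval, with finite families of non-overlapping intervals.\<close>

definition abs_cont_on :: "real \<Rightarrow> real \<Rightarrow> (real \<Rightarrow> 'a::real_normed_vector) \<Rightarrow> bool" where
  "abs_cont_on s t x \<longleftrightarrow>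
     (\<forall>\<epsilon>>0. \<exists>\<delta>>0. \<forall>(N::nat) a b.
        (\<forall>i<N. s \<le> a i \<and> a i \<le> b i \<and> b i \<le> t) \<and>
        disjoint_family_on (\<lambda>i. {a i<..<b i}) {..<N} \<and>
        (\<Sum>i<N. b i - a i) < \<delta> \<longrightarrow>
        (\<Sum>i<N. norm (x (b i) - x (a i))) < \<epsilon>)"

definition trajectory ::
  "(real \<Rightarrow> real^'n \<Rightarrow> real^'m \<Rightarrow> real^'n) \<Rightarrow> real \<Rightarrow> real \<Rightarrow> real^'n \<Rightarrow>
   (real \<Rightarrow> real^'m) \<Rightarrow> (real \<Rightarrow> real^'n) \<Rightarrow> bool" where
  "trajectory f t\<^sub>0 t\<^sub>1 \<xi> u x \<longleftrightarrow>
     abs_cont_on t\<^sub>0 t\<^sub>1 x \<and> x t\<^sub>0 = \<xi> \<and>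
     (AE t in lebesgue_on {t\<^sub>0..t\<^sub>1}.
        (x has_vector_derivative f t (x t) (u t)) (at t within {t\<^sub>0..t\<^sub>1}))"

text \<open>Controls on \<open>[t\<^sub>0,t\<^sub>1]\<close> are total functions of which only the restriction to \<open>[t\<^sub>0,t\<^sub>1]\<close> matters.\<close>

definition admissible_controls ::
  "(real \<Rightarrow> real^'n \<Rightarrow> real^'m \<Rightarrow> real^'n) \<Rightarrow> (real^'n) set \<Rightarrow> (real^'m) set \<Rightarrow> (real^'n) set \<Rightarrow>
   real \<Rightarrow> real \<Rightarrow> real^'n \<Rightarrow> (real \<Rightarrow> real^'m) set" where
  "admissible_controls f X U K t\<^sub>0 t\<^sub>1 \<xi> =
     {u. u \<in> borel_measurable (lebesgue_on {t\<^sub>0..t\<^sub>1}) \<and>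
         bounded (u ` {t\<^sub>0..t\<^sub>1}) \<and> u ` {t\<^sub>0..t\<^sub>1} \<subseteq> U \<and>
         (\<exists>x. trajectory f t\<^sub>0 t\<^sub>1 \<xi> u x \<and>
              (AE t in lebesgue_on {t\<^sub>0..t\<^sub>1}. (x t, u t) \<in> X \<times> U) \<and>
              x t\<^sub>1 \<in> K)}"

text \<open>In \<^typ>\<open>ereal\<close> the infimum of the empty set is \<open>\<infinity>\<close>.\<close>

definition value_function ::
  "(real \<Rightarrow> real^'n \<Rightarrow> real^'m \<Rightarrow> real^'n) \<Rightarrow> (real^'n) set \<Rightarrow> (real^'m) set \<Rightarrow> (real^'n) set \<Rightarrow>
   real \<Rightarrow> real \<Rightarrow> real^'n \<Rightarrow> ereal" where
  "value_function f X U K T t\<^sub>0 \<xi> =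
     Inf {ereal (t\<^sub>1 - t\<^sub>0) | t\<^sub>1 u. t\<^sub>1 \<in> {t\<^sub>0..T} \<and> u \<in> admissible_controls f X U K t\<^sub>0 t\<^sub>1 \<xi>}"

text \<open>Exponents \<open>(k, \<alpha>)\<close> of the monomials \<open>t\<^sup>k x\<^sup>\<alpha>\<close> of total degree at most \<open>d\<close>.\<close>

definition exponents :: "nat \<Rightarrow> (nat \<times> ('n::finite \<Rightarrow> nat)) set" where
  "exponents d = {(k, \<alpha>). k + (\<Sum>i\<in>UNIV. \<alpha> i) \<le> d}"

lemma finite_exponents: "finite (exponents d :: (nat \<times> ('n::finite \<Rightarrow> nat)) set)"
proof (rule finite_subset)
  show "(exponents d :: (nat \<times> ('n \<Rightarrow> nat)) set) \<subseteq> {..d} \<times> (UNIV \<rightarrow>\<^sub>E {..d})"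
  proof clarsimp
    fix k and \<alpha> :: "'n \<Rightarrow> nat"
    assume "(k, \<alpha>) \<in> exponents d"
    then have *: "k + (\<Sum>i\<in>UNIV. \<alpha> i) \<le> d" by (simp add: exponents_def)
    have "\<alpha> i \<le> (\<Sum>i\<in>UNIV. \<alpha> i)" for i by (simp add: member_le_sum)
    then have "\<alpha> i \<le> d" for i using * by (meson add_leD2 order_trans)
    then show "k \<le> d \<and> \<alpha> \<in> UNIV \<rightarrow>\<^sub>E {..d}" using * by auto
  qed
  show "finite ({..d} \<times> (UNIV \<rightarrow>\<^sub>E {..d} :: ('n \<Rightarrow> nat) set))"
    by (intro finite_cartesian_product finite_PiE) auto
qed

text \<open>Polynomials are identified with polynomial functions.\<close>

definition polys_upto :: "nat \<Rightarrow> (real \<Rightarrow> real^'n \<Rightarrow> real) set" where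
  "polys_upto d =
     {V. \<exists>c :: nat \<times> ('n \<Rightarrow> nat) \<Rightarrow> real. \<forall>t x.
        V t x = (\<Sum>(k, \<alpha>)\<in>exponents d. c (k, \<alpha>) * t ^ k * (\<Prod>i\<in>UNIV. (x $ i) ^ \<alpha> i))}"

definition gradient :: "('a::real_inner \<Rightarrow> real) \<Rightarrow> 'a \<Rightarrow> 'a" where
  "gradient g x = (THE D. GDERIV g x :> D)"

definition feasible_R ::
  "(real \<Rightarrow> real^'n \<Rightarrow> real^'m \<Rightarrow> real^'n) \<Rightarrow> (real^'n) set \<Rightarrow> (real^'m) set \<Rightarrow> (real^'n) set \<Rightarrow>
   real \<Rightarrow> nat \<Rightarrow> (real \<Rightarrow> real^'n \<Rightarrow> real) set" where
  "feasible_R f X U K T d =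
     {V \<in> polys_upto d.
        (\<forall>t\<in>{0..T}. \<forall>x\<in>X. \<forall>u\<in>U.
           deriv (\<lambda>s. V s x) t + 1 + gradient (V t) x \<bullet> f t x u \<ge> 0) \<and>
        (\<forall>t\<in>{0..T}. \<forall>x\<in>K. V t x \<le> 0)}"

definition val_R ::
  "(real \<Rightarrow> real^'n \<Rightarrow> real^'m \<Rightarrow> real^'n) \<Rightarrow> (real^'n) set \<Rightarrow> (real^'m) set \<Rightarrow> (real^'n) set \<Rightarrow>
   real \<Rightarrow> real^'n \<Rightarrow> nat \<Rightarrow> ereal" where
  "val_R f X U K T x\<^sub>0 d = (SUP V\<in>feasible_R f X U K T d. ereal (V 0 x\<^sub>0))"

end

theory Submission
  imports Defs "HOL-Complex_Analysis.Great_Picard"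
begin

text \<open>
  Upper bound: along an admissible trajectory a feasible \<open>V\<close> satisfies \<open>d/dt V(t, x(t)) \<ge> -1\<close> almost everywhere,
  so \<open>V(0, x\<^sub>0) \<le> t\<^sub>1\<close>.

  Lower bound: drop the state constraint and the target, and penalise violating them with weight \<open>k\<close>. The value
  function of this problem over Euler polygons with steps at most \<open>\<eta>\<close> is Lipschitz, nonpositive on \<open>[0,T] \<times> K\<close>,
  and satisfies the dynamic programming inequality exactly, for every control value and every small step. Convolving
  it with a Landau kernel gives a polynomial for which the Hamilton-Jacobi inequality holds up to a small
  error, which a term \<open>\<epsilon> (t - T) - \<epsilon>\<close> absorbs; no duality argument is involved. As \<open>k \<rightarrow> \<infinity>\<close> and \<open>\<eta> \<rightarrow> 0\<close>
  near-optimal polygons converge (Arzela-Ascoli) to a curve that stays in \<open>X\<close>, ends in \<open>K\<close>, and whose velocity lies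
  in the convex sets \<open>f(t, x, U)\<close>; a measurable selection turns it into an admissible control, so the penalised
  values cannot stay below \<open>V*(0, x\<^sub>0)\<close>.
\<close>

section \<open>Absolutely continuous functions and the upper bound\<close>

text \<open>The constrained minimal time is in general neither continuous nor finite, so it is no
  candidate for mollification. The penalised value is bounded and Lipschitz on the whole space,
  which matters because a convolution at a point of \<open>X\<close> also reads values outside. It
  need not be differentiable, so the Hamilton-Jacobi inequality is kept in difference form, W(z)
  \<le> s (1 + k dist(z, A)) + W(z + s F(z, v)). Averaging over translates of z preserves it up to
  Lipschitz errors, and only the mollified function is differentiated. Euler steps give this form
  without the flow of the controlled equation. Time is the first state coordinate, F = (1, f), so
  [0,T] becomes part of the state constraint A = [0,T] x X. The cap M = T + 1 on the terminal
  penalty exceeds every level below V*(0, x0), a number at most T, and makes M - W vanish far from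
  the target; this bounded support is what lets a truncated Landau kernel act as a polynomial near
  A. Convexity is needed only at the end, to separate a velocity outside f(t, x, U) from that set by
  a hyperplane.\<close>

lemma abs_cont_onE:
  assumes "abs_cont_on a b x" and "e > 0"
  obtains d where "d > 0" "\<forall>(n::nat) p q. (\<forall>i<n. a \<le> p i \<and> p i \<le> q i \<and> q i \<le> b) \<and>
    disjoint_family_on (\<lambda>i. {p i<..<q i}) {..<n} \<and> (\<Sum>i<n. q i - p i) < d \<longrightarrow>
    (\<Sum>i<n. norm (x (q i) - x (p i))) < e"
  using assms unfolding abs_cont_on_def by (elim allE[of _ e] impE exE) blast+

text \<open>A one-sided fundamental theorem of calculus obtained without integrating the derivative.
  A gauge makes the tagged intervals at good points so short that the derivative bound controls the
  increment; tags in the null set get balls inside an open set of small measure, where absolute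
  continuity controls the sum of the increments.\<close>

lemma abs_cont_derivative_lower_bound:
  fixes w :: "real \<Rightarrow> real"
  assumes ac: "abs_cont_on a b w" and ab: "a \<le> b"
    and der: "AE t in lebesgue_on {a..b}. \<exists>D\<ge>c. (w has_real_derivative D) (at t within {a..b})"
  shows "c * (b - a) \<le> w b - w a"
proof -
  let ?good = "\<lambda>t. \<exists>D\<ge>c. (w has_real_derivative D) (at t within {a..b})"
  obtain N where N: "negligible N" "\<And>t. t \<in> {a..b} \<Longrightarrow> t \<notin> N \<Longrightarrow> ?good t"
  proof -
    have "AE t in lebesgue. t \<in> {a..b} \<longrightarrow> ?good t"
      using der by (simp add: AE_restrict_space_iff)
    then obtain N where "N \<in> null_sets lebesgue" "{t. \<not> (t \<in> {a..b} \<longrightarrow> ?good t)} \<subseteq> N"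
      unfolding eventually_ae_filter by auto
    show thesis
      by (rule that[of N]) (use \<open>N \<in> _\<close> \<open>_ \<subseteq> N\<close> in \<open>auto simp: negligible_iff_null_sets\<close>)
  qed
  have main: "(c - e) * (b - a) - 2 * e \<le> w b - w a" if "e > 0" for e
  proof -
    obtain d1 where "d1 > 0" and "\<forall>(n::nat) p q. (\<forall>i<n. a \<le> p i \<and> p i \<le> q i \<and> q i \<le> b) \<and>
        disjoint_family_on (\<lambda>i. {p i<..<q i}) {..<n} \<and> (\<Sum>i<n. q i - p i) < d1 \<longrightarrow>
        (\<Sum>i<n. norm (w (q i) - w (p i))) < e"
      by (rule abs_cont_onE[OF ac \<open>e > 0\<close>])
    note d1 = this(2)[rule_format]
    \<comment> \<open>The first bound lets absolute continuity act on the bad intervals; the second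
      makes \<open>\<bar>c - e\<bar>\<close> times their total length at most
      \<open>e\<close>.\<close>
    define d where "d = min d1 (e / (\<bar>c - e\<bar> + 1))"
    have d: "d > 0" "d \<le> d1" "\<bar>c - e\<bar> * d \<le> e"
    proof -
      show "d > 0" "d \<le> d1" using \<open>d1 > 0\<close> \<open>e > 0\<close> by (auto simp: d_def)
      have "\<bar>c - e\<bar> * d \<le> (\<bar>c - e\<bar> + 1) * (e / (\<bar>c - e\<bar> + 1))"
        using \<open>e > 0\<close> \<open>d > 0\<close> by (intro mult_mono) (auto simp: d_def)
      then show "\<bar>c - e\<bar> * d \<le> e" by simp
    qed
    have "N \<in> sets lebesgue" using N(1) by (simp add: negligible_imp_sets)
    then obtain G where G: "open G" "N \<subseteq> G" "(G - N) \<in> lmeasurable" "emeasure lebesgue (G - N) < ennreal d"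
      using sets_lebesgue_outer_open d(1) by blast
    have Gm: "G \<in> lmeasurable" "measure lebesgue G < d"
    proof -
      have "G = (G - N) \<union> N" using G by auto
      moreover have "N \<in> lmeasurable" "measure lebesgue N = 0"
        using N(1) negligible_iff_measure by auto
      ultimately show "G \<in> lmeasurable" using G(3) by (metis fmeasurable.Un)
      have "measure lebesgue G = measure lebesgue (G - N)"
        by (simp add: N(1) G(2) measure_Diff_null_set[OF _ ] \<open>N \<in> sets lebesgue\<close> negligible_iff_null_sets[symmetric]
          \<open>G \<in> lmeasurable\<close> fmeasurableD)
      also have "\<dots> < d" using G(3,4) d(1)
        by (simp add: emeasure_eq_measure2 ennreal_less_iff)
      finally show "measure lebesgue G < d" .
    qed
    \<comment> \<open>The radius of the gauge at \<open>x\<close>. At a good point both endpoints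
      are compared with the tag, so every short interval around the tag has slope at least
      \<open>c - e\<close>.\<close>
    have "\<exists>r>0. (x \<in> N \<longrightarrow> ball x r \<subseteq> G) \<and>
        (x \<in> {a..b} - N \<longrightarrow> (\<forall>p q. p \<in> {a..b} \<and> q \<in> {a..b} \<and> p \<le> x \<and> x \<le> q \<and> dist x p < r \<and> dist x q < r \<longrightarrow>
            (c - e) * (q - p) \<le> w q - w p))" for x
    proof (cases "x \<in> N")
      case True
      then show ?thesis using G(1,2) open_contains_ball by blast
    next
      case False
      show ?thesis
      proof (cases "x \<in> {a..b}")
        case True
        then obtain D where D: "D \<ge> c" "(w has_real_derivative D) (at x within {a..b})"
          using N(2) False by blast
        then have "(w has_derivative (\<lambda>h. D * h)) (at x within {a..b})"
          by (simp add: has_field_derivative_def)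
        then obtain r where r: "r > 0" "\<And>y. y \<in> {a..b} \<Longrightarrow> norm (y - x) < r \<Longrightarrow>
            norm (w y - w x - D * (y - x)) \<le> e * norm (y - x)"
          using \<open>e > 0\<close> unfolding has_derivative_within_alt by blast
        have "(c - e) * (q - p) \<le> w q - w p" if "p \<in> {a..b}" "q \<in> {a..b}" "p \<le> x" "x \<le> q"
          "dist x p < r" "dist x q < r" for p q
        proof -
          have "norm (w p - w x - D * (p - x)) \<le> e * norm (p - x)"
               "norm (w q - w x - D * (q - x)) \<le> e * norm (q - x)"
            using r(2)[of p] r(2)[of q] that by (auto simp: dist_norm norm_minus_commute)
          then have "(D - e) * (q - p) \<le> w q - w p"
            using that by (auto simp: algebra_simps abs_le_iff)
          moreover have "(c - e) * (q - p) \<le> (D - e) * (q - p)"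
            using D that by (intro mult_right_mono) auto
          ultimately show ?thesis by linarith
        qed
        then show ?thesis using r(1) False by blast
      next
        case False2: False
        show ?thesis using False False2 by (intro exI[of _ 1]) auto
      qed
    qed
    then obtain r where r: "\<And>x. r x > 0" "\<And>x. x \<in> N \<Longrightarrow> ball x (r x) \<subseteq> G"
      "\<And>x p q. x \<in> {a..b} - N \<Longrightarrow> p \<in> {a..b} \<Longrightarrow> q \<in> {a..b} \<Longrightarrow> p \<le> x \<Longrightarrow> x \<le> q \<Longrightarrow> dist x p < r x \<Longrightarrow> dist x q < r x \<Longrightarrow>
            (c - e) * (q - p) \<le> w q - w p"
      by metis
    have "gauge (\<lambda>x. ball x (r x))" using r(1) by (simp add: gauge_ball_dependent)
    then obtain P where P: "P tagged_division_of {a..b}" "(\<lambda>x. ball x (r x)) fine P"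
      using fine_division_exists_real by blast
    have finP: "finite P" using P(1) by blast
    have elt: "\<exists>p q. k = {p..q} \<and> a \<le> p \<and> p \<le> x \<and> x \<le> q \<and> q \<le> b \<and> dist x p < r x \<and> dist x q < r x \<and> k \<subseteq> ball x (r x)"
      if xk: "(x, k) \<in> P" for x k
    proof -
      obtain p q where pq: "k = cbox p q" using tagged_division_ofD(4)[OF P(1) xk] by blast
      have "x \<in> k" "k \<subseteq> {a..b}" using tagged_division_ofD(2,3)[OF P(1) xk] by auto
      moreover have "k \<subseteq> ball x (r x)" using P(2) xk by (auto simp: fine_def)
      ultimately show ?thesis using pq by (intro exI[of _ p] exI[of _ q]) (auto simp: subset_iff)
    qed
    define B where "B = {xk \<in> P. fst xk \<in> N}"
    have finB: "finite B" using finP by (simp add: B_def)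
    define lo where "lo = (\<lambda>xk::real \<times> real set. Inf (snd xk))"
    define hi where "hi = (\<lambda>xk::real \<times> real set. Sup (snd xk))"
    have lohi: "snd xk = {lo xk..hi xk} \<and> a \<le> lo xk \<and> lo xk \<le> fst xk \<and> fst xk \<le> hi xk \<and> hi xk \<le> b \<and>
       dist (fst xk) (lo xk) < r (fst xk) \<and> dist (fst xk) (hi xk) < r (fst xk) \<and> snd xk \<subseteq> ball (fst xk) (r (fst xk))"
      if inP: "xk \<in> P" for xk
    proof -
      obtain x k where xk: "xk = (x, k)" by fastforce
      obtain p q where "k = {p..q}" "a \<le> p" "p \<le> x" "x \<le> q" "q \<le> b" "dist x p < r x" "dist x q < r x" "k \<subseteq> ball x (r x)"
        using elt inP unfolding xk by blast
      then show ?thesis by (simp add: lo_def hi_def xk)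
    qed
    have disj: "{lo xk<..<hi xk} \<inter> {lo xk'<..<hi xk'} = {}" if "xk \<in> P" "xk' \<in> P" "xk \<noteq> xk'" for xk xk'
    proof -
      have "interior (snd xk) \<inter> interior (snd xk') = {}"
        using tagged_division_ofD(5)[OF P(1), of "fst xk" "snd xk" "fst xk'" "snd xk'"] that by auto
      then show ?thesis using lohi[OF that(1)] lohi[OF that(2)] by (metis interior_atLeastAtMost_real)
    qed
    have sumP: "(\<Sum>xk\<in>P. g (hi xk) - g (lo xk)) = g b - g a" for g :: "real \<Rightarrow> real"
      using additive_tagged_division_1[OF ab P(1), of g] by (simp add: hi_def lo_def case_prod_beta)
    have bad: "(\<Sum>xk\<in>B. norm (w (hi xk) - w (lo xk))) < e \<and> (\<Sum>xk\<in>B. hi xk - lo xk) < d"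
    proof -
      have len: "(\<Sum>xk\<in>B. hi xk - lo xk) < d"
      proof -
        have "(\<Sum>xk\<in>B. hi xk - lo xk) = (\<Sum>xk\<in>B. measure lebesgue {lo xk<..<hi xk})"
        proof (rule sum.cong)
          fix xk assume "xk \<in> B"
          then have "lo xk \<le> hi xk" using lohi[of xk] by (auto simp: B_def)
          then show "hi xk - lo xk = measure lebesgue {lo xk<..<hi xk}" by simp
        qed simp
        also have "\<dots> = measure lebesgue (\<Union>xk\<in>B. {lo xk<..<hi xk})"
        proof (rule measure_finite_Union[symmetric])
          show "disjoint_family_on (\<lambda>xk. {lo xk<..<hi xk}) B"
            using disj by (auto simp: disjoint_family_on_def B_def)
          have "emeasure lborel {p<..<q} \<noteq> \<infinity>" for p q :: real
            by (cases "p \<le> q") auto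
          then show "emeasure lebesgue {lo xk<..<hi xk} \<noteq> \<infinity>" for xk by simp
        qed (use finB in auto)
        also have "\<dots> \<le> measure lebesgue G"
        proof (rule measure_mono_fmeasurable)
          show "(\<Union>xk\<in>B. {lo xk<..<hi xk}) \<subseteq> G"
          proof
            fix y assume "y \<in> (\<Union>xk\<in>B. {lo xk<..<hi xk})"
            then obtain xk where xk: "xk \<in> B" "y \<in> {lo xk<..<hi xk}" by blast
            then have "y \<in> snd xk" using lohi[of xk] by (auto simp: B_def)
            then show "y \<in> G" using lohi[of xk] r(2)[of "fst xk"] xk(1) by (auto simp: B_def)
          qed
        qed (use finB Gm in auto)
        finally show ?thesis using Gm by simp
      qed
      \<comment> \<open>\<open>abs_cont_on\<close> speaks of families indexed by an initial segment
        of the naturals, hence the enumeration of the bad intervals.\<close>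
      obtain \<beta> where \<beta>: "bij_betw \<beta> {..<card B} B"
        using ex_bij_betw_nat_finite[OF finB] by (auto simp: lessThan_atLeast0)
      have reidx: "(\<Sum>i<card B. g (\<beta> i)) = (\<Sum>xk\<in>B. g xk)" for g :: "_ \<Rightarrow> real"
        by (rule sum.reindex_bij_betw[OF \<beta>])
      have inP: "\<beta> i \<in> P" if "i < card B" for i using \<beta> that by (auto simp: bij_betw_def B_def)
      have "(\<Sum>i<card B. norm (w (hi (\<beta> i)) - w (lo (\<beta> i)))) < e"
      proof (rule d1, intro conjI allI impI)
        show "a \<le> lo (\<beta> i)" "lo (\<beta> i) \<le> hi (\<beta> i)" "hi (\<beta> i) \<le> b" if "i < card B" for i
          using lohi[OF inP[OF that]] by auto
        show "disjoint_family_on (\<lambda>i. {lo (\<beta> i)<..<hi (\<beta> i)}) {..<card B}"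
          unfolding disjoint_family_on_def
        proof (intro ballI impI)
          fix i j assume "i \<in> {..<card B}" "j \<in> {..<card B}" "i \<noteq> j"
          then show "{lo (\<beta> i)<..<hi (\<beta> i)} \<inter> {lo (\<beta> j)<..<hi (\<beta> j)} = {}"
            using \<beta> by (intro disj inP) (auto simp: bij_betw_def inj_on_def)
        qed
      qed (use len d(2) reidx[of "\<lambda>xk. hi xk - lo xk"] in simp)
      then show ?thesis using len reidx[of "\<lambda>xk. norm (w (hi xk) - w (lo xk))"] by simp
    qed
    \<comment> \<open>The summand is the shortfall from slope \<open>c - e\<close>; it is
      nonpositive on good intervals, so only the bad ones can contribute.\<close>
    have "(\<Sum>xk\<in>P. (c - e) * (hi xk - lo xk) - (w (hi xk) - w (lo xk)))
        \<le> (\<Sum>xk\<in>B. (c - e) * (hi xk - lo xk) - (w (hi xk) - w (lo xk)))"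
    proof -
      have "(c - e) * (hi xk - lo xk) - (w (hi xk) - w (lo xk)) \<le> 0" if "xk \<in> P - B" for xk
        using lohi[of xk] r(3)[of "fst xk" "lo xk" "hi xk"] that by (auto simp: B_def)
      then have "(\<Sum>xk\<in>P-B. (c - e) * (hi xk - lo xk) - (w (hi xk) - w (lo xk))) \<le> 0"
        by (rule sum_nonpos)
      then show ?thesis using sum.subset_diff[of B P "\<lambda>xk. (c - e) * (hi xk - lo xk) - (w (hi xk) - w (lo xk))"] finP
        by (auto simp: B_def)
    qed
    also have "\<dots> \<le> (\<Sum>xk\<in>B. \<bar>c - e\<bar> * (hi xk - lo xk) + norm (w (hi xk) - w (lo xk)))"
    proof (rule sum_mono)
      fix xk assume "xk \<in> B"
      then have "0 \<le> hi xk - lo xk" using lohi[of xk] by (auto simp: B_def)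
      then have "(c - e) * (hi xk - lo xk) \<le> \<bar>c - e\<bar> * (hi xk - lo xk)"
        by (intro mult_right_mono) auto
      then show "(c - e) * (hi xk - lo xk) - (w (hi xk) - w (lo xk))
          \<le> \<bar>c - e\<bar> * (hi xk - lo xk) + norm (w (hi xk) - w (lo xk))" by (simp add: abs_if)
    qed
    also have "\<dots> = \<bar>c - e\<bar> * (\<Sum>xk\<in>B. hi xk - lo xk) + (\<Sum>xk\<in>B. norm (w (hi xk) - w (lo xk)))"
      by (simp add: sum.distrib sum_distrib_left)
    also have "\<dots> \<le> \<bar>c - e\<bar> * d + e"
      using bad by (intro add_mono mult_left_mono) auto
    also have "\<dots> \<le> 2 * e" using d(3) by simp
    also have "(\<Sum>xk\<in>P. (c - e) * (hi xk - lo xk) - (w (hi xk) - w (lo xk))) = (c - e) * (b - a) - (w b - w a)"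
      using sumP[of w] sumP[of id] by (simp add: sum_subtractf sum_distrib_left[symmetric])
    finally show ?thesis by simp
  qed
  show ?thesis
  proof (rule field_le_epsilon)
    fix \<epsilon> :: real assume "\<epsilon> > 0"
    \<comment> \<open>\<open>main\<close> falls short of the claim by
      \<open>e * (b - a) + 2 * e\<close>.\<close>
    define e where "e = \<epsilon> / (b - a + 2)"
    have "e > 0" "e * (b - a + 2) = \<epsilon>" using \<open>\<epsilon> > 0\<close> ab by (auto simp: e_def)
    with main[of e] show "c * (b - a) \<le> w b - w a + \<epsilon>" by (simp add: algebra_simps)
  qed
qed

text \<open>Serves polynomials, which are Lipschitz on bounded sets but not globally; hence the
  confinement to a set \<open>S\<close> containing the graph of \<open>x\<close>.\<close>

lemma abs_cont_on_lipschitz_graph: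
  fixes x :: "real \<Rightarrow> 'a::real_normed_vector" and V :: "real \<times> 'a \<Rightarrow> 'b::real_normed_vector"
  assumes x: "abs_cont_on a b x" and V: "C-lipschitz_on S V"
    and S: "\<And>t. t \<in> {a..b} \<Longrightarrow> (t, x t) \<in> S"
  shows "abs_cont_on a b (\<lambda>t. V (t, x t))"
  unfolding abs_cont_on_def
proof (intro allI impI)
  fix \<epsilon> :: real assume "\<epsilon> > 0"
  have C: "C \<ge> 0" using V lipschitz_on_nonneg by blast
  define e where "e = \<epsilon> / (2 * C + 1)"
  have e: "e > 0" "C * (2 * e) < \<epsilon>"
  proof -
    show "e > 0" using C \<open>\<epsilon> > 0\<close> by (simp add: e_def)
    moreover have "\<epsilon> = (2 * C + 1) * e" using C by (simp add: e_def)
    ultimately show "C * (2 * e) < \<epsilon>" by (simp add: algebra_simps)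
  qed
  obtain d where d: "d > 0" "\<forall>(n::nat) p q. (\<forall>i<n. a \<le> p i \<and> p i \<le> q i \<and> q i \<le> b) \<and>
      disjoint_family_on (\<lambda>i. {p i<..<q i}) {..<n} \<and> (\<Sum>i<n. q i - p i) < d \<longrightarrow>
      (\<Sum>i<n. norm (x (q i) - x (p i))) < e"
    by (rule abs_cont_onE[OF x e(1)])
  show "\<exists>\<delta>>0. \<forall>(N::nat) p q. (\<forall>i<N. a \<le> p i \<and> p i \<le> q i \<and> q i \<le> b) \<and>
      disjoint_family_on (\<lambda>i. {p i<..<q i}) {..<N} \<and> (\<Sum>i<N. q i - p i) < \<delta> \<longrightarrow>
      (\<Sum>i<N. norm (V (q i, x (q i)) - V (p i, x (p i)))) < \<epsilon>"
  proof (intro exI[of _ "min d e"] conjI allI impI)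
    fix N :: nat and p q :: "nat \<Rightarrow> real"
    assume A: "(\<forall>i<N. a \<le> p i \<and> p i \<le> q i \<and> q i \<le> b) \<and>
      disjoint_family_on (\<lambda>i. {p i<..<q i}) {..<N} \<and> (\<Sum>i<N. q i - p i) < min d e"
    have "norm (V (q i, x (q i)) - V (p i, x (p i))) \<le> C * ((q i - p i) + norm (x (q i) - x (p i)))" if "i < N" for i
    proof -
      have pq: "a \<le> p i" "p i \<le> q i" "q i \<le> b" using A that by auto
      then have "norm (V (q i, x (q i)) - V (p i, x (p i))) \<le> C * norm ((q i, x (q i)) - (p i, x (p i)))"
        by (intro lipschitz_on_normD[OF V] S) auto
      also have "\<dots> \<le> C * ((q i - p i) + norm (x (q i) - x (p i)))"
        using norm_Pair_le[of "q i - p i" "x (q i) - x (p i)"] pq C by (intro mult_left_mono) auto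
      finally show ?thesis .
    qed
    then have "(\<Sum>i<N. norm (V (q i, x (q i)) - V (p i, x (p i)))) \<le> (\<Sum>i<N. C * ((q i - p i) + norm (x (q i) - x (p i))))"
      by (intro sum_mono) simp
    also have "\<dots> = C * ((\<Sum>i<N. q i - p i) + (\<Sum>i<N. norm (x (q i) - x (p i))))"
      by (simp add: sum_distrib_left sum.distrib distrib_left)
    also have "\<dots> \<le> C * (e + e)"
      using A d(2)[rule_format, of N p q] C by (intro mult_left_mono add_mono) auto
    also have "\<dots> < \<epsilon>" using e by simp
    finally show "(\<Sum>i<N. norm (V (q i, x (q i)) - V (p i, x (p i)))) < \<epsilon>" .
  qed (use d e in auto)
qed

lemma abs_cont_on_imp_continuous_on:
  assumes "abs_cont_on a b x"
  shows "continuous_on {a..b} x"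
  unfolding continuous_on_iff
proof (intro ballI allI impI)
  fix t e :: real assume t: "t \<in> {a..b}" and "e > 0"
  obtain d where d: "d > 0" "\<forall>(n::nat) p q. (\<forall>i<n. a \<le> p i \<and> p i \<le> q i \<and> q i \<le> b) \<and>
      disjoint_family_on (\<lambda>i. {p i<..<q i}) {..<n} \<and> (\<Sum>i<n. q i - p i) < d \<longrightarrow>
      (\<Sum>i<n. norm (x (q i) - x (p i))) < e"
    by (rule abs_cont_onE[OF assms \<open>e > 0\<close>])
  have *: "norm (x q - x p) < e" if "a \<le> p" "p \<le> q" "q \<le> b" "q - p < d" for p q
    using d(2)[rule_format, of 1 "\<lambda>_. p" "\<lambda>_. q"] that by (simp add: disjoint_family_on_def)
  show "\<exists>d>0. \<forall>s\<in>{a..b}. dist s t < d \<longrightarrow> dist (x s) (x t) < e"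
  proof (intro exI conjI ballI impI)
    fix s assume "s \<in> {a..b}" "dist s t < d"
    then show "dist (x s) (x t) < e"
      using *[of s t] *[of t s] t by (cases "s \<le> t") (auto simp: dist_norm norm_minus_commute)
  qed (use d in auto)
qed

text \<open>A product of Lipschitz functions is Lipschitz when both factors are bounded, so the
  induction carries a sup bound together with the Lipschitz constant.\<close>

lemma real_polynomial_function_lipschitz:
  assumes "real_polynomial_function p" "bounded S"
  obtains C where "C-lipschitz_on S p"
proof -
  obtain R where R: "\<And>z. z \<in> S \<Longrightarrow> norm z \<le> R" using \<open>bounded S\<close> bounded_iff by metis
  have "\<exists>M C. (\<forall>z\<in>S. \<bar>p z\<bar> \<le> M) \<and> C-lipschitz_on S p"
    using assms(1)
  proof induction
    case (linear f)
    then obtain B where "B \<ge> 0" and B: "\<And>z. norm (f z) \<le> norm z * B"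
      using bounded_linear.nonneg_bounded by blast
    then have "B-lipschitz_on S f"
      using linear by (intro lipschitz_onI)
        (auto simp: dist_norm linear_diff[OF bounded_linear.linear, symmetric] mult.commute simp del: real_norm_def)
    moreover have "\<bar>f z\<bar> \<le> R * B" if "z \<in> S" for z
      using B[of z] R[OF that] \<open>B \<ge> 0\<close> mult_right_mono[of "norm z" R B] by simp
    ultimately show ?case by blast
  next
    case (const c)
    then show ?case using lipschitz_on_constant by (intro exI[of _ "\<bar>c\<bar>"] exI[of _ 0]) auto
  next
    case (add f g)
    then obtain M C N D where *: "\<forall>z\<in>S. \<bar>f z\<bar> \<le> M" "C-lipschitz_on S f" "\<forall>z\<in>S. \<bar>g z\<bar> \<le> N" "D-lipschitz_on S g"
      by blast
    then have "(C + D)-lipschitz_on S (\<lambda>z. f z + g z)" by (intro lipschitz_on_add)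
    moreover have "\<bar>f z + g z\<bar> \<le> M + N" if "z \<in> S" for z using *(1,3) that by (smt (verit))
    ultimately show ?case by blast
  next
    case (mult f g)
    then obtain M C N D where *: "\<forall>z\<in>S. \<bar>f z\<bar> \<le> M" "C-lipschitz_on S f" "\<forall>z\<in>S. \<bar>g z\<bar> \<le> N" "D-lipschitz_on S g"
      by blast
    have C: "C \<ge> 0" "D \<ge> 0" using * lipschitz_on_nonneg by blast+
    have "(\<bar>M\<bar> * D + \<bar>N\<bar> * C)-lipschitz_on S (\<lambda>z. f z * g z)"
    proof (rule lipschitz_onI)
      fix z w assume zw: "z \<in> S" "w \<in> S"
      have "dist (f z * g z) (f w * g w) = \<bar>f z * (g z - g w) + g w * (f z - f w)\<bar>"
        by (simp add: dist_real_def algebra_simps)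
      also have "\<dots> \<le> \<bar>f z\<bar> * \<bar>g z - g w\<bar> + \<bar>g w\<bar> * \<bar>f z - f w\<bar>"
        by (metis abs_mult abs_triangle_ineq)
      also have "\<dots> \<le> \<bar>M\<bar> * (D * dist z w) + \<bar>N\<bar> * (C * dist z w)"
        using *(1,3) zw lipschitz_onD[OF *(2) zw] lipschitz_onD[OF *(4) zw]
        by (intro add_mono mult_mono) (auto simp: dist_real_def intro: order_trans[OF _ abs_ge_self])
      finally show "dist (f z * g z) (f w * g w) \<le> (\<bar>M\<bar> * D + \<bar>N\<bar> * C) * dist z w"
        by (simp add: algebra_simps)
    qed (use C in auto)
    moreover have "\<bar>f z * g z\<bar> \<le> \<bar>M\<bar> * \<bar>N\<bar>" if "z \<in> S" for z
      unfolding abs_mult using *(1,3) that by (intro mult_mono) (auto intro: order_trans[OF _ abs_ge_self])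
    ultimately show ?case by blast
  qed
  then show thesis using that by blast
qed

lemma real_polynomial_function_polys_upto:
  fixes V :: "real \<Rightarrow> real^'n \<Rightarrow> real"
  assumes "V \<in> polys_upto d"
  shows "real_polynomial_function (\<lambda>(t, x). V t x)"
proof -
  obtain c where c: "\<And>t x. V t x = (\<Sum>(k, \<alpha>)\<in>exponents d. c (k, \<alpha>) * t ^ k * (\<Prod>i\<in>UNIV. (x $ i) ^ \<alpha> i))"
    using assms unfolding polys_upto_def by blast
  have t: "real_polynomial_function (fst :: real \<times> (real^'n) \<Rightarrow> real)"
    by (intro real_polynomial_function.intros(1) bounded_linear_fst)
  have x: "real_polynomial_function (\<lambda>z :: real \<times> (real^'n). snd z $ i)" for i
    by (intro real_polynomial_function.intros(1) bounded_linear_compose[OF bounded_linear_vec_nth bounded_linear_snd])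
  have "real_polynomial_function (\<lambda>z :: real \<times> (real^'n). \<Sum>ka\<in>exponents d. c ka * fst z ^ fst ka * (\<Prod>i\<in>UNIV. (snd z $ i) ^ snd ka i))"
    by (intro real_polynomial_function_sum finite_exponents real_polynomial_function.intros(2,4)
      real_polynomial_function_prod real_polynomial_function_power t x finite_class.finite_UNIV)
  then show ?thesis by (simp add: c case_prod_unfold)
qed

text \<open>Merges the two partial derivatives in \<open>feasible_R\<close> into one directional
  derivative: the constraint becomes D (1, f t x u) \<ge> -1, the form in which it is both used
  along trajectories and verified for the constructed polynomial. Uniqueness of derivatives resolves
  the description in \<open>gradient\<close>.\<close>

lemma deriv_plus_gradient:
  fixes V :: "real \<Rightarrow> 'a::euclidean_space \<Rightarrow> real"
  assumes V: "((\<lambda>(t, x). V t x) has_derivative D) (at (t, x))"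
  shows "deriv (\<lambda>s. V s x) t + gradient (V t) x \<bullet> a = D (1, a)"
proof -
  have lin: "linear D" using V has_derivative_linear by blast
  have "((\<lambda>s. (\<lambda>(t, x). V t x) (s, x)) has_derivative (\<lambda>h. D (h, 0))) (at t)"
    by (rule has_derivative_compose[of "\<lambda>s. (s, x)", OF _ V]) (auto intro!: derivative_eq_intros)
  moreover have "(\<lambda>h. D (h, 0)) = (*) (D (1, 0))"
  proof
    fix h :: real
    have "D (h, 0) = D (h *\<^sub>R (1, 0))" by simp
    also have "\<dots> = h *\<^sub>R D (1, 0)" by (rule linear_scale[OF lin])
    also have "\<dots> = D (1, 0) * h" by simp
    finally show "D (h, 0) = D (1, 0) * h" .
  qed
  ultimately have t: "deriv (\<lambda>s. V s x) t = D (1, 0)"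
    by (intro DERIV_imp_deriv) (simp add: has_field_derivative_def)
  have D: "((\<lambda>y. (\<lambda>(t, x). V t x) (t, y)) has_derivative (\<lambda>h. D (0, h))) (at x)"
    by (rule has_derivative_compose[of "\<lambda>y. (t, y)", OF _ V]) (auto intro!: derivative_eq_intros)
  have lin2: "linear (\<lambda>h. D (0, h))" using D has_derivative_linear by blast
  define g where "g = (\<Sum>b\<in>Basis. D (0, b) *\<^sub>R b)"
  have g: "D (0, h) = h \<bullet> g" for h
  proof -
    have "D (0, h) = D (0, \<Sum>b\<in>Basis. (h \<bullet> b) *\<^sub>R b)" by (simp add: euclidean_representation)
    also have "\<dots> = (\<Sum>b\<in>Basis. (h \<bullet> b) * D (0, b))"
      by (simp add: linear_sum[OF lin2] linear_scale[OF lin2])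
    finally show ?thesis by (simp add: g_def inner_sum_right mult.commute)
  qed
  have "GDERIV (V t) x :> g" using D by (simp add: gderiv_def g)
  then have "gradient (V t) x = g"
    unfolding gradient_def
  proof (rule the_equality)
    fix g' assume "GDERIV (V t) x :> g'"
    with \<open>GDERIV (V t) x :> g\<close> have "(\<lambda>h. h \<bullet> g') = (\<lambda>h. h \<bullet> g)"
      unfolding gderiv_def by (rule has_derivative_unique[symmetric])
    then show "g' = g" by (metis inner_commute vector_eq_ldot)
  qed
  then have "gradient (V t) x \<bullet> a = D (0, a)" by (simp add: g inner_commute)
  moreover have "D (1, a) = D (1, 0) + D (0, a)"
    using linear_add[OF lin, of "(1, 0)" "(0, a)"] by simp
  ultimately show ?thesis using t by simp
qed

lemma feasible_R_le_time:
  assumes V: "V \<in> feasible_R f X U K T d" and t1: "t\<^sub>1 \<in> {0..T}"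
    and u: "u \<in> admissible_controls f X U K 0 t\<^sub>1 x\<^sub>0"
  shows "V 0 x\<^sub>0 \<le> t\<^sub>1"
proof -
  have Vp: "real_polynomial_function (\<lambda>(t, x). V t x)"
    and Vd: "\<And>t x v. t \<in> {0..T} \<Longrightarrow> x \<in> X \<Longrightarrow> v \<in> U \<Longrightarrow> deriv (\<lambda>s. V s x) t + 1 + gradient (V t) x \<bullet> f t x v \<ge> 0"
    and VK: "\<And>t x. t \<in> {0..T} \<Longrightarrow> x \<in> K \<Longrightarrow> V t x \<le> 0"
    using V real_polynomial_function_polys_upto by (auto simp: feasible_R_def)
  obtain x where tr: "trajectory f 0 t\<^sub>1 x\<^sub>0 u x" and XU: "AE t in lebesgue_on {0..t\<^sub>1}. (x t, u t) \<in> X \<times> U"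
    and xK: "x t\<^sub>1 \<in> K"
    using u unfolding admissible_controls_def by blast
  have ac: "abs_cont_on 0 t\<^sub>1 x" and x0: "x 0 = x\<^sub>0"
    and dx: "AE t in lebesgue_on {0..t\<^sub>1}. (x has_vector_derivative f t (x t) (u t)) (at t within {0..t\<^sub>1})"
    using tr by (auto simp: trajectory_def)
  let ?S = "(\<lambda>t. (t, x t)) ` {0..t\<^sub>1}"
  have "compact ?S"
    using abs_cont_on_imp_continuous_on[OF ac]
    by (intro compact_continuous_image continuous_on_Pair continuous_on_id) auto
  then obtain C where C: "C-lipschitz_on ?S (\<lambda>(t, x). V t x)"
    using real_polynomial_function_lipschitz[OF Vp] compact_imp_bounded by blast
  let ?w = "\<lambda>t. V t (x t)"
  have acw: "abs_cont_on 0 t\<^sub>1 ?w"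
    using abs_cont_on_lipschitz_graph[OF ac C] by simp
  have "AE t in lebesgue_on {0..t\<^sub>1}. t \<in> {0..t\<^sub>1}" by (simp add: AE_restrict_space_iff)
  then have "AE t in lebesgue_on {0..t\<^sub>1}. \<exists>D\<ge>-1. (?w has_real_derivative D) (at t within {0..t\<^sub>1})"
    using dx XU
  proof eventually_elim
    case (elim t)
    obtain D where D: "((\<lambda>(t, x). V t x) has_derivative D) (at (t, x t))"
      using differentiable_at_real_polynomial_function[OF Vp] differentiable_def by blast
    have "((\<lambda>s. (\<lambda>(t, x). V t x) (s, x s)) has_derivative (\<lambda>h. D (h, h *\<^sub>R f t (x t) (u t)))) (at t within {0..t\<^sub>1})"
      using elim(2) by (intro has_derivative_compose[of "\<lambda>s. (s, x s)", OF _ D] has_derivative_Pair)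
        (auto simp: has_vector_derivative_def)
    moreover have "D (h, h *\<^sub>R f t (x t) (u t)) = D (1, f t (x t) (u t)) * h" for h
      using linear_scale[OF has_derivative_linear[OF D], of h "(1, f t (x t) (u t))"] by (simp add: mult.commute)
    ultimately have "(?w has_real_derivative D (1, f t (x t) (u t))) (at t within {0..t\<^sub>1})"
      by (simp add: has_field_derivative_def)
    moreover have "D (1, f t (x t) (u t)) \<ge> -1"
      using deriv_plus_gradient[OF D, of "f t (x t) (u t)"] Vd[of t "x t" "u t"] elim t1 by auto
    ultimately show ?case by blast
  qed
  then have "- 1 * (t\<^sub>1 - 0) \<le> ?w t\<^sub>1 - ?w 0"
    using t1 by (intro abs_cont_derivative_lower_bound[OF acw]) auto
  then show ?thesis using VK[OF t1 xK] x0 by simp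
qed

lemma val_R_le_value_function: "val_R f X U K T x\<^sub>0 d \<le> value_function f X U K T 0 x\<^sub>0"
  unfolding val_R_def value_function_def
proof (rule SUP_least, rule Inf_greatest)
  fix V c assume V: "V \<in> feasible_R f X U K T d"
    and "c \<in> {ereal (t\<^sub>1 - 0) | t\<^sub>1 u. t\<^sub>1 \<in> {0..T} \<and> u \<in> admissible_controls f X U K 0 t\<^sub>1 x\<^sub>0}"
  then obtain t\<^sub>1 u where "c = ereal t\<^sub>1" "t\<^sub>1 \<in> {0..T}" "u \<in> admissible_controls f X U K 0 t\<^sub>1 x\<^sub>0"
    unfolding mem_Collect_eq diff_zero by blast
  then show "ereal (V 0 x\<^sub>0) \<le> c" using feasible_R_le_time[OF V] by simp
qed

section \<open>Polynomials and their degrees\<close>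

definition monom_fun :: "nat \<times> ('n::finite \<Rightarrow> nat) \<Rightarrow> real \<Rightarrow> real^'n \<Rightarrow> real" where
  "monom_fun m t x = t ^ fst m * (\<Prod>i\<in>UNIV. (x $ i) ^ snd m i)"

lemma polys_upto_alt:
  "V \<in> polys_upto d \<longleftrightarrow> (\<exists>c. \<forall>t x. V t x = (\<Sum>m\<in>exponents d. c m * monom_fun m t x))"
  unfolding polys_upto_def monom_fun_def by (simp add: case_prod_unfold mult.assoc)

lemma exponents_mono: "d \<le> d' \<Longrightarrow> exponents d \<subseteq> exponents d'"
  by (auto simp: exponents_def)

lemma polys_upto_mono:
  assumes "d \<le> d'" shows "polys_upto d \<subseteq> (polys_upto d' :: (real \<Rightarrow> real^'n \<Rightarrow> real) set)"
proof
  fix V :: "real \<Rightarrow> real^'n \<Rightarrow> real" assume "V \<in> polys_upto d"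
  then obtain c where c: "\<And>t x. V t x = (\<Sum>m\<in>exponents d. c m * monom_fun m t x)"
    unfolding polys_upto_alt by blast
  have "V t x = (\<Sum>m\<in>exponents d'. (if m \<in> exponents d then c m else 0) * monom_fun m t x)" for t x
    unfolding c using exponents_mono[OF assms]
    by (intro sum.mono_neutral_cong_left finite_exponents) auto
  then show "V \<in> polys_upto d'"
    unfolding polys_upto_alt by (intro exI[of _ "\<lambda>m. if m \<in> exponents d then c m else 0"] allI)
qed

lemma polys_upto_add:
  assumes "V \<in> polys_upto d" "W \<in> polys_upto d"
  shows "(\<lambda>t x. V t x + W t x) \<in> polys_upto d"
proof -
  obtain b c where "\<And>t x. V t x = (\<Sum>m\<in>exponents d. b m * monom_fun m t x)"
     "\<And>t x. W t x = (\<Sum>m\<in>exponents d. c m * monom_fun m t x)"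
    using assms unfolding polys_upto_alt by blast
  then show ?thesis
    unfolding polys_upto_alt by (intro exI[of _ "\<lambda>m. b m + c m"]) (simp add: sum.distrib distrib_right)
qed

lemma polys_upto_scale:
  assumes "V \<in> polys_upto d"
  shows "(\<lambda>t x. a * V t x) \<in> polys_upto d"
proof -
  obtain b where "\<And>t x. V t x = (\<Sum>m\<in>exponents d. b m * monom_fun m t x)"
    using assms unfolding polys_upto_alt by blast
  then show ?thesis
    unfolding polys_upto_alt by (intro exI[of _ "\<lambda>m. a * b m"]) (simp add: sum_distrib_left mult.assoc)
qed

lemma polys_upto_sum:
  assumes "finite I" "\<And>i. i \<in> I \<Longrightarrow> V i \<in> polys_upto d"
  shows "(\<lambda>t x. \<Sum>i\<in>I. V i t x) \<in> polys_upto d"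
  using assms
proof induction
  case empty
  then show ?case unfolding polys_upto_alt by (intro exI[of _ "\<lambda>_. 0"]) simp
qed (auto intro: polys_upto_add)

lemma monom_fun_in_polys_upto: "m \<in> exponents d \<Longrightarrow> monom_fun m \<in> polys_upto d"
  unfolding polys_upto_alt
  by (intro exI[of _ "\<lambda>m'. if m' = m then 1 else 0"])
    (simp add: finite_exponents if_distrib[of "\<lambda>c. c * _"] cong: if_cong)

lemma polys_upto_mult:
  assumes "V \<in> polys_upto d" "W \<in> polys_upto d'"
  shows "(\<lambda>t x. V t x * W t x) \<in> polys_upto (d + d')"
proof -
  obtain b c where V: "\<And>t x. V t x = (\<Sum>m\<in>exponents d. b m * monom_fun m t x)"
    and W: "\<And>t x. W t x = (\<Sum>m\<in>exponents d'. c m * monom_fun m t x)"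
    using assms unfolding polys_upto_alt by blast
  let ?a = "\<lambda>m m' :: nat \<times> ('a \<Rightarrow> nat). (fst m + fst m', \<lambda>i. snd m i + snd m' i)"
  have prod: "monom_fun m t x * monom_fun m' t x = monom_fun (?a m m') t x" for m m' t x
    by (simp add: monom_fun_def power_add prod.distrib)
  have "?a m m' \<in> exponents (d + d')" if "m \<in> exponents d" "m' \<in> exponents d'" for m m'
    using that by (auto simp: exponents_def sum.distrib)
  then have "(\<lambda>t x. \<Sum>m\<in>exponents d. \<Sum>m'\<in>exponents d'. b m * c m' * monom_fun (?a m m') t x) \<in> polys_upto (d + d')"
    by (intro polys_upto_sum finite_exponents polys_upto_scale monom_fun_in_polys_upto)
  also have "(\<lambda>t x. \<Sum>m\<in>exponents d. \<Sum>m'\<in>exponents d'. b m * c m' * monom_fun (?a m m') t x) = (\<lambda>t x. V t x * W t x)"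
    by (simp add: V W sum_product prod[symmetric] mult_ac)
  finally show ?thesis .
qed

text \<open>Leads from the inductive notion of polynomial, convenient for constructions, to
  coefficient sums. Some degree suffices, because the limit in \<open>d\<close> calls for no
  rate.\<close>

lemma real_polynomial_function_imp_polys_upto:
  fixes P :: "real \<times> (real^'n) \<Rightarrow> real"
  assumes "real_polynomial_function P"
  shows "\<exists>d. (\<lambda>t x. P (t, x)) \<in> polys_upto d"
  using assms
proof induction
  case (linear P)
  let ?e = "\<lambda>j. (0, \<lambda>i. if i = j then 1 else 0) :: nat \<times> ('n \<Rightarrow> nat)"
  let ?Q = "\<lambda>t x. P (1, 0) * monom_fun (1, \<lambda>_. 0) t x + (\<Sum>j\<in>UNIV. P (0, axis j 1) * monom_fun (?e j) t x)"
  interpret P: linear P using linear by (rule bounded_linear.linear)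
  have "(\<lambda>t x. P (t, x)) = ?Q"
  proof (intro ext)
    fix t :: real and x :: "real^'n"
    have "(t, x) = t *\<^sub>R (1, 0) + (\<Sum>j\<in>UNIV. (x $ j) *\<^sub>R (0, axis j 1))"
    proof (rule prod_eqI)
      show "snd (t, x) = snd (t *\<^sub>R (1, 0) + (\<Sum>j\<in>UNIV. (x $ j) *\<^sub>R (0 :: real, axis j (1 :: real))))"
        using basis_expansion[of x] by (simp add: snd_sum scalar_mult_eq_scaleR)
    qed (simp add: fst_sum)
    then have "P (t, x) = P (t *\<^sub>R (1, 0) + (\<Sum>j\<in>UNIV. (x $ j) *\<^sub>R (0, axis j 1)))" by simp
    also have "\<dots> = t * P (1, 0) + (\<Sum>j\<in>UNIV. (x $ j) * P (0, axis j 1))"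
      unfolding P.add P.sum P.scale by simp
    also have "\<dots> = ?Q t x"
    proof -
      have "monom_fun (?e j) t x = x $ j" for j
      proof -
        have "(\<Prod>i\<in>UNIV. (x $ i) ^ (if i = j then 1 else 0)) = (\<Prod>i\<in>UNIV. if i = j then x $ i else 1)"
          by (intro prod.cong) auto
        then show ?thesis by (simp add: monom_fun_def)
      qed
      moreover have "monom_fun (1, \<lambda>_. 0) t x = t" by (simp add: monom_fun_def)
      ultimately show ?thesis by (simp add: mult.commute)
    qed
    finally show "P (t, x) = ?Q t x" .
  qed
  moreover have "?Q \<in> polys_upto 1"
    by (intro polys_upto_add polys_upto_scale polys_upto_sum monom_fun_in_polys_upto)
      (auto simp: exponents_def)
  ultimately show ?case by metis
next
  case (const c)
  have "(\<lambda>t x. c * monom_fun (0, \<lambda>_. 0) t x) \<in> (polys_upto 0 :: (real \<Rightarrow> real^'n \<Rightarrow> real) set)"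
    by (intro polys_upto_scale monom_fun_in_polys_upto) (simp add: exponents_def)
  then show ?case by (auto simp: monom_fun_def)
next
  case (add P Q)
  then obtain d d' where "(\<lambda>t x. P (t, x)) \<in> polys_upto d" "(\<lambda>t x. Q (t, x)) \<in> polys_upto d'" by blast
  then have "(\<lambda>t x. P (t, x)) \<in> polys_upto (max d d')" "(\<lambda>t x. Q (t, x)) \<in> polys_upto (max d d')"
    using polys_upto_mono max.cobounded1 max.cobounded2 by blast+
  then show ?case using polys_upto_add by blast
next
  case (mult P Q)
  then show ?case using polys_upto_mult by blast
qed

text \<open>Makes \<open>val_R\<close> nondecreasing in the degree, so one good polynomial settles
  all larger \<open>d\<close>.\<close>

lemma feasible_R_mono: "d \<le> d' \<Longrightarrow> feasible_R f X U K T d \<subseteq> feasible_R f X U K T d'"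
  using polys_upto_mono by (auto simp: feasible_R_def)

section \<open>Polynomial mollification by the Landau kernel\<close>

lemma integrable_continuous_bounded_support:
  fixes h :: "'a::euclidean_space \<Rightarrow> real"
  assumes "continuous_on UNIV h" "\<And>w. R < norm w \<Longrightarrow> h w = 0"
  shows "integrable lborel h"
proof -
  have "integrable lborel (\<lambda>w. indicator (cball 0 R) w *\<^sub>R h w)"
    by (rule borel_integrable_compact) (use assms(1) continuous_on_subset in auto)
  also have "(\<lambda>w. indicator (cball 0 R) w *\<^sub>R h w) = h"
  proof
    fix w show "indicator (cball 0 R) w *\<^sub>R h w = h w"
      using assms(2)[of w] by (cases "norm w \<le> R") auto
  qed
  finally show ?thesis .
qed

lemma integral_lborel_translation:
  fixes g :: "'a::euclidean_space \<Rightarrow> real"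
  assumes "g \<in> borel_measurable borel"
  shows "(LINT w|lborel. g w) = (LINT y|lborel. g (c + y))"
proof -
  have "(LINT w|lborel. g w) = (LINT w|distr lborel borel ((+) c). g w)"
    by (simp add: lborel_distr_plus)
  also have "\<dots> = (LINT y|lborel. g (c + y))"
    using assms by (intro integral_distr) auto
  finally show ?thesis .
qed

text \<open>One factor of the kernel separates into functions of \<open>z\<close> and of \<open>w\<close>; the induction absorbs the latter into \<open>\<psi>\<close>.\<close>

lemma landau_integral_polynomial:
  fixes \<psi> :: "'a::euclidean_space \<Rightarrow> real"
  assumes "continuous_on UNIV \<psi>" "\<And>w. R\<^sub>0 < norm w \<Longrightarrow> \<psi> w = 0"
  shows "real_polynomial_function (\<lambda>z. LINT w|lborel. \<psi> w * (1 - k * (norm (w - z))\<^sup>2) ^ N)"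
  using assms
proof (induction N arbitrary: \<psi>)
  case 0
  then show ?case by (simp add: real_polynomial_function.intros)
next
  case (Suc N)
  let ?I = "\<lambda>\<psi> z. LINT w|lborel. \<psi> w * (1 - k * (norm (w - z))\<^sup>2) ^ N"
  let ?B = "\<lambda>w. \<psi> w * (1 - k * (w \<bullet> w))"
  let ?C = "\<lambda>b w. \<psi> w * (2 * k * (w \<bullet> b))"
  have int: "integrable lborel (\<lambda>w. g w * (1 - k * (norm (w - z))\<^sup>2) ^ N)"
    if "continuous_on UNIV g" "\<And>w. R\<^sub>0 < norm w \<Longrightarrow> g w = 0" for g z
    using that by (intro integrable_continuous_bounded_support[where R = R\<^sub>0] continuous_intros) auto
  have cont: "continuous_on UNIV ?B" "\<And>b. continuous_on UNIV (?C b)"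
    using Suc.prems by (auto intro!: continuous_intros)
  have supp: "?B w = 0" "?C b w = 0" if "R\<^sub>0 < norm w" for b w
    using Suc.prems that by auto
  have "(LINT w|lborel. \<psi> w * (1 - k * (norm (w - z))\<^sup>2) ^ Suc N)
      = ?I ?B z - k * (z \<bullet> z) * ?I \<psi> z + (\<Sum>b\<in>Basis. (z \<bullet> b) * ?I (?C b) z)" for z
  proof -
    have "\<psi> w * (1 - k * (norm (w - z))\<^sup>2) ^ Suc N
        = ?B w * (1 - k * (norm (w - z))\<^sup>2) ^ N - k * (z \<bullet> z) * (\<psi> w * (1 - k * (norm (w - z))\<^sup>2) ^ N)
          + (\<Sum>b\<in>Basis. (z \<bullet> b) * (?C b w * (1 - k * (norm (w - z))\<^sup>2) ^ N))" for w
    proof -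
      define E where "E = (1 - k * (norm (w - z))\<^sup>2) ^ N"
      have "1 - k * (norm (w - z))\<^sup>2 = 1 - k * (w \<bullet> w) - k * (z \<bullet> z) + 2 * k * (w \<bullet> z)"
        by (simp add: power2_norm_eq_inner inner_diff_left inner_diff_right inner_commute algebra_simps)
      then have "\<psi> w * (1 - k * (norm (w - z))\<^sup>2) ^ Suc N
          = \<psi> w * (1 - k * (w \<bullet> w) - k * (z \<bullet> z) + 2 * k * (w \<bullet> z)) * E"
        by (simp add: E_def)
      also have "\<dots> = ?B w * E - k * (z \<bullet> z) * (\<psi> w * E) + \<psi> w * (2 * k * (w \<bullet> z)) * E"
        by (simp add: algebra_simps)
      also have "w \<bullet> z = (\<Sum>b\<in>Basis. (w \<bullet> b) * (z \<bullet> b))" by (rule euclidean_inner)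
      also have "\<psi> w * (2 * k * (\<Sum>b\<in>Basis. (w \<bullet> b) * (z \<bullet> b))) * E = (\<Sum>b\<in>Basis. (z \<bullet> b) * (?C b w * E))"
        by (simp add: sum_distrib_left sum_distrib_right mult_ac)
      finally show ?thesis by (simp only: E_def)
    qed
    then show ?thesis
      using int[OF cont(1) supp(1)] int[OF cont(2) supp(2)] int[OF Suc.prems] by simp
  qed
  moreover have "real_polynomial_function (\<lambda>z :: 'a. z \<bullet> b)" for b
    by (intro real_polynomial_function.intros bounded_linear_inner_left)
  moreover have "real_polynomial_function (\<lambda>z :: 'a. z \<bullet> z)"
  proof -
    have "real_polynomial_function (\<lambda>z :: 'a. \<Sum>b\<in>Basis. (z \<bullet> b) * (z \<bullet> b))"
      by (intro real_polynomial_function_sum real_polynomial_function.intros bounded_linear_inner_left) auto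
    then show ?thesis by (simp add: euclidean_inner[symmetric])
  qed
  ultimately show ?case
    using Suc.IH[OF cont(1) supp(1)] Suc.IH[OF cont(2) supp(2)] Suc.IH[OF Suc.prems]
    by (auto intro!: real_polynomial_function_sum real_polynomial_function_diff real_polynomial_function.intros(2-))
qed

text \<open>The base 1 - |y|^2 / R^2 is at most \<open>a\<close> outside radius \<open>d\<close> and
  at least \<open>b > a\<close> inside radius \<open>d / 2\<close>. After normalisation the tail
  mass is therefore at most a constant times \<open>(a / b) ^ N\<close>.\<close>

lemma landau_kernel_concentrates:
  fixes R \<delta> e :: real
  assumes "R > 0" "\<delta> > 0" "e > 0"
  obtains N c where
    "integrable lborel (\<lambda>y::'a::euclidean_space. indicator (cball 0 R) y * (c * (1 - (norm y)\<^sup>2 / R\<^sup>2) ^ N))"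
    "(LINT y::'a|lborel. indicator (cball 0 R) y * (c * (1 - (norm y)\<^sup>2 / R\<^sup>2) ^ N)) = 1"
    "(LINT y::'a|lborel. indicator {y. \<delta> < norm y} y * (indicator (cball 0 R) y * (c * (1 - (norm y)\<^sup>2 / R\<^sup>2) ^ N))) \<le> e"
    "c > 0"
proof -
  \<comment> \<open>Passing from \<delta> to a smaller radius only enlarges the tail to be
    estimated, and \<open>d < R\<close> keeps the base \<open>a\<close> nonnegative.\<close>
  define d where "d = min \<delta> (R / 2)"
  have d: "0 < d" "d \<le> \<delta>" "d < R" using assms by (auto simp: d_def)
  define q where "q = (\<lambda>N (y::'a). indicator (cball 0 R) y * (1 - (norm y)\<^sup>2 / R\<^sup>2) ^ N)"
  have q0: "q N y \<ge> 0" for N y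
  proof (cases "norm y \<le> R")
    case True
    then have "(norm y)\<^sup>2 \<le> R\<^sup>2" by (simp add: power_mono)
    then show ?thesis using \<open>R > 0\<close> by (simp add: q_def)
  qed (simp add: q_def)
  have "integrable lborel (\<lambda>y. indicator (cball 0 R) y *\<^sub>R (1 - (norm y)\<^sup>2 / R\<^sup>2) ^ N)" for N
    using \<open>R > 0\<close> by (intro borel_integrable_compact continuous_intros) auto
  then have qint: "integrable lborel (q N)" for N by (simp add: q_def)
  have fin: "emeasure lborel (cball 0 r :: 'a set) < \<infinity>" "emeasure lborel (ball 0 r :: 'a set) < \<infinity>" for r
    using emeasure_bounded_finite by (metis bounded_cball, metis bounded_ball)
  define a where "a = 1 - d\<^sup>2 / R\<^sup>2"
  define b where "b = 1 - (d / 2)\<^sup>2 / R\<^sup>2"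
  have "d\<^sup>2 < R\<^sup>2" using d by (simp add: power_strict_mono)
  then have a: "0 \<le> a" using assms by (simp add: a_def)
  have ab: "a < b" using d assms by (simp add: a_def b_def power_divide field_simps)
  define v where "v = measure lborel (ball 0 (d/2) :: 'a set)"
  define V where "V = measure lborel (cball 0 R :: 'a set)"
  have v: "v > 0" using content_ball_pos[of "d/2" "0::'a"] d by (simp add: v_def)
  have lower: "v * b ^ N \<le> (LINT y|lborel. q N y)" for N
  proof -
    have "v * b ^ N = (LINT y|lborel. indicator (ball 0 (d/2) :: 'a set) y * b ^ N)"
      using fin by (simp add: v_def)
    also have "\<dots> \<le> (LINT y|lborel. q N y)"
    proof (rule integral_mono[OF _ qint])
      show "integrable lborel (\<lambda>y. indicator (ball 0 (d/2) :: 'a set) y * b ^ N)" using fin by simp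
      fix y :: 'a
      show "indicator (ball 0 (d/2)) y * b ^ N \<le> q N y"
      proof (cases "norm y < d / 2")
        case True
        then have "(norm y)\<^sup>2 / R\<^sup>2 \<le> (d/2)\<^sup>2 / R\<^sup>2" by (intro divide_right_mono power_mono) auto
        then have "b ^ N \<le> (1 - (norm y)\<^sup>2 / R\<^sup>2) ^ N"
          using a ab by (intro power_mono) (auto simp: b_def)
        then show ?thesis using True d by (simp add: q_def)
      qed (use q0 in simp)
    qed
    finally show ?thesis .
  qed
  have upper: "(LINT y|lborel. indicator {y. \<delta> < norm y} y * q N y) \<le> V * a ^ N" for N
  proof -
    have "(LINT y|lborel. indicator {y. \<delta> < norm y} y * q N y) \<le> (LINT y|lborel. indicator (cball 0 R :: 'a set) y * a ^ N)"
    proof (rule integral_mono)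
      show "integrable lborel (\<lambda>y. indicator {y. \<delta> < norm y} y * q N y)"
        using integrable_mult_indicator[OF _ qint, of "{y. \<delta> < norm y}"] by simp
      show "integrable lborel (\<lambda>y. indicator (cball 0 R :: 'a set) y * a ^ N)" using fin by simp
      fix y :: 'a
      show "indicator {y. \<delta> < norm y} y * q N y \<le> indicator (cball 0 R) y * a ^ N"
      proof (cases "\<delta> < norm y \<and> norm y \<le> R")
        case True
        then have "d\<^sup>2 / R\<^sup>2 \<le> (norm y)\<^sup>2 / R\<^sup>2" using d by (intro divide_right_mono power_mono) auto
        moreover have "(norm y)\<^sup>2 / R\<^sup>2 \<le> 1" using True assms by (simp add: power_mono)
        ultimately have "(1 - (norm y)\<^sup>2 / R\<^sup>2) ^ N \<le> a ^ N"
          by (intro power_mono) (auto simp: a_def)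
        then show ?thesis using True by (simp add: q_def)
      qed (use a in \<open>auto simp: q_def indicator_def\<close>)
    qed
    also have "\<dots> = V * a ^ N" using fin by (simp add: V_def)
    finally show ?thesis .
  qed
  have "(\<lambda>N. V / v * (a / b) ^ N) \<longlonglongrightarrow> V / v * 0"
    using a ab by (intro tendsto_intros LIMSEQ_realpow_zero) auto
  then have "eventually (\<lambda>N. V / v * (a / b) ^ N < e) sequentially"
    using \<open>e > 0\<close> by (intro order_tendstoD) auto
  then obtain N where N: "V / v * (a / b) ^ N < e" using eventually_happens by fastforce
  define I where "I = (LINT y|lborel. q N y)"
  have bN: "b ^ N > 0" using a ab by simp
  then have I: "I > 0" using lower[of N] v mult_pos_pos[of v "b ^ N"] unfolding I_def by linarith
  have eq: "indicator (cball 0 R) y * (1 / I * (1 - (norm y)\<^sup>2 / R\<^sup>2) ^ N) = q N y / I" for y :: 'a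
    by (simp add: q_def)
  show thesis
  proof (rule that[of "1 / I" N])
    show "integrable lborel (\<lambda>y::'a. indicator (cball 0 R) y * (1 / I * (1 - (norm y)\<^sup>2 / R\<^sup>2) ^ N))"
      unfolding eq using qint by simp
    show "(LINT y::'a|lborel. indicator (cball 0 R) y * (1 / I * (1 - (norm y)\<^sup>2 / R\<^sup>2) ^ N)) = 1"
      unfolding eq using I by (simp add: I_def)
    have "(LINT y|lborel. indicator {y. \<delta> < norm y} y * (q N y / I)) = (LINT y|lborel. indicator {y. \<delta> < norm y} y * q N y) / I"
      by simp
    also have "\<dots> \<le> (V * a ^ N) / (v * b ^ N)"
      using upper[of N] lower[of N] v bN a by (intro frac_le) (auto simp: I_def V_def)
    also have "\<dots> \<le> e" using N by (simp add: power_divide)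
    finally show "(LINT y::'a|lborel. indicator {y. \<delta> < norm y} y * (indicator (cball 0 R) y * (1 / I * (1 - (norm y)\<^sup>2 / R\<^sup>2) ^ N))) \<le> e"
      unfolding eq .
  qed (use I in simp)
qed

text \<open>The estimates need a nonnegative kernel \<open>p\<close>, hence a truncated one, while
  polynomiality in \<open>z\<close> comes from the untruncated power. With
  \<open>R = R\<^sub>0 + R\<^sub>1\<close> the two integrals agree for
  \<open>norm z \<le> R\<^sub>1\<close>: if \<open>norm y > R\<close> then
  \<open>norm (z + y) > R\<^sub>0\<close>, where \<phi> vanishes.\<close>

lemma polynomial_mollification:
  fixes \<phi> :: "'a::euclidean_space \<Rightarrow> real"
  assumes \<phi>: "continuous_on UNIV \<phi>" "\<And>w. R\<^sub>0 < norm w \<Longrightarrow> \<phi> w = 0"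
    and pos: "R\<^sub>0 > 0" "R\<^sub>1 > 0" "\<delta> > 0" "e > 0"
  obtains Q p where "real_polynomial_function Q" "\<And>y. p y \<ge> 0" "integrable lborel p" "(LINT y|lborel. p y) = 1"
    "(LINT y|lborel. indicator {y. \<delta> < norm y} y * p y) \<le> e"
    "\<And>z. norm z \<le> R\<^sub>1 \<Longrightarrow> Q z = (LINT y|lborel. \<phi> (z + y) * p y)"
proof -
  define R where "R = R\<^sub>0 + R\<^sub>1"
  have R: "R > 0" using pos by (simp add: R_def)
  obtain N c where Nc:
    "integrable lborel (\<lambda>y::'a::euclidean_space. indicator (cball 0 R) y * (c * (1 - (norm y)\<^sup>2 / R\<^sup>2) ^ N))"
    "(LINT y::'a|lborel. indicator (cball 0 R) y * (c * (1 - (norm y)\<^sup>2 / R\<^sup>2) ^ N)) = 1"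
    "(LINT y::'a|lborel. indicator {y. \<delta> < norm y} y * (indicator (cball 0 R) y * (c * (1 - (norm y)\<^sup>2 / R\<^sup>2) ^ N))) \<le> e"
    "c > 0"
    by (rule landau_kernel_concentrates[OF R pos(3,4)])
  define q where "q = (\<lambda>y::'a. c * (1 - (norm y)\<^sup>2 / R\<^sup>2) ^ N)"
  define p where "p = (\<lambda>y::'a. indicator (cball 0 R) y * q y)"
  define Q where "Q = (\<lambda>z. c * (LINT w|lborel. \<phi> w * (1 - 1 / R\<^sup>2 * (norm (w - z))\<^sup>2) ^ N))"
  show thesis
  proof (rule that[of Q p])
    show "real_polynomial_function Q"
      unfolding Q_def using landau_integral_polynomial[OF \<phi>] by (intro real_polynomial_function.intros(2,4))
    show "p y \<ge> 0" for y
    proof (cases "norm y \<le> R")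
      case True
      then have "(norm y)\<^sup>2 \<le> R\<^sup>2" by (simp add: power_mono)
      then show ?thesis using R \<open>c > 0\<close> by (simp add: p_def q_def)
    qed (simp add: p_def)
    show "integrable lborel p" "(LINT y|lborel. p y) = 1"
      "(LINT y|lborel. indicator {y. \<delta> < norm y} y * p y) \<le> e"
      using Nc by (simp_all add: p_def q_def)
    show "Q z = (LINT y|lborel. \<phi> (z + y) * p y)" if z: "norm z \<le> R\<^sub>1" for z
    proof -
      have "Q z = (LINT w|lborel. \<phi> w * q (w - z))"
        by (simp add: Q_def q_def mult.left_commute flip: integral_mult_right_zero)
      also have "\<dots> = (LINT y|lborel. \<phi> (z + y) * q (z + y - z))"
        using \<phi>(1) by (intro integral_lborel_translation borel_measurable_continuous_onI)
          (use R in \<open>auto simp: q_def intro!: continuous_intros\<close>)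
      also have "\<dots> = (LINT y|lborel. \<phi> (z + y) * p y)"
      proof (rule Bochner_Integration.integral_cong)
        fix y :: 'a
        show "\<phi> (z + y) * q (z + y - z) = \<phi> (z + y) * p y"
        proof (cases "norm y \<le> R")
          case False
          then have "R\<^sub>0 < norm (z + y)"
            using norm_triangle_ineq4[of "z + y" z] z by (simp add: R_def)
          then show ?thesis using \<phi>(2) by simp
        qed (simp add: p_def)
      qed simp
      finally show ?thesis .
    qed
  qed
qed

text \<open>Splits a mollification error: \<alpha> is the bound near the centre of the kernel,
  \<beta> the excess tolerated on the tail \<open>S\<close>, which is charged only with the small
  mass \<open>e\<close>.\<close>

lemma kernel_average_le:
  fixes p h :: "'a::euclidean_space \<Rightarrow> real"
  assumes p: "integrable lborel p" "\<And>y. 0 \<le> p y" "(LINT y|lborel. p y) = 1"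
    and tail: "(LINT y|lborel. indicator S y * p y) \<le> e" and S: "S \<in> sets borel"
    and hp: "integrable lborel (\<lambda>y. h y * p y)"
    and h: "\<And>y. h y \<le> \<alpha> + \<beta> * indicator S y" and \<beta>: "0 \<le> \<beta>"
  shows "(LINT y|lborel. h y * p y) \<le> \<alpha> + \<beta> * e"
proof -
  have int: "integrable lborel (\<lambda>y. indicator S y * p y)"
    using integrable_mult_indicator[OF _ p(1), of S] S by simp
  have "(LINT y|lborel. h y * p y) \<le> (LINT y|lborel. \<alpha> * p y + \<beta> * (indicator S y * p y))"
  proof (rule integral_mono[OF hp])
    show "integrable lborel (\<lambda>y. \<alpha> * p y + \<beta> * (indicator S y * p y))" using p(1) int by simp
    show "h y * p y \<le> \<alpha> * p y + \<beta> * (indicator S y * p y)" for y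
      using mult_right_mono[OF h[of y] p(2)[of y]] by (simp add: algebra_simps)
  qed
  also have "\<dots> = \<alpha> * (LINT y|lborel. p y) + \<beta> * (LINT y|lborel. indicator S y * p y)"
    using p(1) int by simp
  also have "\<dots> \<le> \<alpha> + \<beta> * e" using p(3) mult_left_mono[OF tail \<beta>] by simp
  finally show ?thesis .
qed

text \<open>The return from the difference form of the Hamilton-Jacobi inequality to the
  differential one, once the function is smooth.\<close>

lemma has_derivative_direction_ge:
  fixes Q :: "'a::real_normed_vector \<Rightarrow> real"
  assumes D: "(Q has_derivative D) (at z)" and "0 < r"
    and Q: "\<And>s. 0 < s \<Longrightarrow> s \<le> r \<Longrightarrow> c * s \<le> Q (z + s *\<^sub>R a) - Q z"
  shows "c \<le> D a"
proof -
  have "((\<lambda>s. Q (z + s *\<^sub>R a)) has_derivative (\<lambda>s. D (s *\<^sub>R a))) (at 0)"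
    by (rule has_derivative_compose[of "\<lambda>s. z + s *\<^sub>R a", of _ 0]) (use D in \<open>auto intro!: derivative_eq_intros\<close>)
  moreover have "(\<lambda>s. D (s *\<^sub>R a)) = (*) (D a)"
  proof
    fix s
    have "D (s *\<^sub>R a) = s *\<^sub>R D a" by (rule linear_scale[OF has_derivative_linear[OF D]])
    then show "D (s *\<^sub>R a) = D a * s" by (simp add: mult.commute)
  qed
  ultimately have "((\<lambda>s. Q (z + s *\<^sub>R a)) has_real_derivative D a) (at 0)"
    by (simp add: has_field_derivative_def)
  then have "((\<lambda>s. (Q (z + s *\<^sub>R a) - Q z) / s) \<longlongrightarrow> D a) (at_right 0)"
    by (simp add: DERIV_def) (blast intro: tendsto_within_subset)
  moreover have "eventually (\<lambda>s. c \<le> (Q (z + s *\<^sub>R a) - Q z) / s) (at_right 0)"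
    using eventually_at_right_less[of 0] eventually_at_right_real[OF \<open>0 < r\<close>]
    by eventually_elim (use Q in \<open>auto simp: pos_le_divide_eq\<close>)
  ultimately show ?thesis by (intro tendsto_lowerbound) auto
qed

section \<open>Penalised values of Euler polygons\<close>

text \<open>A chain is a list of pairs of a step length and a control value held constant along that Euler step.
  Allowing arbitrary step lengths below \<open>\<eta>\<close> makes the dynamic programming inequality exact for every small step.\<close>

locale euler_chains =
  fixes F :: "'a::euclidean_space \<Rightarrow> 'b \<Rightarrow> 'a" and U :: "'b set" and A K :: "'a set" and L B M :: real
  assumes B_nonneg: "0 \<le> B" and L_nonneg: "0 \<le> L" and M_pos: "0 < M"
    and F_bound: "\<And>y v. v \<in> U \<Longrightarrow> norm (F y v) \<le> B"
    and F_lipschitz: "\<And>y z v. v \<in> U \<Longrightarrow> norm (F y v - F z v) \<le> L * norm (y - z)"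
    and closed_A: "closed A" and closed_K: "closed K" and K_nonempty: "K \<noteq> {}" and K_subset_A: "K \<subseteq> A"
begin

definition chains :: "real \<Rightarrow> (real \<times> 'b) list set" where
  "chains \<eta> = {l. \<forall>(h, v)\<in>set l. 0 \<le> h \<and> h \<le> \<eta> \<and> v \<in> U}"

abbreviation duration :: "(real \<times> 'b) list \<Rightarrow> real" where
  "duration l \<equiv> sum_list (map fst l)"

text \<open>The integral of \<open>G\<close> along the polygon up to time \<open>s\<close>, with
  \<open>G\<close> frozen at the initial node of each step. \<open>F\<close> gives the displacement
  and the distance to \<open>A\<close> gives the penalty, so one estimate serves both. Past the last
  step the value stays constant.\<close>

primrec accum :: "('a \<Rightarrow> 'b \<Rightarrow> 'c::real_vector) \<Rightarrow> 'a \<Rightarrow> (real \<times> 'b) list \<Rightarrow> real \<Rightarrow> 'c" where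
  "accum G z [] s = 0"
| "accum G z (hv # l) s =
     (if s \<le> fst hv then s *\<^sub>R G z (snd hv)
      else fst hv *\<^sub>R G z (snd hv) + accum G (z + fst hv *\<^sub>R F z (snd hv)) l (s - fst hv))"

definition polygon :: "'a \<Rightarrow> (real \<times> 'b) list \<Rightarrow> real \<Rightarrow> 'a" where
  "polygon z l s = z + accum F z l s"

text \<open>The state penalty is read at the node where a step starts, so the cost of a prefixed
  step does not depend on its control. The cap \<open>M\<close> applies to the terminal penalty
  alone, yet it bounds the value function, because the empty chain competes.\<close>

primrec chain_cost :: "real \<Rightarrow> 'a \<Rightarrow> (real \<times> 'b) list \<Rightarrow> real" where
  "chain_cost k z [] = min M (k * infdist z K)"
| "chain_cost k z (hv # l) = fst hv * (1 + k * infdist z A) + chain_cost k (z + fst hv *\<^sub>R F z (snd hv)) l"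

lemma Nil_in_chains [simp]: "[] \<in> chains \<eta>"
  by (simp add: chains_def)

lemma Cons_in_chains [simp]: "(h, v) # l \<in> chains \<eta> \<longleftrightarrow> 0 \<le> h \<and> h \<le> \<eta> \<and> v \<in> U \<and> l \<in> chains \<eta>"
  by (auto simp: chains_def)

lemma chains_induct [consumes 1, case_names Nil Cons]:
  assumes "l \<in> chains \<eta>" "P []"
    and "\<And>h v l. 0 \<le> h \<Longrightarrow> h \<le> \<eta> \<Longrightarrow> v \<in> U \<Longrightarrow> l \<in> chains \<eta> \<Longrightarrow> P l \<Longrightarrow> P ((h, v) # l)"
  shows "P l"
  using assms(1)
proof (induction l)
  case (Cons hv l)
  then show ?case using assms(3) by (cases hv) auto
qed (rule assms(2))

lemma duration_nonneg: "l \<in> chains \<eta> \<Longrightarrow> 0 \<le> duration l"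
  by (induction rule: chains_induct) auto

lemma accum_0: "l \<in> chains \<eta> \<Longrightarrow> accum G z l 0 = 0"
  by (induction rule: chains_induct) auto

lemma polygon_0: "l \<in> chains \<eta> \<Longrightarrow> polygon z l 0 = z"
  by (simp add: polygon_def accum_0)

lemma accum_Cons_add:
  assumes "l \<in> chains \<eta>" "0 \<le> r"
  shows "accum G z ((h, v) # l) (h + r) = h *\<^sub>R G z v + accum G (z + h *\<^sub>R F z v) l r"
  using assms by (cases "r = 0") (auto simp: accum_0)

lemma polygon_Cons_add:
  assumes "l \<in> chains \<eta>" "0 \<le> r"
  shows "polygon z ((h, v) # l) (h + r) = polygon (z + h *\<^sub>R F z v) l r"
  using accum_Cons_add[OF assms, of F] by (simp add: polygon_def)

lemma inner_accum: "p \<bullet> accum G z l s = accum (\<lambda>y v. p \<bullet> G y v) z l s"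
  by (induction l arbitrary: z s) (auto simp: inner_add_right)

lemma uminus_accum: "accum (\<lambda>y v. - G y v) z l s = - accum G z l s"
  by (induction l arbitrary: z s) auto

text \<open>Between \<open>s\<close> and \<open>s'\<close> the integrand is frozen at nodes, and the
  step under way at time \<open>s\<close> may have started up to \<eta> earlier; this is why
  \<sigma> ranges from s - \<eta>. The bounds on polygons below are instances with a suitable scalar
  \<open>G\<close>.\<close>

lemma accum_increment_le:
  fixes G :: "'a \<Rightarrow> 'b \<Rightarrow> real"
  assumes "l \<in> chains \<eta>" "0 \<le> s" "s \<le> s'" "s' \<le> duration l"
    and "\<And>\<sigma> v. s - \<eta> \<le> \<sigma> \<Longrightarrow> 0 \<le> \<sigma> \<Longrightarrow> \<sigma> \<le> s' \<Longrightarrow> v \<in> U \<Longrightarrow> G (polygon z l \<sigma>) v \<le> c"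
  shows "accum G z l s' - accum G z l s \<le> c * (s' - s)"
  using assms
proof (induction arbitrary: z s s' rule: chains_induct)
  case Nil
  then have "s' = s" by simp
  then show ?case by simp
next
  case (Cons h v l)
  let ?z = "z + h *\<^sub>R F z v"
  have tail: "G (polygon ?z l \<sigma>) w \<le> c" if "s - \<eta> \<le> h + \<sigma>" "0 \<le> \<sigma>" "h + \<sigma> \<le> s'" "w \<in> U" for \<sigma> w
    using Cons.prems(4)[of "h + \<sigma>" w] polygon_Cons_add[OF \<open>l \<in> chains \<eta>\<close>, of \<sigma> z h v] that \<open>0 \<le> h\<close> by simp
  have head: "G z v \<le> c" if "s \<le> h"
    using Cons.prems(4)[of 0 v] polygon_0[of "(h, v) # l" \<eta> z] Cons.hyps Cons.prems that by auto
  show ?case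
  proof (cases "s' \<le> h")
    case True
    then have "(s' - s) * G z v \<le> (s' - s) * c" using head Cons.prems by (intro mult_left_mono) auto
    then show ?thesis using True Cons.prems by (simp add: algebra_simps)
  next
    case False
    define r' where "r' = s' - h"
    have r': "s' = h + r'" "0 \<le> r'" using False by (auto simp: r'_def)
    show ?thesis
    proof (cases "s \<le> h")
      case True
      have "accum G ?z l r' - accum G ?z l 0 \<le> c * (r' - 0)"
        using Cons.prems r' True \<open>h \<le> \<eta>\<close> by (intro Cons.IH tail) auto
      moreover have "(h - s) * G z v \<le> (h - s) * c" using head True by (intro mult_left_mono) auto
      moreover have "accum G z ((h, v) # l) s = s * G z v" using True by simp
      ultimately show ?thesis
        unfolding r'(1) accum_Cons_add[OF \<open>l \<in> chains \<eta>\<close> r'(2)] accum_0[OF \<open>l \<in> chains \<eta>\<close>]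
        by (simp add: algebra_simps)
    next
      case s: False
      define r where "r = s - h"
      have r: "s = h + r" "0 \<le> r" using s by (auto simp: r_def)
      have "accum G ?z l r' - accum G ?z l r \<le> c * (r' - r)"
        using Cons.prems r' r by (intro Cons.IH tail) auto
      then show ?thesis
        unfolding r'(1) r(1) accum_Cons_add[OF \<open>l \<in> chains \<eta>\<close> r'(2)] accum_Cons_add[OF \<open>l \<in> chains \<eta>\<close> r(2)]
        by simp
    qed
  qed
qed

lemma accum_infdist_mono:
  assumes "l \<in> chains \<eta>" "0 \<le> s" "s \<le> s'" "s' \<le> duration l"
  shows "accum (\<lambda>y v. infdist y A) z l s \<le> accum (\<lambda>y v. infdist y A) z l s'"
proof -
  have "accum (\<lambda>y v. - infdist y A) z l s' - accum (\<lambda>y v. - infdist y A) z l s \<le> 0 * (s' - s)"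
    by (rule accum_increment_le[OF assms]) (simp add: infdist_nonneg)
  then show ?thesis by (simp add: uminus_accum)
qed

lemma polygon_lipschitz:
  assumes "l \<in> chains \<eta>" "0 \<le> s" "s \<le> s'" "s' \<le> duration l"
  shows "norm (polygon z l s' - polygon z l s) \<le> B * (s' - s)"
proof -
  \<comment> \<open>Testing the increment against itself reduces the vector estimate to the scalar
    one; a factor \<open>norm p\<close> cancels at the end.\<close>
  define p where "p = polygon z l s' - polygon z l s"
  have "p \<bullet> p = accum (\<lambda>y v. p \<bullet> F y v) z l s' - accum (\<lambda>y v. p \<bullet> F y v) z l s"
    by (simp add: inner_accum[symmetric] inner_diff_right[symmetric] p_def polygon_def)
  also have "\<dots> \<le> (norm p * B) * (s' - s)"
  proof (rule accum_increment_le[OF assms])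
    fix \<sigma> v assume "v \<in> U"
    have "p \<bullet> F (polygon z l \<sigma>) v \<le> norm p * norm (F (polygon z l \<sigma>) v)" by (rule norm_cauchy_schwarz)
    also have "\<dots> \<le> norm p * B" using F_bound[OF \<open>v \<in> U\<close>] by (intro mult_left_mono) auto
    finally show "p \<bullet> F (polygon z l \<sigma>) v \<le> norm p * B" .
  qed
  finally have "norm p * norm p \<le> norm p * (B * (s' - s))"
    by (simp add: power2_norm_eq_inner[symmetric] power2_eq_square mult.assoc)
  then show ?thesis using B_nonneg assms(3) unfolding p_def[symmetric] by (cases "p = 0") auto
qed

text \<open>\<open>w\<close> will be the point of the limit curve at time \<open>s\<close>. The
  nodes that matter between \<open>s\<close> and \<open>s'\<close> lie within B (s' - s + \<eta>) of
  the polygon at \<open>s\<close>, and \<open>L\<close> turns their distance from \<open>w\<close>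
  into a difference of velocities.\<close>

lemma polygon_direction_le:
  assumes l: "l \<in> chains \<eta>" "0 \<le> s" "s \<le> s'" "s' \<le> duration l" and \<eta>: "0 \<le> \<eta>"
    and p: "\<And>v. v \<in> U \<Longrightarrow> p \<bullet> F w v \<le> c"
  shows "p \<bullet> (polygon z l s' - polygon z l s)
    \<le> (c + norm p * (L * (norm (polygon z l s - w) + B * (s' - s + \<eta>)))) * (s' - s)"
proof -
  have "p \<bullet> (polygon z l s' - polygon z l s) = accum (\<lambda>y v. p \<bullet> F y v) z l s' - accum (\<lambda>y v. p \<bullet> F y v) z l s"
    by (simp add: inner_accum[symmetric] inner_diff_right[symmetric] polygon_def)
  also have "\<dots> \<le> (c + norm p * (L * (norm (polygon z l s - w) + B * (s' - s + \<eta>)))) * (s' - s)"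
  proof (rule accum_increment_le[OF l])
    fix \<sigma> v assume \<sigma>: "s - \<eta> \<le> \<sigma>" "0 \<le> \<sigma>" "\<sigma> \<le> s'" and v: "v \<in> U"
    let ?y = "polygon z l \<sigma>"
    have "norm (?y - polygon z l s) \<le> B * \<bar>\<sigma> - s\<bar>"
      using polygon_lipschitz[OF l(1), of \<sigma> s z] polygon_lipschitz[OF l(1), of s \<sigma> z] l \<sigma>
      by (cases "\<sigma> \<le> s") (auto simp: norm_minus_commute)
    also have "\<dots> \<le> B * (s' - s + \<eta>)" using B_nonneg \<sigma> l \<eta> by (intro mult_left_mono) auto
    finally have "norm (?y - w) \<le> norm (polygon z l s - w) + B * (s' - s + \<eta>)"
      using norm_triangle_ineq[of "?y - polygon z l s" "polygon z l s - w"] by simp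
    then have "L * norm (?y - w) \<le> L * (norm (polygon z l s - w) + B * (s' - s + \<eta>))"
      using L_nonneg by (rule mult_left_mono)
    then have "norm (F ?y v - F w v) \<le> L * (norm (polygon z l s - w) + B * (s' - s + \<eta>))"
      using F_lipschitz[OF v] order_trans by blast
    then have "norm p * norm (F ?y v - F w v) \<le> norm p * (L * (norm (polygon z l s - w) + B * (s' - s + \<eta>)))"
      by (intro mult_left_mono) auto
    moreover have "p \<bullet> F ?y v = p \<bullet> F w v + p \<bullet> (F ?y v - F w v)" by (simp add: inner_diff_right)
    ultimately show "p \<bullet> F ?y v \<le> c + norm p * (L * (norm (polygon z l s - w) + B * (s' - s + \<eta>)))"
      using p[OF v] norm_cauchy_schwarz[of p "F ?y v - F w v"] by linarith
  qed
  finally show ?thesis .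
qed

text \<open>Meant for p = (1, 0): the time coordinate of the velocity is 1 everywhere, so the clock
  of a polygon agrees with its parameter.\<close>

lemma polygon_direction_eq:
  assumes l: "l \<in> chains \<eta>" "0 \<le> s" "s \<le> duration l"
    and p: "\<And>y v. v \<in> U \<Longrightarrow> p \<bullet> F y v = c"
  shows "p \<bullet> polygon z l s = p \<bullet> z + c * s"
proof -
  have "accum (\<lambda>y v. p \<bullet> F y v) z l s - accum (\<lambda>y v. p \<bullet> F y v) z l 0 \<le> c * (s - 0)"
    using p by (intro accum_increment_le[OF l(1) order.refl l(2,3)]) simp
  moreover have "accum (\<lambda>y v. - (p \<bullet> F y v)) z l s - accum (\<lambda>y v. - (p \<bullet> F y v)) z l 0 \<le> - c * (s - 0)"
    using p by (intro accum_increment_le[OF l(1) order.refl l(2,3)]) simp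
  ultimately show ?thesis
    by (simp add: uminus_accum accum_0[OF l(1)] polygon_def inner_add_right inner_accum)
qed

text \<open>Bounded speed keeps a polygon that is away from \<open>A\<close> at time
  \<open>s\<close> away from it for a while, so an excursion is paid for in the integrated penalty.
  Read backwards, a small penalty makes the pointwise distance small.\<close>

lemma polygon_infdist_le:
  assumes l: "l \<in> chains \<eta>" "0 \<le> s" "s \<le> s'" "s' \<le> duration l" and \<eta>: "0 \<le> \<eta>"
  shows "(infdist (polygon z l s) A - B * (s' - s + \<eta>)) * (s' - s) \<le> accum (\<lambda>y v. infdist y A) z l (duration l)"
proof -
  let ?D = "\<lambda>y (v :: 'b). infdist y A"
  have "accum (\<lambda>y v. - infdist y A) z l s' - accum (\<lambda>y v. - infdist y A) z l s
      \<le> (- (infdist (polygon z l s) A - B * (s' - s + \<eta>))) * (s' - s)"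
  proof (rule accum_increment_le[OF l])
    fix \<sigma> v assume \<sigma>: "s - \<eta> \<le> \<sigma>" "0 \<le> \<sigma>" "\<sigma> \<le> s'" and v: "v \<in> U"
    let ?y = "polygon z l \<sigma>"
    have "norm (?y - polygon z l s) \<le> B * \<bar>\<sigma> - s\<bar>"
      using polygon_lipschitz[OF l(1), of \<sigma> s z] polygon_lipschitz[OF l(1), of s \<sigma> z] l \<sigma>
      by (cases "\<sigma> \<le> s") (auto simp: norm_minus_commute)
    also have "\<dots> \<le> B * (s' - s + \<eta>)" using B_nonneg \<sigma> l \<eta> by (intro mult_left_mono) auto
    finally have "infdist (polygon z l s) A \<le> infdist ?y A + B * (s' - s + \<eta>)"
      using infdist_triangle[of "polygon z l s" A ?y] by (simp add: dist_norm norm_minus_commute)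
    then show "- infdist ?y A \<le> - (infdist (polygon z l s) A - B * (s' - s + \<eta>))" by simp
  qed
  then have "(infdist (polygon z l s) A - B * (s' - s + \<eta>)) * (s' - s) \<le> accum ?D z l s' - accum ?D z l s"
    by (simp add: uminus_accum algebra_simps)
  also have "\<dots> \<le> accum ?D z l (duration l)"
    using accum_infdist_mono[OF l(1), of 0 s z] accum_infdist_mono[OF l(1), of s' "duration l" z] accum_0[OF l(1), of ?D z] l by simp
  finally show ?thesis .
qed

lemma chain_cost_eq:
  assumes "l \<in> chains \<eta>"
  shows "chain_cost k z l = duration l + k * accum (\<lambda>y v. infdist y A) z l (duration l)
    + min M (k * infdist (polygon z l (duration l)) K)"
  using assms
proof (induction arbitrary: z rule: chains_induct)
  case Nil
  then show ?case by (simp add: polygon_def)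
next
  case (Cons h v l)
  have d: "duration ((h, v) # l) = h + duration l" by simp
  show ?case
    unfolding d accum_Cons_add[OF \<open>l \<in> chains \<eta>\<close> duration_nonneg[OF \<open>l \<in> chains \<eta>\<close>]]
      polygon_Cons_add[OF \<open>l \<in> chains \<eta>\<close> duration_nonneg[OF \<open>l \<in> chains \<eta>\<close>]]
    by (simp add: Cons.IH algebra_simps)
qed

lemma chain_cost_ge:
  assumes l: "l \<in> chains \<eta>" and k: "0 \<le> k"
  shows "duration l + min M (k * infdist (polygon z l (duration l)) K) \<le> chain_cost k z l"
    and "duration l \<le> chain_cost k z l"
proof -
  have "0 \<le> accum (\<lambda>y v. infdist y A) z l (duration l)"
    using accum_infdist_mono[OF l order.refl duration_nonneg[OF l] order.refl, of z]
      accum_0[OF l, of "\<lambda>y v. infdist y A" z] by simp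
  then have *: "0 \<le> k * accum (\<lambda>y v. infdist y A) z l (duration l)" using k by simp
  then show "duration l + min M (k * infdist (polygon z l (duration l)) K) \<le> chain_cost k z l"
    using chain_cost_eq[OF l, of k z] by simp
  moreover have "0 \<le> min M (k * infdist (polygon z l (duration l)) K)"
    using k M_pos by (simp add: infdist_nonneg)
  ultimately show "duration l \<le> chain_cost k z l" by linarith
qed

text \<open>A discrete Gronwall estimate: a step of length \<open>h\<close> expands distances by at
  most 1 + L h \<le> exp (L h). The factor 1 + duration collects the terminal penalty and the
  running one.\<close>

lemma chain_cost_lipschitz:
  assumes "l \<in> chains \<eta>" and k: "0 \<le> k"
  shows "chain_cost k z l \<le> chain_cost k y l + k * (1 + duration l) * exp (L * duration l) * norm (z - y)"
  using assms(1)
proof (induction arbitrary: z y rule: chains_induct)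
  case Nil
  have "infdist z K \<le> infdist y K + norm (z - y)" using infdist_triangle[of z K y] by (simp add: dist_norm)
  then have "k * infdist z K \<le> k * (infdist y K + norm (z - y))" using k by (rule mult_left_mono)
  moreover have "0 \<le> k * norm (z - y)" using k by simp
  ultimately show ?case by (simp add: algebra_simps min_def)
next
  case (Cons h v l)
  let ?d = "duration l"
  let ?z = "z + h *\<^sub>R F z v" and ?y = "y + h *\<^sub>R F y v"
  have d: "0 \<le> ?d" using duration_nonneg Cons.hyps by blast
  have step: "norm (?z - ?y) \<le> exp (L * h) * norm (z - y)"
  proof -
    have "norm (?z - ?y) = norm ((z - y) + h *\<^sub>R (F z v - F y v))" by (simp add: algebra_simps)
    also have "\<dots> \<le> norm (z - y) + h * norm (F z v - F y v)"
      using norm_triangle_ineq[of "z - y" "h *\<^sub>R (F z v - F y v)"] \<open>0 \<le> h\<close> by simp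
    also have "\<dots> \<le> norm (z - y) + h * (L * norm (z - y))"
      using F_lipschitz[OF \<open>v \<in> U\<close>] \<open>0 \<le> h\<close> by (intro add_left_mono mult_left_mono) auto
    also have "\<dots> = (1 + L * h) * norm (z - y)" by (simp add: algebra_simps)
    also have "\<dots> \<le> exp (L * h) * norm (z - y)"
      by (intro mult_right_mono exp_ge_add_one_self) auto
    finally show ?thesis .
  qed
  have "k * (1 + ?d) * exp (L * ?d) * norm (?z - ?y) \<le> k * (1 + ?d) * exp (L * ?d) * (exp (L * h) * norm (z - y))"
    using step k d by (intro mult_left_mono) auto
  also have "\<dots> = k * (1 + ?d) * exp (L * (h + ?d)) * norm (z - y)"
    by (simp add: exp_add distrib_left mult_ac)
  finally have tail: "chain_cost k ?z l \<le> chain_cost k ?y l + k * (1 + ?d) * exp (L * (h + ?d)) * norm (z - y)"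
    using Cons.IH[of ?z ?y] by linarith
  have "infdist z A \<le> infdist y A + norm (z - y)" using infdist_triangle[of z A y] by (simp add: dist_norm)
  then have "h * (1 + k * infdist z A) \<le> h * (1 + k * (infdist y A + norm (z - y)))"
    using k \<open>0 \<le> h\<close> by (intro mult_left_mono add_left_mono) auto
  also have "\<dots> = h * (1 + k * infdist y A) + k * h * 1 * norm (z - y)" by (simp add: algebra_simps)
  also have "\<dots> \<le> h * (1 + k * infdist y A) + k * h * exp (L * (h + ?d)) * norm (z - y)"
    using k \<open>0 \<le> h\<close> d L_nonneg by (intro add_left_mono mult_right_mono mult_left_mono) auto
  finally show ?case using tail by (simp add: algebra_simps)
qed

section \<open>The value function over all chains\<close>

definition chain_value :: "real \<Rightarrow> real \<Rightarrow> 'a \<Rightarrow> real" where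
  "chain_value k \<eta> z = (INF l\<in>chains \<eta>. chain_cost k z l)"

lemma chain_value_le:
  assumes "0 \<le> k" "l \<in> chains \<eta>" shows "chain_value k \<eta> z \<le> chain_cost k z l"
  unfolding chain_value_def
proof (rule cINF_lower[OF _ assms(2)])
  show "bdd_below (chain_cost k z ` chains \<eta>)"
    using chain_cost_ge(2)[OF _ assms(1)] duration_nonneg order_trans by (intro bdd_belowI2[of _ 0]) blast
qed

lemma chain_value_ge: "(\<And>l. l \<in> chains \<eta> \<Longrightarrow> c \<le> chain_cost k z l) \<Longrightarrow> c \<le> chain_value k \<eta> z"
  unfolding chain_value_def by (intro cINF_greatest) (auto intro: Nil_in_chains)

lemma chain_value_nonneg: "0 \<le> k \<Longrightarrow> 0 \<le> chain_value k \<eta> z"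
  using chain_cost_ge(2) duration_nonneg order_trans by (intro chain_value_ge) blast

lemma chain_value_le_terminal: "0 \<le> k \<Longrightarrow> chain_value k \<eta> z \<le> min M (k * infdist z K)"
  using chain_value_le[of k "[]" \<eta> z] by simp

lemma chain_value_step:
  assumes "0 \<le> k" "0 \<le> s" "s \<le> \<eta>" "v \<in> U"
  shows "chain_value k \<eta> z \<le> s * (1 + k * infdist z A) + chain_value k \<eta> (z + s *\<^sub>R F z v)"
proof -
  have "chain_value k \<eta> z - s * (1 + k * infdist z A) \<le> chain_value k \<eta> (z + s *\<^sub>R F z v)"
  proof (rule chain_value_ge)
    fix l assume "l \<in> chains \<eta>"
    then show "chain_value k \<eta> z - s * (1 + k * infdist z A) \<le> chain_cost k (z + s *\<^sub>R F z v) l"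
      using chain_value_le[of k "(s, v) # l" \<eta> z] assms by simp
  qed
  then show ?thesis by simp
qed

text \<open>The constant for a single chain grows with its duration, but a chain longer than
  \<open>M\<close> costs more than \<open>M\<close> and loses to the empty chain.\<close>

lemma chain_value_lipschitz:
  assumes k: "0 \<le> k"
  shows "(k * (1 + M) * exp (L * M))-lipschitz_on UNIV (chain_value k \<eta>)"
proof -
  let ?C = "k * (1 + M) * exp (L * M)"
  have C: "0 \<le> ?C" using k M_pos by simp
  have *: "chain_value k \<eta> z - ?C * norm (z - y) \<le> chain_value k \<eta> y" for z y
  proof (rule chain_value_ge)
    fix l assume l: "l \<in> chains \<eta>"
    show "chain_value k \<eta> z - ?C * norm (z - y) \<le> chain_cost k y l"
    proof (cases "duration l \<le> M")
      case True
      have "k * (1 + duration l) * exp (L * duration l) * norm (z - y) \<le> ?C * norm (z - y)"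
        using True k L_nonneg M_pos duration_nonneg[OF l] by (intro mult_mono) (auto intro: mult_left_mono)
      then show ?thesis using chain_value_le[OF k l, of z] chain_cost_lipschitz[OF l k, of z y] by linarith
    next
      case False
      then have "M \<le> chain_cost k y l" using chain_cost_ge(2)[OF l k, of y] by linarith
      moreover have "chain_value k \<eta> z \<le> M" using chain_value_le_terminal[OF k, of \<eta> z] by simp
      moreover have "0 \<le> ?C * norm (z - y)" using C by simp
      ultimately show ?thesis by linarith
    qed
  qed
  show ?thesis
  proof (rule lipschitz_onI)
    fix z y
    show "dist (chain_value k \<eta> z) (chain_value k \<eta> y) \<le> ?C * dist z y"
      using *[of z y] *[of y z] by (simp add: dist_real_def dist_norm norm_minus_commute abs_le_iff)
  qed (rule C)
qed

text \<open>At speed at most \<open>B\<close>, a chain of duration at most \<open>M\<close> cannot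
  come closer to \<open>K\<close> than M / k, where the terminal penalty would fall below its cap;
  longer chains cost at least \<open>M\<close> anyway.\<close>

lemma chain_value_far:
  assumes k: "0 < k" and z: "M / k + B * M \<le> infdist z K"
  shows "chain_value k \<eta> z = M"
proof (rule antisym)
  show "chain_value k \<eta> z \<le> M" using chain_value_le_terminal[of k \<eta> z] k by simp
  show "M \<le> chain_value k \<eta> z"
  proof (rule chain_value_ge)
    fix l assume l: "l \<in> chains \<eta>"
    have d: "0 \<le> duration l" using duration_nonneg[OF l] .
    show "M \<le> chain_cost k z l"
    proof (cases "duration l \<le> M")
      case True
      let ?y = "polygon z l (duration l)"
      have "norm (?y - z) \<le> B * duration l"
        using polygon_lipschitz[OF l order.refl d order.refl, of z] polygon_0[OF l, of z] by simp
      also have "\<dots> \<le> B * M" using True B_nonneg by (rule mult_left_mono)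
      finally have "infdist z K \<le> infdist ?y K + B * M"
        using infdist_triangle[of z K ?y] by (simp add: dist_norm norm_minus_commute)
      then have "M / k \<le> infdist ?y K" using z by linarith
      then have "M \<le> k * infdist ?y K" using k by (simp add: field_simps)
      then show ?thesis using chain_cost_ge(1)[OF l, of k z] k d by simp
    qed (use chain_cost_ge(2)[OF l, of k z] k in linarith)
  qed
qed

text \<open>The differential inclusion for the limit curve is recorded in integrated form, tested against
  a direction \<open>p\<close>; this is the form that survives uniform convergence.\<close>

lemma near_optimal_chains_limit:
  assumes l: "\<And>n. l n \<in> chains (inverse (real (Suc n)))"
    and cost: "\<And>n. chain_cost (real (Suc n)) z\<^sub>0 (l n) \<le> c" and "c < M"
  obtains g \<tau> where "0 \<le> \<tau>" "\<tau> \<le> c" "g 0 = z\<^sub>0" "g \<tau> \<in> K" "B-lipschitz_on {0..\<tau>} g"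
    "\<And>s. 0 \<le> s \<Longrightarrow> s \<le> \<tau> \<Longrightarrow> g s \<in> A"
    "\<And>p d s s'. 0 \<le> s \<Longrightarrow> s < s' \<Longrightarrow> s' < \<tau> \<Longrightarrow> (\<And>v. v \<in> U \<Longrightarrow> p \<bullet> F (g s) v \<le> d) \<Longrightarrow>
       p \<bullet> (g s' - g s) \<le> (d + norm p * (L * (B * (s' - s)))) * (s' - s)"
    "\<And>p d s. 0 \<le> s \<Longrightarrow> s \<le> \<tau> \<Longrightarrow> (\<And>y v. v \<in> U \<Longrightarrow> p \<bullet> F y v = d) \<Longrightarrow> p \<bullet> g s = p \<bullet> z\<^sub>0 + d * s"
proof -
  define D where "D = (\<lambda>n. duration (l n))"
  define \<eta> where "\<eta> = (\<lambda>n. inverse (real (Suc n)))"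
  \<comment> \<open>Polygons of different durations are frozen at their endpoints, so that all live
    on the common interval [0, M].\<close>
  define \<gamma> where "\<gamma> = (\<lambda>n s. polygon z\<^sub>0 (l n) (min s (D n)))"
  have l': "l n \<in> chains (\<eta> n)" for n using l by (simp add: \<eta>_def)
  have D: "0 \<le> D n" "D n \<le> c" for n
    using duration_nonneg[OF l] chain_cost_ge(2)[OF l, of "real (Suc n)" n z\<^sub>0] cost[of n] by (auto simp: D_def)
  have \<eta>: "\<eta> \<longlonglongrightarrow> 0" "0 \<le> \<eta> n" for n
    using LIMSEQ_inverse_real_of_nat by (auto simp: \<eta>_def)
  have \<gamma>_lip: "norm (\<gamma> n s' - \<gamma> n s) \<le> B * \<bar>s' - s\<bar>" if "0 \<le> s" "0 \<le> s'" for n s s'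
  proof -
    have *: "norm (\<gamma> n b - \<gamma> n a) \<le> B * (b - a)" if "0 \<le> a" "a \<le> b" for a b
    proof -
      have "norm (\<gamma> n b - \<gamma> n a) \<le> B * (min b (D n) - min a (D n))"
        unfolding \<gamma>_def using that D(1)[of n] by (intro polygon_lipschitz[OF l']) (auto simp: D_def)
      also have "\<dots> \<le> B * (b - a)" using that B_nonneg by (intro mult_left_mono) auto
      finally show ?thesis .
    qed
    show ?thesis using *[of s s'] *[of s' s] that by (cases "s \<le> s'") (auto simp: norm_minus_commute)
  qed
  have \<gamma>0: "\<gamma> n 0 = z\<^sub>0" for n using D(1)[of n] polygon_0[OF l'] by (simp add: \<gamma>_def)
  obtain g r where r: "strict_mono (r :: nat \<Rightarrow> nat)"
    and g: "\<And>e. 0 < e \<Longrightarrow> \<exists>N. \<forall>n x. n \<ge> N \<and> x \<in> {0..M} \<longrightarrow> norm (\<gamma> (r n) x - g x) < e"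
  proof (rule Arzela_Ascoli[of "{0..M}" \<gamma> "norm z\<^sub>0 + B * M"])
    fix n and s :: real assume s: "s \<in> {0..M}"
    have "norm (\<gamma> n s) \<le> norm (\<gamma> n 0) + norm (\<gamma> n s - \<gamma> n 0)" by (metis add.commute norm_triangle_sub)
    moreover have "norm (\<gamma> n s - \<gamma> n 0) \<le> B * \<bar>s - 0\<bar>" using s by (intro \<gamma>_lip) auto
    moreover have "B * \<bar>s - 0\<bar> \<le> B * M" using s B_nonneg by (intro mult_left_mono) auto
    ultimately show "norm (\<gamma> n s) \<le> norm z\<^sub>0 + B * M" using \<gamma>0[of n] by simp
  next
    fix s e :: real assume s: "s \<in> {0..M}" and "0 < e"
    show "\<exists>d. 0 < d \<and> (\<forall>n y. y \<in> {0..M} \<and> norm (s - y) < d \<longrightarrow> norm (\<gamma> n s - \<gamma> n y) < e)"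
    proof (intro exI[of _ "e / (B + 1)"] conjI allI impI)
      fix n y assume y: "y \<in> {0..M} \<and> norm (s - y) < e / (B + 1)"
      then have "norm (\<gamma> n s - \<gamma> n y) \<le> B * \<bar>s - y\<bar>" using s by (intro \<gamma>_lip) auto
      also have "\<dots> \<le> (B + 1) * \<bar>s - y\<bar>" by (intro mult_right_mono) auto
      also have "\<dots> < e" using y B_nonneg by (simp add: field_simps)
      finally show "norm (\<gamma> n s - \<gamma> n y) < e" .
    qed (use \<open>0 < e\<close> B_nonneg in auto)
  qed auto
  \<comment> \<open>A further subsequence makes the durations converge as well.\<close>
  have "seq_compact {0..c}" by (simp add: compact_imp_seq_compact)
  moreover have "\<forall>n. D (r n) \<in> {0..c}" using D by simp
  ultimately obtain \<tau> q where \<tau>: "\<tau> \<in> {0..c}" and q: "strict_mono (q :: nat \<Rightarrow> nat)"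
    and D_lim': "((\<lambda>n. D (r n)) \<circ> q) \<longlonglongrightarrow> \<tau>"
    by (rule seq_compactE)
  define m where "m = r \<circ> q"
  have D_lim: "(\<lambda>n. D (m n)) \<longlonglongrightarrow> \<tau>" using D_lim' by (simp add: m_def o_def)
  have m: "strict_mono m" using r q by (simp add: m_def strict_mono_o)
  have \<eta>_lim: "(\<lambda>n. \<eta> (m n)) \<longlonglongrightarrow> 0"
    using LIMSEQ_subseq_LIMSEQ[OF \<eta>(1) m] by (simp add: o_def)
  have unif: "\<exists>N. \<forall>n\<ge>N. \<forall>s\<in>{0..M}. norm (\<gamma> (m n) s - g s) < e" if "0 < e" for e
  proof -
    obtain N where N: "\<And>n s. n \<ge> N \<Longrightarrow> s \<in> {0..M} \<Longrightarrow> norm (\<gamma> (r n) s - g s) < e" using g[OF \<open>0 < e\<close>] by blast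
    show ?thesis
      using N order_trans[OF _ seq_suble[OF q]] by (intro exI[of _ N]) (auto simp: m_def)
  qed
  have lim: "(\<lambda>n. \<gamma> (m n) s) \<longlonglongrightarrow> g s" if "s \<in> {0..M}" for s
    unfolding LIMSEQ_iff using unif that by blast
  have g_lip: "norm (g s' - g s) \<le> B * \<bar>s' - s\<bar>" if "s \<in> {0..M}" "s' \<in> {0..M}" for s s'
    using that by (intro LIMSEQ_le_const2[OF tendsto_norm[OF tendsto_diff[OF lim lim]]] exI[of _ 0] allI impI \<gamma>_lip) auto
  have \<tau>M: "\<tau> < M" using \<tau> \<open>c < M\<close> by simp
  have k_lim: "(\<lambda>n. c * \<eta> (m n)) \<longlonglongrightarrow> 0" using tendsto_mult_right_zero[OF \<eta>_lim] .
  \<comment> \<open>Both penalties carry weight n + 1, so a total cost of at most \<open>c\<close>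
    leaves at most c / (n + 1) for each of them unweighted. For the terminal one, c < M excludes
    that the cap is active.\<close>
  have acc: "accum (\<lambda>y v. infdist y A) z\<^sub>0 (l n) (D n) \<le> c * \<eta> n"
    and K: "infdist (\<gamma> n (D n)) K \<le> c * \<eta> n" for n
  proof -
    have eq: "chain_cost (real (Suc n)) z\<^sub>0 (l n) = D n + real (Suc n) * accum (\<lambda>y v. infdist y A) z\<^sub>0 (l n) (D n)
        + min M (real (Suc n) * infdist (\<gamma> n (D n)) K)"
      using chain_cost_eq[OF l[of n], of "real (Suc n)" z\<^sub>0] by (simp add: D_def \<gamma>_def)
    have "0 \<le> accum (\<lambda>y v. infdist y A) z\<^sub>0 (l n) (D n)"
      using accum_infdist_mono[OF l[of n] order.refl duration_nonneg[OF l[of n]] order.refl, of z\<^sub>0]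
        accum_0[OF l[of n], of "\<lambda>y v. infdist y A" z\<^sub>0] by (simp add: D_def)
    then have a: "0 \<le> real (Suc n) * accum (\<lambda>y v. infdist y A) z\<^sub>0 (l n) (D n)" by simp
    have b: "0 \<le> min M (real (Suc n) * infdist (\<gamma> n (D n)) K)" using M_pos by (simp add: infdist_nonneg)
    have "real (Suc n) * accum (\<lambda>y v. infdist y A) z\<^sub>0 (l n) (D n) \<le> c" using eq cost[of n] b D(1)[of n] by linarith
    then show "accum (\<lambda>y v. infdist y A) z\<^sub>0 (l n) (D n) \<le> c * \<eta> n" by (simp add: \<eta>_def field_simps)
    have "min M (real (Suc n) * infdist (\<gamma> n (D n)) K) \<le> c" using eq cost[of n] a D(1)[of n] by linarith
    then have "real (Suc n) * infdist (\<gamma> n (D n)) K \<le> c" using \<open>c < M\<close> by (simp add: min_def split: if_splits)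
    then show "infdist (\<gamma> n (D n)) K \<le> c * \<eta> n" by (simp add: \<eta>_def field_simps)
  qed
  have gK: "g \<tau> \<in> K"
  proof -
    have "infdist (g \<tau>) K \<le> norm (g \<tau> - \<gamma> (m n) \<tau>) + B * \<bar>\<tau> - D (m n)\<bar> + c * \<eta> (m n)" for n
    proof -
      have "infdist (g \<tau>) K \<le> infdist (\<gamma> (m n) (D (m n))) K + norm (g \<tau> - \<gamma> (m n) (D (m n)))"
        using infdist_triangle[of "g \<tau>" K] by (simp add: dist_norm)
      moreover have "norm (\<gamma> (m n) \<tau> - \<gamma> (m n) (D (m n))) \<le> B * \<bar>\<tau> - D (m n)\<bar>"
        using D \<tau> by (intro \<gamma>_lip) auto
      moreover have "norm (g \<tau> - \<gamma> (m n) (D (m n))) \<le> norm (g \<tau> - \<gamma> (m n) \<tau>) + norm (\<gamma> (m n) \<tau> - \<gamma> (m n) (D (m n)))"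
        using norm_triangle_ineq[of "g \<tau> - \<gamma> (m n) \<tau>" "\<gamma> (m n) \<tau> - \<gamma> (m n) (D (m n))"] by simp
      ultimately show ?thesis using K[of "m n"] by linarith
    qed
    moreover have "(\<lambda>n. norm (g \<tau> - \<gamma> (m n) \<tau>) + B * \<bar>\<tau> - D (m n)\<bar> + c * \<eta> (m n)) \<longlonglongrightarrow> norm (g \<tau> - g \<tau>) + B * \<bar>\<tau> - \<tau>\<bar> + 0"
      using \<tau> \<tau>M by (intro tendsto_intros lim D_lim k_lim) auto
    ultimately have "infdist (g \<tau>) K \<le> norm (g \<tau> - g \<tau>) + B * \<bar>\<tau> - \<tau>\<bar> + 0"
      by (intro LIMSEQ_le_const) blast+
    then have "infdist (g \<tau>) K = 0" using infdist_nonneg[of "g \<tau>" K] by simp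
    then show ?thesis using in_closed_iff_infdist_zero[OF closed_K K_nonempty] by blast
  qed
  \<comment> \<open>For s' strictly below \<tau> the polygons are eventually not yet frozen at s'.
    The endpoint \<tau> itself is covered by \<open>gK\<close>.\<close>
  have ev: "eventually (\<lambda>n. s' \<le> D (m n)) sequentially" if "s' < \<tau>" for s'
    using order_tendstoD(1)[OF D_lim that] by (rule eventually_mono) auto
  have \<gamma>_eq: "\<gamma> n s = polygon z\<^sub>0 (l n) s" if "s \<le> D n" for n s using that by (simp add: \<gamma>_def)
  have gA: "g s \<in> A" if s: "0 \<le> s" "s < \<tau>" for s
  proof -
    \<comment> \<open>The total penalty tends to 0, so after division by s' - s only the error from
      moving on to s' is left; it disappears as s' decreases to \<open>s\<close>.\<close>
    have *: "infdist (g s) A \<le> B * (s' - s)" if s': "s < s'" "s' < \<tau>" for s'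
    proof -
      have "eventually (\<lambda>n. (infdist (\<gamma> (m n) s) A - B * (s' - s + \<eta> (m n))) * (s' - s) \<le> c * \<eta> (m n)) sequentially"
        using ev[OF s'(2)]
      proof eventually_elim
        case (elim n)
        then show ?case
          using polygon_infdist_le[OF l'[of "m n"] s(1) less_imp_le[OF s'(1)] _ \<eta>(2), where z = z\<^sub>0] acc[of "m n"] s'
          by (simp add: \<gamma>_eq D_def)
      qed
      moreover have "(\<lambda>n. (infdist (\<gamma> (m n) s) A - B * (s' - s + \<eta> (m n))) * (s' - s))
          \<longlonglongrightarrow> (infdist (g s) A - B * (s' - s + 0)) * (s' - s)"
        using s \<tau>M by (intro tendsto_intros lim \<eta>_lim) auto
      ultimately have "(infdist (g s) A - B * (s' - s + 0)) * (s' - s) \<le> 0"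
        by (intro tendsto_le[OF _ k_lim]) auto
      then show ?thesis using s' by (simp add: mult_le_0_iff)
    qed
    have "infdist (g s) A \<le> 0"
    proof (rule field_le_epsilon)
      fix e :: real assume "0 < e"
      define s' where "s' = s + min ((\<tau> - s) / 2) (e / (B + 1))"
      have "s < s'" "s' < \<tau>" using s \<open>0 < e\<close> B_nonneg by (auto simp: s'_def min_def field_simps)
      moreover have "B * (s' - s) \<le> e"
      proof -
        have "B * (s' - s) \<le> (B + 1) * (e / (B + 1))"
          using B_nonneg \<open>0 < e\<close> \<open>s < s'\<close> by (intro mult_mono) (auto simp: s'_def)
        then show ?thesis using B_nonneg by simp
      qed
      ultimately show "infdist (g s) A \<le> 0 + e" using * by force
    qed
    then have "infdist (g s) A = 0" using infdist_nonneg[of "g s" A] by simp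
    then show ?thesis using in_closed_iff_infdist_zero[OF closed_A] K_nonempty K_subset_A by blast
  qed
  show thesis
  proof (rule that[of \<tau> g])
    show "0 \<le> \<tau>" "\<tau> \<le> c" using \<tau> by auto
    show "g 0 = z\<^sub>0" using LIMSEQ_unique[OF lim[of 0]] M_pos by (simp add: \<gamma>0)
    show "g \<tau> \<in> K" by (rule gK)
    show "B-lipschitz_on {0..\<tau>} g"
      using g_lip \<tau>M B_nonneg by (intro lipschitz_onI) (auto simp: dist_norm)
    show "g s \<in> A" if "0 \<le> s" "s \<le> \<tau>" for s
      using gA[of s] gK K_subset_A that by (cases "s = \<tau>") auto
    show "p \<bullet> g s = p \<bullet> z\<^sub>0 + d * s" if s: "0 \<le> s" "s \<le> \<tau>" and d: "\<And>y v. v \<in> U \<Longrightarrow> p \<bullet> F y v = d" for p d s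
    proof -
      have "p \<bullet> \<gamma> n s = p \<bullet> z\<^sub>0 + d * min s (D n)" for n
        unfolding \<gamma>_def using s(1) D(1)[of n] by (intro polygon_direction_eq[OF l' _ _ d]) (auto simp: D_def)
      then have "(\<lambda>n. p \<bullet> \<gamma> (m n) s) \<longlonglongrightarrow> p \<bullet> z\<^sub>0 + d * min s \<tau>"
        by (simp only:) (intro tendsto_intros D_lim)
      moreover have "(\<lambda>n. p \<bullet> \<gamma> (m n) s) \<longlonglongrightarrow> p \<bullet> g s"
        using s \<tau>M by (intro tendsto_intros lim) auto
      ultimately have "p \<bullet> g s = p \<bullet> z\<^sub>0 + d * min s \<tau>" by (rule LIMSEQ_unique[symmetric])
      then show ?thesis using s by simp
    qed
    show "p \<bullet> (g s' - g s) \<le> (d + norm p * (L * (B * (s' - s)))) * (s' - s)"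
      if s: "0 \<le> s" "s < s'" "s' < \<tau>" and d: "\<And>v. v \<in> U \<Longrightarrow> p \<bullet> F (g s) v \<le> d" for p d s s'
    proof -
      have "eventually (\<lambda>n. p \<bullet> (\<gamma> (m n) s' - \<gamma> (m n) s)
          \<le> (d + norm p * (L * (norm (\<gamma> (m n) s - g s) + B * (s' - s + \<eta> (m n))))) * (s' - s)) sequentially"
        using ev[OF s(3)]
      proof eventually_elim
        case (elim n)
        then show ?case
          using polygon_direction_le[OF l'[of "m n"] s(1) less_imp_le[OF s(2)] _ \<eta>(2) d, where z = z\<^sub>0] s
          by (simp add: \<gamma>_eq D_def)
      qed
      moreover have "(\<lambda>n. (d + norm p * (L * (norm (\<gamma> (m n) s - g s) + B * (s' - s + \<eta> (m n))))) * (s' - s))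
          \<longlonglongrightarrow> (d + norm p * (L * (norm (g s - g s) + B * (s' - s + 0)))) * (s' - s)"
        using s \<tau>M by (intro tendsto_intros lim \<eta>_lim) auto
      moreover have "(\<lambda>n. p \<bullet> (\<gamma> (m n) s' - \<gamma> (m n) s)) \<longlonglongrightarrow> p \<bullet> (g s' - g s)"
        using s \<tau>M by (intro tendsto_intros lim) auto
      ultimately have "p \<bullet> (g s' - g s) \<le> (d + norm p * (L * (norm (g s - g s) + B * (s' - s + 0)))) * (s' - s)"
        by (intro tendsto_le[OF sequentially_bot]) auto
      then show ?thesis by simp
    qed
  qed
qed

section \<open>Polynomial approximation of the penalised value\<close>

lemma chain_value_bounded_support:
  assumes "bounded K" "0 < k"
  obtains R where "0 < R" "\<And>z. R < norm z \<Longrightarrow> chain_value k \<eta> z = M"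
proof -
  obtain r where r: "0 < r" "\<And>y. y \<in> K \<Longrightarrow> norm y \<le> r" using \<open>bounded K\<close> bounded_pos by metis
  have MB: "0 \<le> M / k" "0 \<le> B * M" using M_pos B_nonneg \<open>0 < k\<close> by auto
  show thesis
  proof (rule that[of "r + M / k + B * M"])
    fix z :: 'a assume z: "r + M / k + B * M < norm z"
    have "norm z - r \<le> infdist z K"
      unfolding infdist_notempty[OF K_nonempty]
    proof (rule cINF_greatest[OF K_nonempty])
      fix y assume "y \<in> K"
      then show "norm z - r \<le> dist z y" using r(2)[of y] norm_triangle_ineq2[of z y] by (simp add: dist_norm)
    qed
    then show "chain_value k \<eta> z = M" using z \<open>0 < k\<close> by (intro chain_value_far) auto
  qed (use r MB in linarith)
qed

text \<open>The step inequality at each translate z + y is moved to the common direction F(z, v) and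
  averaged against the kernel, then divided by \<open>s\<close>. The mollified function is M - W,
  which has bounded support; \<open>Q\<close> undoes the reflection.\<close>

lemma chain_value_polynomial:
  assumes "bounded A" "0 < k" "0 < \<eta>" "0 < \<epsilon>"
  obtains Q where "real_polynomial_function Q" "\<And>z. z \<in> A \<Longrightarrow> \<bar>Q z - chain_value k \<eta> z\<bar> \<le> \<epsilon>"
    "\<And>z v D. z \<in> A \<Longrightarrow> v \<in> U \<Longrightarrow> (Q has_derivative D) (at z) \<Longrightarrow> - (1 + \<epsilon>) \<le> D (F z v)"
proof -
  let ?W = "chain_value k \<eta>"
  have k: "0 \<le> k" using \<open>0 < k\<close> by simp
  define C where "C = k * (1 + M) * exp (L * M)"
  have C: "0 \<le> C" using k M_pos by (simp add: C_def)
  have W_lip: "C-lipschitz_on UNIV ?W" unfolding C_def by (rule chain_value_lipschitz[OF k])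
  have W_diff: "\<bar>?W y - ?W z\<bar> \<le> C * norm (y - z)" for y z
    using lipschitz_onD[OF W_lip, of y z] by (simp add: dist_norm)
  have W_bd: "0 \<le> ?W z" "?W z \<le> M" for z
    using chain_value_nonneg[OF k] chain_value_le_terminal[OF k, of \<eta> z] by auto
  define \<phi> where "\<phi> = (\<lambda>z. M - ?W z)"
  obtain R\<^sub>0 where R\<^sub>0: "0 < R\<^sub>0" "\<And>z. R\<^sub>0 < norm z \<Longrightarrow> ?W z = M"
    using chain_value_bounded_support[OF bounded_subset[OF \<open>bounded A\<close> K_subset_A] \<open>0 < k\<close>] by blast
  have \<phi>_cont: "continuous_on UNIV \<phi>"
    unfolding \<phi>_def using lipschitz_on_continuous_on[OF W_lip] by (intro continuous_intros)
  have \<phi>_supp: "\<phi> z = 0" if "R\<^sub>0 < norm z" for z using R\<^sub>0(2)[OF that] by (simp add: \<phi>_def)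
  obtain a where a: "0 < a" "\<And>z. z \<in> A \<Longrightarrow> norm z \<le> a" using \<open>bounded A\<close> bounded_pos by metis
  \<comment> \<open>\<delta> pays for the errors near the kernel's centre: \<open>k\<close> from the
    penalty at a point within \<delta> of \<open>A\<close>, \<open>C * L\<close> from the change of
    direction, \<open>C\<close> from the values. The mass \<open>e\<close> pays for the tail,
    \<open>C * B\<close> in the difference inequality and \<open>M\<close> in the values.\<close>
  define \<delta> where "\<delta> = \<epsilon> / 2 / (k + C * L + C + 1)"
  define e where "e = \<epsilon> / 2 / (C * B + M)"
  have pos: "0 < k + C * L + C + 1" "0 < C * B + M"
    using k C L_nonneg B_nonneg M_pos by (auto intro!: add_nonneg_pos)
  have \<delta>: "0 < \<delta>" "(k + C * L + C) * \<delta> \<le> \<epsilon> / 2"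
  proof -
    show "0 < \<delta>" using pos \<open>0 < \<epsilon>\<close> by (simp add: \<delta>_def)
    moreover have "(k + C * L + C + 1) * \<delta> = \<epsilon> / 2"
      using pos(1) unfolding \<delta>_def by (metis less_irrefl nonzero_mult_div_cancel_left times_divide_eq_right)
    ultimately show "(k + C * L + C) * \<delta> \<le> \<epsilon> / 2" by (simp add: distrib_right)
  qed
  have e: "0 < e" "(C * B + M) * e = \<epsilon> / 2"
    using pos(2) \<open>0 < \<epsilon>\<close> unfolding e_def
    by (simp, metis less_irrefl nonzero_mult_div_cancel_left times_divide_eq_right)
  have parts: "k * \<delta> + C * L * \<delta> \<le> \<epsilon> / 2" "C * \<delta> \<le> \<epsilon> / 2" "C * B * e \<le> \<epsilon> / 2" "M * e \<le> \<epsilon> / 2"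
  proof -
    have "0 \<le> k * \<delta>" "0 \<le> C * L * \<delta>" "0 \<le> C * \<delta>" "0 \<le> C * B * e" "0 \<le> M * e"
      using k C L_nonneg B_nonneg M_pos \<delta>(1) e(1) by auto
    then show "k * \<delta> + C * L * \<delta> \<le> \<epsilon> / 2" "C * \<delta> \<le> \<epsilon> / 2" "C * B * e \<le> \<epsilon> / 2" "M * e \<le> \<epsilon> / 2"
      using \<delta>(2) e(2) by (auto simp: distrib_right)
  qed
  \<comment> \<open>The extra 1 leaves room for the displaced point
    \<open>z + s *\<^sub>R F z v\<close>, given s \<le> 1 / (B + 1).\<close>
  have R\<^sub>1: "0 < a + 1" using a(1) by simp
  obtain Q\<^sub>0 p where Q\<^sub>0: "real_polynomial_function Q\<^sub>0"
    and p: "\<And>y. p y \<ge> 0" "integrable lborel p" "(LINT y|lborel. p y) = 1"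
      "(LINT y|lborel. indicator {y. \<delta> < norm y} y * p y) \<le> e"
    and Q\<^sub>0_eq: "\<And>z. norm z \<le> a + 1 \<Longrightarrow> Q\<^sub>0 z = (LINT y|lborel. \<phi> (z + y) * p y)"
    using polynomial_mollification[OF \<phi>_cont \<phi>_supp R\<^sub>0(1) R\<^sub>1 \<delta>(1) e(1)] by blast
  have S: "{y :: 'a. \<delta> < norm y} \<in> sets borel" by measurable
  have int: "integrable lborel (\<lambda>y. \<phi> (z + y) * p y)" for z
  proof (rule Bochner_Integration.integrable_bound)
    show "integrable lborel (\<lambda>y. M * p y)" using p(2) by simp
    have "continuous_on UNIV (\<lambda>y. \<phi> (z + y))"
      by (rule continuous_on_compose2[OF \<phi>_cont]) (auto intro!: continuous_intros)
    then have "(\<lambda>y. \<phi> (z + y)) \<in> borel_measurable borel" by (rule borel_measurable_continuous_onI)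
    then show "(\<lambda>y. \<phi> (z + y) * p y) \<in> borel_measurable lborel"
      using borel_measurable_integrable[OF p(2)] by simp
    have "norm (\<phi> (z + y) * p y) \<le> norm (M * p y)" for y
      using W_bd[of "z + y"] p(1)[of y] M_pos by (simp add: \<phi>_def abs_mult mult_right_mono)
    then show "AE y in lborel. norm (\<phi> (z + y) * p y) \<le> norm (M * p y)" by simp
  qed
  have avg: "(LINT y|lborel. h y * p y) \<le> \<alpha> + \<beta> * e"
    if "integrable lborel (\<lambda>y. h y * p y)" "\<And>y. h y \<le> \<alpha> + \<beta> * indicator {y. \<delta> < norm y} y" "0 \<le> \<beta>" for h \<alpha> \<beta>
    using kernel_average_le[OF p(2,1,3,4) S that] .
  define Q where "Q = (\<lambda>z. M - Q\<^sub>0 z)"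
  show thesis
  proof (rule that[of Q])
    show "real_polynomial_function Q"
      unfolding Q_def using Q\<^sub>0 by (intro real_polynomial_function_diff real_polynomial_function.intros(2))
    show "\<bar>Q z - ?W z\<bar> \<le> \<epsilon>" if z: "z \<in> A" for z
    proof -
      have za: "norm z \<le> a + 1" using a(2)[OF z] by simp
      have intz: "integrable lborel (\<lambda>y. \<phi> z * p y)" using p(2) by simp
      have diff: "\<bar>\<phi> (z + y) - \<phi> z\<bar> \<le> C * \<delta> + M * indicator {y. \<delta> < norm y} y" for y
      proof (cases "\<delta> < norm y")
        case True
        have "\<bar>\<phi> (z + y) - \<phi> z\<bar> \<le> M" using W_bd[of z] W_bd[of "z + y"] by (auto simp: \<phi>_def)
        moreover have "0 \<le> C * \<delta>" using C \<delta> by simp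
        ultimately show ?thesis using True by simp
      next
        case False
        have "\<bar>\<phi> (z + y) - \<phi> z\<bar> \<le> C * norm y" using W_diff[of z "z + y"] by (simp add: \<phi>_def)
        also have "\<dots> \<le> C * \<delta>" using C False by (intro mult_left_mono) auto
        finally show ?thesis using False by simp
      qed
      have "(LINT y|lborel. (\<phi> (z + y) - \<phi> z) * p y) \<le> C * \<delta> + M * e"
        using int[of z] intz diff M_pos by (intro avg) (auto simp: left_diff_distrib abs_le_iff)
      moreover have "(LINT y|lborel. (\<phi> z - \<phi> (z + y)) * p y) \<le> C * \<delta> + M * e"
        using int[of z] intz diff M_pos by (intro avg) (auto simp: left_diff_distrib abs_le_iff)
      moreover have "(LINT y|lborel. (\<phi> (z + y) - \<phi> z) * p y) = Q\<^sub>0 z - \<phi> z"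
        "(LINT y|lborel. (\<phi> z - \<phi> (z + y)) * p y) = \<phi> z - Q\<^sub>0 z"
        using int[of z] intz p(3) Q\<^sub>0_eq[OF za] by (simp_all add: left_diff_distrib)
      ultimately have "\<bar>Q\<^sub>0 z - \<phi> z\<bar> \<le> C * \<delta> + M * e" by linarith
      then show ?thesis using parts by (simp add: Q_def \<phi>_def abs_le_iff)
    qed
    show "- (1 + \<epsilon>) \<le> D (F z v)" if z: "z \<in> A" and v: "v \<in> U" and D: "(Q has_derivative D) (at z)" for z v D
    proof (rule has_derivative_direction_ge[OF D])
      show "0 < min \<eta> (1 / (B + 1))" using \<open>0 < \<eta>\<close> B_nonneg by simp
      fix s assume s: "0 < s" "s \<le> min \<eta> (1 / (B + 1))"
      let ?a = "F z v"
      have za: "norm z \<le> a + 1" using a(2)[OF z] by simp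
      have "s * norm ?a \<le> 1 / (B + 1) * (B + 1)"
        using s F_bound[OF v, of z] B_nonneg by (intro mult_mono) auto
      then have zsa: "norm (z + s *\<^sub>R ?a) \<le> a + 1"
        using norm_triangle_ineq[of z "s *\<^sub>R ?a"] a(2)[OF z] s B_nonneg by simp
      \<comment> \<open>Both terms must be proportional to \<open>s\<close> to survive division by
        it. On the tail the Lipschitz bound alone provides this; a sup bound on \<phi> would
        not.\<close>
      have diff: "\<phi> (z + s *\<^sub>R ?a + y) - \<phi> (z + y) \<le> s * (1 + (k * \<delta> + C * L * \<delta>)) + s * (C * B) * indicator {y. \<delta> < norm y} y" for y
      proof (cases "\<delta> < norm y")
        case True
        have "\<phi> (z + s *\<^sub>R ?a + y) - \<phi> (z + y) \<le> C * norm (s *\<^sub>R ?a)"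
          using W_diff[of "z + y" "z + s *\<^sub>R ?a + y"] by (simp add: \<phi>_def algebra_simps)
        also have "\<dots> \<le> C * (s * B)" using C s F_bound[OF v, of z] by (intro mult_left_mono) auto
        moreover have "0 \<le> s * (1 + (k * \<delta> + C * L * \<delta>))" using s k C L_nonneg \<delta> by (intro mult_nonneg_nonneg add_nonneg_nonneg) auto
        ultimately show ?thesis using True by (simp add: mult_ac)
      next
        case False
        let ?y = "z + y"
        have "infdist ?y A \<le> norm y" using infdist_le[OF z, of ?y] by (simp add: dist_norm)
        also have "\<dots> \<le> \<delta>" using False by simp
        finally have "s * (1 + k * infdist ?y A) \<le> s * (1 + k * \<delta>)" using s k by (intro mult_left_mono add_left_mono) auto
        moreover have "?W ?y \<le> s * (1 + k * infdist ?y A) + ?W (?y + s *\<^sub>R F ?y v)"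
          using s v k by (intro chain_value_step) auto
        moreover have "?W (?y + s *\<^sub>R F ?y v) - ?W (?y + s *\<^sub>R ?a) \<le> C * (s * (L * \<delta>))"
        proof -
          have "?W (?y + s *\<^sub>R F ?y v) - ?W (?y + s *\<^sub>R ?a) \<le> C * norm (s *\<^sub>R (F ?y v - F z v))"
            using W_diff[of "?y + s *\<^sub>R F ?y v" "?y + s *\<^sub>R ?a"] by (simp add: scaleR_diff_right)
          also have "\<dots> \<le> C * (s * (L * norm (?y - z)))"
            using C s F_lipschitz[OF v, of ?y z] by (auto intro!: mult_left_mono)
          also have "\<dots> \<le> C * (s * (L * \<delta>))" using C s L_nonneg False by (intro mult_left_mono) auto
          finally show ?thesis .
        qed
        moreover have "?y + s *\<^sub>R ?a = z + s *\<^sub>R ?a + y" by simp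
        ultimately have "?W ?y - ?W (z + s *\<^sub>R ?a + y) \<le> s * (1 + k * \<delta>) + C * (s * (L * \<delta>))" by simp
        then show ?thesis using False by (simp add: \<phi>_def algebra_simps)
      qed
      have "Q\<^sub>0 (z + s *\<^sub>R ?a) - Q\<^sub>0 z = (LINT y|lborel. (\<phi> (z + s *\<^sub>R ?a + y) - \<phi> (z + y)) * p y)"
        using int[of z] int[of "z + s *\<^sub>R ?a"] by (simp add: Q\<^sub>0_eq[OF za] Q\<^sub>0_eq[OF zsa] left_diff_distrib)
      also have "\<dots> \<le> s * (1 + (k * \<delta> + C * L * \<delta>)) + s * (C * B) * e"
        using int[of z] int[of "z + s *\<^sub>R ?a"] diff s C B_nonneg by (intro avg) (auto simp: left_diff_distrib)
      also have "\<dots> = s * (1 + (k * \<delta> + C * L * \<delta>) + C * B * e)" by (simp add: algebra_simps)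
      also have "\<dots> \<le> s * (1 + \<epsilon>)" using s parts by (intro mult_left_mono) auto
      finally show "- (1 + \<epsilon>) * s \<le> Q (z + s *\<^sub>R ?a) - Q z" by (simp add: Q_def algebra_simps)
    qed
  qed
qed

end

section \<open>Differentiability of Lipschitz curves\<close>

text \<open>A strictly increasing bi-Lipschitz \<open>F\<close> transports Lebesgue measure to a measure with a density,
  and \<open>F\<close> is the indefinite integral of that density.\<close>

lemma bilipschitz_indefinite_integral:
  fixes F :: "real \<Rightarrow> real"
  assumes lower: "\<And>s t. s \<le> t \<Longrightarrow> t - s \<le> F t - F s" and upper: "C-lipschitz_on UNIV F"
  shows "\<exists>r. \<forall>a b. a \<le> b \<longrightarrow> (r has_integral (F b - F a)) {a..b}"
proof -
  have mono: "F s \<le> F t \<longleftrightarrow> s \<le> t" for s t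
    using lower[of s t] lower[of t s] by (cases "s \<le> t") auto
  have inj: "inj F" by (rule injI) (metis mono order_antisym order_refl)
  have cont: "continuous_on UNIV F" using upper lipschitz_on_continuous_on by blast
  have surj: "\<exists>t. F t = y" for y
  proof -
    define m where "m = \<bar>y\<bar> + \<bar>F 0\<bar>"
    have "F (- m) \<le> y" "y \<le> F m" using lower[of "-m" 0] lower[of 0 m] unfolding m_def by linarith+
    then show ?thesis using IVT'[of F "-m" y m] cont continuous_on_subset by (force simp: m_def)
  qed
  define G where "G = inv F"
  have FG: "F (G y) = y" and GF: "G (F t) = t" for y t
    using surj inj unfolding G_def by (metis f_inv_into_f rangeI, simp)
  have "1-lipschitz_on UNIV G"
  proof (rule lipschitz_onI)
    fix y z show "dist (G y) (G z) \<le> 1 * dist y z"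
      using lower[of "G y" "G z"] lower[of "G z" "G y"] FG by (cases "G y \<le> G z") (auto simp: dist_real_def)
  qed auto
  then have G_meas: "G \<in> borel_measurable borel"
    using lipschitz_on_continuous_on borel_measurable_continuous_onI by blast
  have pre: "G -` A = F ` A" for A
  proof (intro set_eqI iffI)
    fix y assume "y \<in> G -` A" then show "y \<in> F ` A" using FG[of y] by (metis image_eqI vimageE)
  qed (auto simp: GF)
  \<comment> \<open>Preimages under \<open>G\<close> are images under \<open>F\<close>, so \<nu>
    measures the length of the image; Lipschitz maps preserve null sets, which gives the
    density.\<close>
  define \<nu> where "\<nu> = distr lborel borel G"
  have \<nu>: "emeasure \<nu> A = emeasure lborel (F ` A)" if "A \<in> sets borel" for A
    using that G_meas pre by (simp add: \<nu>_def emeasure_distr)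
  have meas: "F ` A \<in> sets borel" if "A \<in> sets borel" for A
    using measurable_sets[OF G_meas that] pre by simp
  have "absolutely_continuous lborel \<nu>"
    unfolding absolutely_continuous_def
  proof
    fix A :: "real set" assume A: "A \<in> null_sets lborel"
    then have "negligible A"
      by (simp add: negligible_iff_null_sets null_sets_completionI)
    then have "negligible (F ` A)"
      using upper by (intro negligible_locally_Lipschitz_image)
        (auto simp: lipschitz_on_def dist_norm intro!: exI[of _ UNIV] exI[of _ C])
    moreover have "F ` A \<in> sets borel" using A by (intro meas) auto
    ultimately have "emeasure lborel (F ` A) = 0"
      by (simp add: negligible_iff_emeasure0)
    then show "A \<in> null_sets \<nu>" using A \<nu> by (auto simp: null_sets_def \<nu>_def)
  qed
  then obtain f where f: "f \<in> borel_measurable lborel" "density lborel f = \<nu>"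
    using sigma_finite_measure.Radon_Nikodym[OF lborel.sigma_finite_measure_axioms, of \<nu>] by (auto simp: \<nu>_def)
  show ?thesis
  proof (intro exI[of _ "\<lambda>x. enn2real (f x)"] allI impI)
    fix a b :: real assume ab: "a \<le> b"
    have "F ` {a..b} = {F a..F b}"
    proof (intro set_eqI iffI)
      fix y assume "y \<in> {F a..F b}"
      then show "y \<in> F ` {a..b}" using FG[of y] mono by (metis atLeastAtMost_iff image_eqI)
    qed (use mono in auto)
    then have "ennreal (F b - F a) = emeasure (density lborel f) {a..b}"
      using \<nu>[of "{a..b}"] f(2) mono ab by simp
    also have "\<dots> = (\<integral>\<^sup>+x. f x * indicator {a..b} x \<partial>lborel)"
      using f(1) by (intro emeasure_density) auto
    finally have eq: "(\<integral>\<^sup>+x. f x * indicator {a..b} x \<partial>lborel) = ennreal (F b - F a)" ..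
    \<comment> \<open>Where the density is finite, \<open>enn2real\<close> loses nothing.\<close>
    have "AE x in lborel. f x * indicator {a..b} x \<noteq> \<infinity>"
      using f(1) eq by (intro nn_integral_PInf_AE) auto
    then have "(\<integral>\<^sup>+x. ennreal (enn2real (f x) * indicator {a..b} x) \<partial>lborel) = (\<integral>\<^sup>+x. f x * indicator {a..b} x \<partial>lborel)"
      by (intro nn_integral_cong_AE, eventually_elim) (auto simp: indicator_def top.not_eq_extremum split: if_splits)
    then have "((\<lambda>x. enn2real (f x) * indicator {a..b} x) has_integral (F b - F a)) UNIV"
      using f(1) eq mono ab by (intro nn_integral_has_integral) auto
    also have "(\<lambda>x. enn2real (f x) * indicator {a..b} x) = (\<lambda>x. if x \<in> {a..b} then enn2real (f x) else 0)"
      by (auto simp: indicator_def)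
    finally show "((\<lambda>x. enn2real (f x)) has_integral (F b - F a)) {a..b}"
      by (simp only: has_integral_restrict_UNIV)
  qed
qed

text \<open>Adding (B + 1) t raises all slopes to at least 1, so the function becomes bi-Lipschitz
  and hence an indefinite integral; Lebesgue's differentiation theorem then applies.\<close>

lemma lipschitz_differentiable_ae:
  fixes g :: "real \<Rightarrow> real"
  assumes "B-lipschitz_on UNIV g"
  obtains N where "negligible N" "\<And>t. t \<notin> N \<Longrightarrow> \<exists>D. (g has_real_derivative D) (at t)"
proof -
  define F where "F = (\<lambda>t. g t + (B + 1) * t)"
  have B: "B \<ge> 0" using assms lipschitz_on_nonneg by blast
  have "t - s \<le> F t - F s" if "s \<le> t" for s t
    using lipschitz_onD[OF assms, of t s] that by (auto simp: F_def dist_real_def abs_le_iff algebra_simps)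
  moreover have "(B + (B + 1))-lipschitz_on UNIV F"
  proof -
    have "(B + 1)-lipschitz_on UNIV (\<lambda>t. (B + 1) * t)"
      using B by (intro lipschitz_onI) (auto simp: dist_real_def right_diff_distrib[symmetric] abs_mult)
    then show ?thesis unfolding F_def by (intro lipschitz_on_add assms)
  qed
  ultimately obtain r where r: "\<And>a b. a \<le> b \<Longrightarrow> (r has_integral (F b - F a)) {a..b}"
    using bilipschitz_indefinite_integral[of F "B + (B + 1)"] by blast
  \<comment> \<open>\<open>integrable_ccontinuous_explicit\<close> treats intervals to the right of
    a point. The reflected density supplies the left quotients, with the same limit
    \<open>r t\<close>.\<close>
  have r': "((\<lambda>x. r (- x)) has_integral (F (- a) - F (- b))) {a..b}" if "a \<le> b" for a b
    using r[of "-b" "-a"] that by (subst has_integral_reflect_real[symmetric]) auto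
  have "r integrable_on cbox a b" "(\<lambda>x. r (- x)) integrable_on cbox a b" for a b :: real
    by (cases "a \<le> b"; use r[of a b] r'[of a b] in \<open>auto simp: integrable_on_def\<close>)+
  then obtain N M where N: "negligible N" "\<And>x e. \<lbrakk>x \<notin> N; 0 < e\<rbrakk> \<Longrightarrow>
        \<exists>d>0. \<forall>h. 0 < h \<and> h < d \<longrightarrow> norm (integral (cbox x (x + h *\<^sub>R One)) r /\<^sub>R h ^ DIM(real) - r x) < e"
    and M: "negligible M" "\<And>x e. \<lbrakk>x \<notin> M; 0 < e\<rbrakk> \<Longrightarrow>
        \<exists>d>0. \<forall>h. 0 < h \<and> h < d \<longrightarrow> norm (integral (cbox x (x + h *\<^sub>R One)) (\<lambda>x. r (- x)) /\<^sub>R h ^ DIM(real) - r (- x)) < e"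
    using integrable_ccontinuous_explicit[of r] integrable_ccontinuous_explicit[of "\<lambda>x. r (- x)"] by metis
  have int: "integral (cbox x (x + h *\<^sub>R One)) r = F (x + h) - F x"
      "integral (cbox (- x) (- x + h *\<^sub>R One)) (\<lambda>x. r (- x)) = F x - F (x - h)" if "0 < h" for x h
    using integral_unique[OF r[of x "x + h"]] integral_unique[OF r'[of "-x" "-x + h"]] that by auto
  show thesis
  proof (rule that[of "N \<union> uminus ` M"])
    show "negligible (N \<union> uminus ` M)"
      using N(1) M(1) by (intro negligible_Un negligible_locally_Lipschitz_image)
        (auto intro!: exI[of _ UNIV] exI[of _ "1 :: real"])
    fix t assume t: "t \<notin> N \<union> uminus ` M"
    then have tM: "- t \<notin> M" by (metis UnCI add.inverse_inverse image_eqI)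
    have "((\<lambda>h. (F (t + h) - F t) / h) \<longlongrightarrow> r t) (at 0)"
      unfolding LIM_eq
    proof (intro allI impI)
      fix e :: real assume "e > 0"
      obtain d where d: "d > 0" "\<And>h. 0 < h \<Longrightarrow> h < d \<Longrightarrow> \<bar>(F (t + h) - F t) / h - r t\<bar> < e"
        using N(2)[of t e] t \<open>e > 0\<close> int(1) by (auto simp: divide_inverse mult.commute)
      obtain d' where d': "d' > 0" "\<And>h. 0 < h \<Longrightarrow> h < d' \<Longrightarrow> \<bar>(F t - F (t - h)) / h - r t\<bar> < e"
        using M(2)[of "-t" e] tM \<open>e > 0\<close> int(2) by (auto simp: divide_inverse mult.commute)
      show "\<exists>s>0. \<forall>h :: real. h \<noteq> 0 \<and> norm (h - 0) < s \<longrightarrow> norm ((F (t + h) - F t) / h - r t) < e"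
      proof (intro exI[of _ "min d d'"] conjI allI impI)
        fix h :: real assume h: "h \<noteq> 0 \<and> norm (h - 0) < min d d'"
        show "norm ((F (t + h) - F t) / h - r t) < e"
        proof (cases "h > 0")
          case False
          then have "(F t - F (t - (- h))) / (- h) = (F (t + h) - F t) / h"
            using h by (simp add: field_simps)
          then show ?thesis using d'(2)[of "- h"] h False by auto
        qed (use d(2)[of h] h in auto)
      qed (use d d' in auto)
    qed
    then have "(F has_real_derivative r t) (at t)" by (simp add: DERIV_def)
    then have "((\<lambda>s. F s - (B + 1) * s) has_real_derivative r t - (B + 1)) (at t)"
      by (auto intro!: derivative_eq_intros)
    then show "\<exists>D. (g has_real_derivative D) (at t)" by (auto simp: F_def)
  qed
qed

lemma lipschitz_vector_differentiable_ae:
  fixes g :: "real \<Rightarrow> 'a::euclidean_space"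
  assumes "B-lipschitz_on UNIV g"
  obtains N where "negligible N" "\<And>t. t \<notin> N \<Longrightarrow> \<exists>D. (g has_vector_derivative D) (at t)"
proof -
  have "\<exists>N. negligible N \<and> (\<forall>t. t \<notin> N \<longrightarrow> (\<exists>D. ((\<lambda>t. g t \<bullet> b) has_real_derivative D) (at t)))" if b: "b \<in> Basis" for b
  proof -
    have "\<bar>g s \<bullet> b - g t \<bullet> b\<bar> \<le> B * \<bar>s - t\<bar>" for s t
    proof -
      have "\<bar>g s \<bullet> b - g t \<bullet> b\<bar> \<le> norm (g s - g t)"
        using Basis_le_norm[OF b, of "g s - g t"] by (simp add: inner_diff_left)
      also have "\<dots> \<le> B * \<bar>s - t\<bar>" using lipschitz_onD[OF assms, of s t] by (simp add: dist_norm)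
      finally show ?thesis .
    qed
    then have "B-lipschitz_on UNIV (\<lambda>t. g t \<bullet> b)"
      using lipschitz_on_nonneg[OF assms] by (intro lipschitz_onI) (auto simp: dist_real_def)
    then show ?thesis using lipschitz_differentiable_ae by metis
  qed
  then obtain N where N: "\<And>b. b \<in> Basis \<Longrightarrow> negligible (N b)"
      "\<And>b t. b \<in> Basis \<Longrightarrow> t \<notin> N b \<Longrightarrow> \<exists>D. ((\<lambda>t. g t \<bullet> b) has_real_derivative D) (at t)"
    by metis
  show thesis
  proof (rule that[of "\<Union>b\<in>Basis. N b"])
    show "negligible (\<Union>b\<in>Basis. N b)" using N(1) by (intro negligible_Union) auto
    fix t assume "t \<notin> (\<Union>b\<in>Basis. N b)"
    then have "\<forall>b\<in>Basis. \<exists>D. ((\<lambda>t. g t \<bullet> b) has_real_derivative D) (at t)" using N(2) by blast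
    then obtain D where D: "\<And>b. b \<in> Basis \<Longrightarrow> ((\<lambda>t. g t \<bullet> b) has_real_derivative D b) (at t)" by metis
    have "(g has_vector_derivative (\<Sum>b\<in>Basis. D b *\<^sub>R b)) (at t)"
      unfolding has_vector_derivative_def has_derivative_componentwise_within[of g]
    proof
      fix b :: 'a assume b: "b \<in> Basis"
      have "((\<Sum>b\<in>Basis. D b *\<^sub>R b) \<bullet> b) = D b" using b by simp
      then show "((\<lambda>x. g x \<bullet> b) has_derivative (\<lambda>x. x *\<^sub>R (\<Sum>b\<in>Basis. D b *\<^sub>R b) \<bullet> b)) (at t)"
        using D[OF b] by (simp add: has_field_derivative_def mult.commute[of _ "D b"])
    qed
    then show "\<exists>D. (g has_vector_derivative D) (at t)" by blast
  qed
qed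

section \<open>Measurable selection\<close>

text \<open>Given, for each \<open>t\<close>, a nonempty compact set \<open>S t\<close>, intersect it successively with the first ball of the
  \<open>n\<close>-th finite cover that it hits; the sets shrink to a point. Measurability is carried along as measurability
  of \<open>{t. S\<^sub>n t \<inter> C \<noteq> {}}\<close> for closed \<open>C\<close>.\<close>

lemma measurable_selection:
  fixes S :: "'t \<Rightarrow> 'b::euclidean_space set"
  assumes U: "compact U" and S: "\<And>t. t \<in> space M \<Longrightarrow> S t \<noteq> {} \<and> closed (S t) \<and> S t \<subseteq> U"
    and meas: "\<And>C. closed C \<Longrightarrow> {t \<in> space M. S t \<inter> C \<noteq> {}} \<in> sets M"
  obtains u where "u \<in> borel_measurable M" "\<And>t. t \<in> space M \<Longrightarrow> u t \<in> S t"
proof -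
  have "\<exists>xs :: 'b list. U \<subseteq> (\<Union>x\<in>set xs. cball x (inverse (Suc n)))" for n
  proof -
    have "U \<subseteq> (\<Union>x\<in>U. ball x (inverse (Suc n)))" by force
    then obtain D where "finite D" "U \<subseteq> (\<Union>x\<in>D. ball x (inverse (Suc n)))"
      using compactE_image[OF U, of U "\<lambda>x. ball x (inverse (Suc n))"] by (metis open_ball)
    moreover obtain xs where "set xs = D" using \<open>finite D\<close> finite_list by blast
    ultimately show ?thesis using ball_subset_cball by (intro exI[of _ xs]) blast
  qed
  then obtain xs :: "nat \<Rightarrow> 'b list" where xs: "\<And>n. U \<subseteq> (\<Union>x\<in>set (xs n). cball x (inverse (Suc n)))"
    by metis
  \<comment> \<open>Indices past the end of the list denote unspecified balls of the same radius. By
    \<open>cover\<close> the least index hit by a nonempty subset of \<open>U\<close> is within the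
    list.\<close>
  define B where "B = (\<lambda>n i. cball (xs n ! i) (inverse (Suc n)))"
  have cover: "\<exists>i<length (xs n). x \<in> B n i" if xU: "x \<in> U" for n x
  proof -
    obtain y where "y \<in> set (xs n)" "x \<in> cball y (inverse (Suc n))" using xs[of n] xU by blast
    then show ?thesis unfolding B_def by (metis in_set_conv_nth)
  qed
  define R where "R = rec_nat S (\<lambda>n A t. A t \<inter> B n (LEAST i. A t \<inter> B n i \<noteq> {}))"
  have R0: "R 0 = S" and RS: "\<And>n t. R (Suc n) t = R n t \<inter> B n (LEAST i. R n t \<inter> B n i \<noteq> {})"
    by (simp_all add: R_def)
  have R: "R n t \<noteq> {} \<and> closed (R n t) \<and> R n t \<subseteq> U" if "t \<in> space M" for n t
  proof (induction n)
    case 0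
    then show ?case using S[OF that] R0 by simp
  next
    case (Suc n)
    then obtain x where "x \<in> R n t" by blast
    then obtain i where "R n t \<inter> B n i \<noteq> {}" using cover[of x n] Suc by blast
    then have "R n t \<inter> B n (LEAST i. R n t \<inter> B n i \<noteq> {}) \<noteq> {}" by (rule LeastI)
    then show ?case using Suc unfolding RS by (auto simp: B_def)
  qed
  have Rmeas: "{t \<in> space M. R n t \<inter> C \<noteq> {}} \<in> sets M" if "closed C" for n C
    using that
  proof (induction n arbitrary: C)
    case 0
    then show ?case using meas R0 by simp
  next
    case (Suc n)
    \<comment> \<open>Index \<open>i\<close> is chosen exactly when \<open>R n t\<close> meets ball
      \<open>i\<close> and no earlier one. As balls and \<open>C\<close> are closed, everything is
      expressed through hitting sets at stage \<open>n\<close>.\<close>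
    have "{t \<in> space M. R (Suc n) t \<inter> C \<noteq> {}} =
      (\<Union>i. ({t \<in> space M. R n t \<inter> B n i \<noteq> {}} - (\<Union>j<i. {t \<in> space M. R n t \<inter> B n j \<noteq> {}}))
         \<inter> {t \<in> space M. R n t \<inter> (B n i \<inter> C) \<noteq> {}})" (is "?L = (\<Union>i. ?P i)")
    proof (intro set_eqI iffI)
      fix t assume t: "t \<in> ?L"
      define i where "i = (LEAST i. R n t \<inter> B n i \<noteq> {})"
      have "R n t \<inter> B n i \<inter> C \<noteq> {}" using t by (simp add: RS i_def)
      moreover have "\<not> R n t \<inter> B n j \<noteq> {}" if "j < i" for j
        using not_less_Least that unfolding i_def by blast
      ultimately have "t \<in> ?P i" using t by auto
      then show "t \<in> (\<Union>i. ?P i)" by blast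
    next
      fix t assume "t \<in> (\<Union>i. ?P i)"
      then obtain i where i: "t \<in> ?P i" by blast
      then have "(LEAST i. R n t \<inter> B n i \<noteq> {}) = i"
        by (intro Least_equality) (auto simp: not_less[symmetric])
      then show "t \<in> ?L" using i by (auto simp: RS)
    qed
    also have "\<dots> \<in> sets M"
      using Suc.prems by (intro sets.countable_UN sets.Int sets.Diff sets.finite_UN Suc.IH)
        (auto simp: B_def intro!: Suc.IH)
    finally show ?case .
  qed
  have dec: "R n t \<subseteq> R m t" if "m \<le> n" for m n t
    using that by (induction rule: dec_induct) (auto simp: RS)
  have Rcomp: "compact (R n t \<inter> C)" if "t \<in> space M" "closed C" for n t C
    using R[OF that(1), of n] U that(2) compact_Int_closed[of U "R n t \<inter> C"]
    by (metis Int_assoc closed_Int inf.absorb_iff2)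
  have ne: "(\<Inter>n. R n t \<inter> C) \<noteq> {}" if "t \<in> space M" "closed C" "\<And>n. R n t \<inter> C \<noteq> {}" for t C
    using dec by (intro compact_nest Rcomp that) blast
  define u where "u = (\<lambda>t. SOME x. x \<in> (\<Inter>n. R n t))"
  have u: "u t \<in> R n t" if "t \<in> space M" for t n
  proof -
    have "(\<Inter>n. R n t) \<noteq> {}" using ne[OF that, of UNIV] R[OF that] by simp
    then have "u t \<in> (\<Inter>n. R n t)" unfolding u_def by (simp only: some_in_eq not_False_eq_True)
    then show ?thesis by blast
  qed
  \<comment> \<open>Stage \<open>Suc n\<close> lies in a ball of radius 1 / (n + 1), so the
    intersection of all stages is a single point.\<close>
  have uniq: "x = u t" if t: "t \<in> space M" and x: "x \<in> (\<Inter>n. R n t)" for x t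
  proof -
    have "dist x (u t) \<le> 2 * inverse (Suc n)" for n
    proof -
      obtain c where "R (Suc n) t \<subseteq> cball c (inverse (Suc n))" by (auto simp: RS B_def)
      then have "dist c x \<le> inverse (Suc n)" "dist c (u t) \<le> inverse (Suc n)"
        using x u[OF t, of "Suc n"] by auto
      then show ?thesis using dist_triangle3[of x "u t" c] by linarith
    qed
    moreover have "(\<lambda>n. 2 * inverse (real (Suc n))) \<longlonglongrightarrow> 2 * 0"
      by (intro tendsto_intros LIMSEQ_inverse_real_of_nat)
    ultimately have "dist x (u t) \<le> 2 * 0" by (intro LIMSEQ_le_const) blast+
    then show ?thesis by simp
  qed
  show thesis
  proof (rule that[of u])
    show "u t \<in> S t" if "t \<in> space M" for t using u[OF that, of 0] R0 by simp
    show "u \<in> borel_measurable M"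
    proof (rule borel_measurableI)
      fix W :: "'b set" assume "open W"
      define C where "C = - W"
      have C: "closed C" using \<open>open W\<close> by (simp add: C_def closed_Compl)
      \<comment> \<open>If every stage meets \<open>C\<close>, nested compactness puts a common
        point in \<open>C\<close>, and by \<open>uniq\<close> that point is
        \<open>u t\<close>.\<close>
      have "u -` C \<inter> space M = (\<Inter>n. {t \<in> space M. R n t \<inter> C \<noteq> {}})"
      proof (intro set_eqI iffI)
        fix t assume "t \<in> (\<Inter>n. {t \<in> space M. R n t \<inter> C \<noteq> {}})"
        then have t: "t \<in> space M" "\<And>n. R n t \<inter> C \<noteq> {}" by auto
        obtain x where "x \<in> (\<Inter>n. R n t \<inter> C)" using ne[OF t(1) C t(2)] by blast
        then have "x \<in> C" "x = u t" using uniq[OF t(1), of x] by auto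
        then show "t \<in> u -` C \<inter> space M" using t by simp
      qed (use u in blast)
      also have "\<dots> \<in> sets M" using Rmeas[OF C] by (intro sets.countable_INT) auto
      finally have "space M - (u -` C \<inter> space M) \<in> sets M" by (rule sets.compl_sets)
      also have "space M - (u -` C \<inter> space M) = u -` W \<inter> space M" by (auto simp: C_def)
      finally show "u -` W \<inter> space M \<in> sets M" .
    qed
  qed
qed

text \<open>Filippov's implicit function lemma. A continuous function on a compact set has a zero
  there iff it is arbitrarily small on a countable dense subset, which makes the hitting sets
  countable combinations of measurable sets.\<close>

lemma measurable_implicit_selection:
  fixes g :: "'t \<Rightarrow> 'b::euclidean_space \<Rightarrow> 'c::euclidean_space"
  assumes U: "compact U"
    and g: "\<And>v. v \<in> U \<Longrightarrow> (\<lambda>t. g t v) \<in> borel_measurable M" "\<And>t. t \<in> space M \<Longrightarrow> continuous_on U (g t)"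
    and sol: "\<And>t. t \<in> space M \<Longrightarrow> \<exists>v\<in>U. g t v = 0"
  obtains u where "u \<in> borel_measurable M" "\<And>t. t \<in> space M \<Longrightarrow> u t \<in> U \<and> g t (u t) = 0"
proof -
  define S where "S = (\<lambda>t. {v \<in> U. g t v = 0})"
  have closed: "closed (S t)" if "t \<in> space M" for t
    using continuous_closed_preimage_constant[OF g(2)[OF that] compact_imp_closed[OF U], of 0] by (simp add: S_def)
  have "{t \<in> space M. S t \<inter> C \<noteq> {}} \<in> sets M" if C: "closed C" for C
  proof -
    \<comment> \<open>Density is taken in U \<inter> C rather than in \<open>U\<close>, since points
      of a dense subset of \<open>U\<close> may all miss \<open>C\<close>.\<close>
    obtain D where D: "countable D" "D \<subseteq> U \<inter> C" "U \<inter> C \<subseteq> closure D"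
      using separable by blast
    have "{t \<in> space M. S t \<inter> C \<noteq> {}} = (\<Inter>n. \<Union>v\<in>D. {t \<in> space M. norm (g t v) < inverse (Suc n)})" (is "?L = ?R")
    proof (intro set_eqI iffI)
      fix t assume "t \<in> ?L"
      then obtain v where t: "t \<in> space M" and v: "v \<in> U" "v \<in> C" "g t v = 0" by (auto simp: S_def)
      have "\<exists>w\<in>D. norm (g t w) < inverse (Suc n)" for n
      proof -
        obtain d where d: "d > 0" "\<And>w. w \<in> U \<Longrightarrow> dist w v < d \<Longrightarrow> dist (g t w) (g t v) < inverse (Suc n)"
          using g(2)[OF t] v(1) unfolding continuous_on_iff by (metis inverse_positive_iff_positive of_nat_0_less_iff zero_less_Suc)
        obtain w where "w \<in> D" "dist w v < d" using D(3) v d(1) closure_approachable by blast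
        then show ?thesis using d(2)[of w] D(2) v(3) by (auto simp: dist_norm)
      qed
      then show "t \<in> ?R" using t by blast
    next
      fix t assume t': "t \<in> ?R"
      then have t: "t \<in> space M" by blast
      have c: "compact (U \<inter> C)" using U C by (rule compact_Int_closed)
      have "U \<inter> C \<noteq> {}" using t' D(2) by fast
      moreover have "continuous_on (U \<inter> C) (\<lambda>v. norm (g t v))"
        using g(2)[OF t] continuous_on_subset by (intro continuous_intros) blast
      ultimately obtain v where v: "v \<in> U \<inter> C" "\<And>w. w \<in> U \<inter> C \<Longrightarrow> norm (g t v) \<le> norm (g t w)"
        using continuous_attains_inf[OF c] by metis
      have "norm (g t v) \<le> inverse (real (Suc n))" for n
      proof -
        obtain w where "w \<in> D" "norm (g t w) < inverse (Suc n)" using t' by blast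
        then show ?thesis using v(2)[of w] D(2) by force
      qed
      then have "norm (g t v) \<le> 0" using LIMSEQ_inverse_real_of_nat by (intro LIMSEQ_le_const) blast+
      then show "t \<in> ?L" using v t by (auto simp: S_def)
    qed
    also have "\<dots> \<in> sets M"
    proof (intro sets.countable_INT)
      show "range (\<lambda>n. \<Union>v\<in>D. {t \<in> space M. norm (g t v) < inverse (Suc n)}) \<subseteq> sets M"
        using D g(1) by (auto intro!: sets.countable_UN' borel_measurable_less borel_measurable_norm)
    qed simp
    finally show ?thesis .
  qed
  then show thesis
    using measurable_selection[OF U, of M S] closed sol that unfolding S_def by (smt (verit) Collect_empty_eq mem_Collect_eq subsetI)
qed

section \<open>From the differential inclusion to an admissible control\<close>

lemma lipschitz_imp_abs_cont_on:
  fixes x :: "real \<Rightarrow> 'a::real_normed_vector"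
  assumes "B-lipschitz_on {a..b} x"
  shows "abs_cont_on a b x"
  unfolding abs_cont_on_def
proof (intro allI impI)
  fix \<epsilon> :: real assume "\<epsilon> > 0"
  have B: "0 \<le> B" using assms lipschitz_on_nonneg by blast
  show "\<exists>\<delta>>0. \<forall>(N::nat) p q. (\<forall>i<N. a \<le> p i \<and> p i \<le> q i \<and> q i \<le> b) \<and>
      disjoint_family_on (\<lambda>i. {p i<..<q i}) {..<N} \<and> (\<Sum>i<N. q i - p i) < \<delta> \<longrightarrow>
      (\<Sum>i<N. norm (x (q i) - x (p i))) < \<epsilon>"
  proof (intro exI[of _ "\<epsilon> / (B + 1)"] conjI allI impI)
    fix N :: nat and p q :: "nat \<Rightarrow> real"
    assume A: "(\<forall>i<N. a \<le> p i \<and> p i \<le> q i \<and> q i \<le> b) \<and>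
      disjoint_family_on (\<lambda>i. {p i<..<q i}) {..<N} \<and> (\<Sum>i<N. q i - p i) < \<epsilon> / (B + 1)"
    have "(\<Sum>i<N. norm (x (q i) - x (p i))) \<le> (\<Sum>i<N. (B + 1) * (q i - p i))"
    proof (rule sum_mono)
      fix i assume "i \<in> {..<N}"
      then have pq: "a \<le> p i" "p i \<le> q i" "q i \<le> b" using A by auto
      then have "norm (x (q i) - x (p i)) \<le> B * (q i - p i)"
        using lipschitz_onD[OF assms, of "q i" "p i"] by (simp add: dist_norm)
      also have "\<dots> \<le> (B + 1) * (q i - p i)" using pq by (intro mult_right_mono) auto
      finally show "norm (x (q i) - x (p i)) \<le> (B + 1) * (q i - p i)" .
    qed
    also have "\<dots> = (B + 1) * (\<Sum>i<N. q i - p i)" by (simp add: sum_distrib_left)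
    also have "\<dots> < \<epsilon>" using A B by (simp add: field_simps)
    finally show "(\<Sum>i<N. norm (x (q i) - x (p i))) < \<epsilon>" .
  qed (use \<open>\<epsilon> > 0\<close> B in auto)
qed

lemma has_vector_derivative_imp_tendsto:
  fixes z :: "real \<Rightarrow> 'a::real_normed_vector"
  assumes "(z has_vector_derivative D) (at t)"
  shows "((\<lambda>h. (z (t + h) - z t) /\<^sub>R h) \<longlongrightarrow> D) (at 0)"
proof -
  have "((\<lambda>h. norm (z (t + h) - z t - h *\<^sub>R D) / norm h) \<longlongrightarrow> 0) (at 0)"
    using assms unfolding has_vector_derivative_def has_derivative_at by blast
  moreover have "eventually (\<lambda>h. norm (z (t + h) - z t - h *\<^sub>R D) / norm h = norm ((z (t + h) - z t) /\<^sub>R h - D)) (at 0)"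
    unfolding eventually_at_filter
  proof (rule always_eventually, intro allI impI)
    fix h :: real assume "h \<noteq> 0"
    then have "z (t + h) - z t - h *\<^sub>R D = h *\<^sub>R ((z (t + h) - z t) /\<^sub>R h - D)"
      by (simp add: scaleR_diff_right)
    then have "norm (z (t + h) - z t - h *\<^sub>R D) = \<bar>h\<bar> * norm ((z (t + h) - z t) /\<^sub>R h - D)"
      by (metis norm_scaleR)
    then show "norm (z (t + h) - z t - h *\<^sub>R D) / norm h = norm ((z (t + h) - z t) /\<^sub>R h - D)"
      using \<open>h \<noteq> 0\<close> by simp
  qed
  ultimately have "((\<lambda>h. norm ((z (t + h) - z t) /\<^sub>R h - D)) \<longlongrightarrow> 0) (at 0)"
    by (rule Lim_transform_eventually)
  then show ?thesis by (simp only: tendsto_norm_zero_iff LIM_zero_iff)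
qed

text \<open>If the velocity at \<open>t\<close> lay outside the compact convex set f(t, y(t), U), a
  hyperplane would separate them strictly. \<open>dir\<close> for its normal, divided by the time
  increment, contradicts this in the limit, as the \<open>C\<close> term vanishes. Filippov's lemma
  then supplies the control.\<close>

lemma differential_inclusion_admissible:
  fixes f :: "real \<Rightarrow> real^'n \<Rightarrow> real^'m \<Rightarrow> real^'n" and y :: "real \<Rightarrow> real^'n"
  assumes f: "continuous_on UNIV (\<lambda>(t, x, v). f t x v)"
    and U: "compact U" "U \<noteq> {}"
    and conv: "\<And>t. t \<in> {0..\<tau>} \<Longrightarrow> convex (f t (y t) ` U)"
    and \<tau>: "0 \<le> \<tau>"
    and y: "B-lipschitz_on {0..\<tau>} y" "y 0 = x\<^sub>0" "y \<tau> \<in> K" "\<And>t. t \<in> {0..\<tau>} \<Longrightarrow> y t \<in> X"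
    and dir: "\<And>a b s s'. 0 \<le> s \<Longrightarrow> s < s' \<Longrightarrow> s' < \<tau> \<Longrightarrow> (\<And>v. v \<in> U \<Longrightarrow> a \<bullet> f s (y s) v \<le> b) \<Longrightarrow>
       a \<bullet> (y s' - y s) \<le> (b + C * norm a * (s' - s)) * (s' - s)"
  shows "\<exists>u. u \<in> admissible_controls f X U K 0 \<tau> x\<^sub>0"
proof -
  \<comment> \<open>Constant continuation beyond both ends, so that results for Lipschitz curves on
    the whole line apply.\<close>
  define z where "z = (\<lambda>t. y (max 0 (min t \<tau>)))"
  have zy: "z t = y t" if "t \<in> {0..\<tau>}" for t using that by (simp add: z_def)
  have z_lip: "B-lipschitz_on UNIV z"
  proof (rule lipschitz_onI)
    fix s t :: real
    have "dist (z s) (z t) \<le> B * dist (max 0 (min s \<tau>)) (max 0 (min t \<tau>))"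
      unfolding z_def using \<tau> by (intro lipschitz_onD[OF y(1)]) auto
    also have "\<dots> \<le> B * dist s t"
      using lipschitz_on_nonneg[OF y(1)] by (intro mult_left_mono) (auto simp: dist_real_def)
    finally show "dist (z s) (z t) \<le> B * dist s t" .
  qed (use lipschitz_on_nonneg[OF y(1)] in simp)
  have z_cont: "continuous_on UNIV z" using z_lip lipschitz_on_continuous_on by blast
  obtain N where N: "negligible N" "\<And>t. t \<notin> N \<Longrightarrow> \<exists>D. (z has_vector_derivative D) (at t)"
    using lipschitz_vector_differentiable_ae[OF z_lip] by blast
  define G where "G = {0<..<\<tau>} - N"
  define D where "D = (\<lambda>t. vector_derivative z (at t))"
  have D: "(z has_vector_derivative D t) (at t)" if "t \<in> G" for t
    using N(2)[of t] that unfolding D_def G_def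
    by (metis DiffE differentiableI_vector vector_derivative_works)
  have f_cont: "continuous_on S (\<lambda>w. f (t w) (x w) (v w))"
    if "continuous_on S t" "continuous_on S x" "continuous_on S v" for S and t :: "_ \<Rightarrow> real" and x v
    using continuous_on_compose2[OF f continuous_on_Pair[OF that(1) continuous_on_Pair[OF that(2,3)]]] by simp
  have incl: "D t \<in> f t (z t) ` U" if t: "t \<in> G" for t
  proof (rule ccontr)
    assume contra: "D t \<notin> f t (z t) ` U"
    have t': "0 < t" "t < \<tau>" using t by (auto simp: G_def)
    have eq: "z t = y t" using zy t' by simp
    have "compact (f t (z t) ` U)"
      using U(1) by (intro compact_continuous_image f_cont continuous_intros)
    then have "\<exists>a b. a \<bullet> D t < b \<and> (\<forall>x\<in>f t (z t) ` U. b < a \<bullet> x)"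
      using conv[of t] t' contra eq by (intro separating_hyperplane_closed_point compact_imp_closed) auto
    then obtain a b where ab: "a \<bullet> D t < b" "\<And>x. x \<in> f t (z t) ` U \<Longrightarrow> b < a \<bullet> x"
      by blast
    have "((\<lambda>h. (- a) \<bullet> ((z (t + h) - z t) /\<^sub>R h)) \<longlongrightarrow> (- a) \<bullet> D t) (at_right 0)"
      using has_vector_derivative_imp_tendsto[OF D[OF t]]
      by (intro tendsto_intros) (rule tendsto_within_subset, auto)
    moreover have "((\<lambda>h. - b + C * norm (- a) * h) \<longlongrightarrow> - b + C * norm (- a) * 0) (at_right 0)"
      by (intro tendsto_intros)
    moreover have "eventually (\<lambda>h. h \<in> {0<..<\<tau> - t}) (at_right 0)"
      using eventually_at_right_real[of 0 "\<tau> - t"] t' by simp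
    then have "eventually (\<lambda>h. (- a) \<bullet> ((z (t + h) - z t) /\<^sub>R h) \<le> - b + C * norm (- a) * h) (at_right 0)"
    proof eventually_elim
      case (elim h)
      have "(- a) \<bullet> (y (t + h) - y t) \<le> (- b + C * norm (- a) * (t + h - t)) * (t + h - t)"
      proof (rule dir)
        fix v assume "v \<in> U"
        then have "b < a \<bullet> f t (y t) v" using ab(2)[of "f t (z t) v"] eq by simp
        then show "(- a) \<bullet> f t (y t) v \<le> - b" by simp
      qed (use t' elim in auto)
      moreover have "z (t + h) = y (t + h)" using zy t' elim by simp
      ultimately have "(- a) \<bullet> (z (t + h) - z t) \<le> (- b + C * norm (- a) * h) * h" using eq by simp
      then have "((- a) \<bullet> (z (t + h) - z t)) / h \<le> - b + C * norm (- a) * h"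
        using elim by (simp only: pos_divide_le_eq greaterThanLessThan_iff)
      then show ?case by (simp only: inner_scaleR_right divide_inverse mult.commute)
    qed
    ultimately have "(- a) \<bullet> D t \<le> - b + C * norm (- a) * 0"
      by (intro tendsto_le[OF trivial_limit_at_right_real])
    then show False using ab(1) by simp
  qed
  have G: "G \<in> sets lebesgue" using N(1) by (auto simp: G_def negligible_imp_sets)
  have "\<exists>v\<in>U. f t (z t) v - D t = 0" if "t \<in> space (lebesgue_on G)" for t
    using incl[of t] that by auto
  moreover have "(\<lambda>t. f t (z t) v - D t) \<in> borel_measurable (lebesgue_on G)" for v
  proof (rule borel_measurable_diff)
    have cont_meas: "h \<in> borel_measurable (lebesgue_on G)" if "continuous_on UNIV h" for h :: "real \<Rightarrow> real^'n"
      using that by (intro measurable_restrict_space1 measurable_completion) (simp add: borel_measurable_continuous_onI)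
    show "(\<lambda>t. f t (z t) v) \<in> borel_measurable (lebesgue_on G)"
      by (intro cont_meas f_cont z_cont continuous_intros)
    \<comment> \<open>On \<open>G\<close> the derivative is the pointwise limit of continuous
      difference quotients.\<close>
    show "D \<in> borel_measurable (lebesgue_on G)"
    proof (rule borel_measurable_LIMSEQ_metric)
      let ?h = "\<lambda>n. inverse (real (Suc n))"
      show "(\<lambda>t. (z (t + ?h n) - z t) /\<^sub>R ?h n) \<in> borel_measurable (lebesgue_on G)" for n
        by (intro cont_meas continuous_intros continuous_on_compose2[OF z_cont]) auto
      fix t assume "t \<in> space (lebesgue_on G)"
      then have "t \<in> G" by simp
      have "filterlim ?h (at 0) sequentially"
        unfolding filterlim_at using LIMSEQ_inverse_real_of_nat by (auto simp: o_def)
      then show "(\<lambda>n. (z (t + ?h n) - z t) /\<^sub>R ?h n) \<longlonglongrightarrow> D t"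
        by (rule filterlim_compose[OF has_vector_derivative_imp_tendsto[OF D[OF \<open>t \<in> G\<close>]]])
    qed
  qed
  moreover have "continuous_on U (\<lambda>v. f t (z t) v - D t)" for t
    by (intro continuous_intros f_cont)
  ultimately obtain w where w: "w \<in> borel_measurable (lebesgue_on G)"
      "\<And>t. t \<in> space (lebesgue_on G) \<Longrightarrow> w t \<in> U \<and> f t (z t) (w t) - D t = 0"
    using measurable_implicit_selection[OF U(1), of "\<lambda>t v. f t (z t) v - D t" "lebesgue_on G"] by blast
  obtain v\<^sub>0 where v\<^sub>0: "v\<^sub>0 \<in> U" using U(2) by blast
  define u where "u = (\<lambda>t. if t \<in> G then w t else v\<^sub>0)"
  have uU: "u t \<in> U" for t using w(2)[of t] v\<^sub>0 by (auto simp: u_def)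
  have "u \<in> borel_measurable lebesgue"
    unfolding u_def using measurable_restrict_space_iff[of G lebesgue v\<^sub>0 borel w] G w(1) by simp
  then have u_meas: "u \<in> borel_measurable (lebesgue_on {0..\<tau>})" by (rule measurable_restrict_space1)
  have G_ae: "AE t in lebesgue_on {0..\<tau>}. t \<in> G"
  proof -
    have "negligible (N \<union> {0, \<tau>})" using N(1) by (intro negligible_Un) auto
    then have "N \<union> {0, \<tau>} \<in> null_sets lebesgue" by (simp only: negligible_iff_null_sets)
    then have "AE t in lebesgue. t \<notin> N \<union> {0, \<tau>}" by (rule AE_not_in)
    then have "AE t in lebesgue. t \<in> {0..\<tau>} \<longrightarrow> t \<in> G"
      by (rule eventually_mono) (auto simp: G_def)
    then show ?thesis by (simp add: AE_restrict_space_iff)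
  qed
  have "trajectory f 0 \<tau> x\<^sub>0 u z"
    unfolding trajectory_def
  proof (intro conjI)
    show "abs_cont_on 0 \<tau> z"
      using z_lip lipschitz_on_subset by (intro lipschitz_imp_abs_cont_on[of B]) blast
    show "z 0 = x\<^sub>0" using zy[of 0] \<tau> y(2) by simp
    show "AE t in lebesgue_on {0..\<tau>}. (z has_vector_derivative f t (z t) (u t)) (at t within {0..\<tau>})"
      using G_ae
    proof eventually_elim
      case (elim t)
      then have "f t (z t) (u t) = D t" using w(2)[of t] by (simp add: u_def)
      then show ?case using D[OF elim] has_vector_derivative_at_within by metis
    qed
  qed
  moreover have "AE t in lebesgue_on {0..\<tau>}. (z t, u t) \<in> X \<times> U"
    using G_ae
  proof eventually_elim
    case (elim t)
    then have "t \<in> {0..\<tau>}" by (auto simp: G_def)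
    then show ?case using y(4) zy uU by auto
  qed
  moreover have "z \<tau> \<in> K" using zy[of \<tau>] \<tau> y(3) by simp
  moreover have "u ` {0..\<tau>} \<subseteq> U" using uU by blast
  moreover have "bounded (u ` {0..\<tau>})" using compact_imp_bounded[OF U(1)] \<open>u ` {0..\<tau>} \<subseteq> U\<close> bounded_subset by blast
  ultimately show ?thesis using u_meas unfolding admissible_controls_def by blast
qed

section \<open>The lower bound\<close>

lemma val_R_approximates_value:
  fixes f :: "real \<Rightarrow> real^'n \<Rightarrow> real^'m \<Rightarrow> real^'n"
    and X K :: "(real^'n) set" and U :: "(real^'m) set"
  assumes T: "T > 0"
    and f: "L-lipschitz_on UNIV (\<lambda>(t, x, v). f t x v)"
    and U: "compact U" "U \<noteq> {}"
    and X: "compact X" and K: "compact K" "K \<subseteq> X"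
    and conv: "\<And>t x. t \<in> {0..T} \<Longrightarrow> x \<in> X \<Longrightarrow> convex (f t x ` U)"
    and x0: "x\<^sub>0 \<in> X" and t1: "t\<^sub>1 \<in> {0..T}" and u: "u \<in> admissible_controls f X U K 0 t\<^sub>1 x\<^sub>0"
    and c: "ereal c < value_function f X U K T 0 x\<^sub>0"
  shows "\<exists>d. \<exists>V\<in>feasible_R f X U K T d. c < V 0 x\<^sub>0"
proof -
  let ?A = "{0..T} \<times> X" and ?K = "{0..T} \<times> K"
  have "value_function f X U K T 0 x\<^sub>0 \<le> ereal (t\<^sub>1 - 0)"
    unfolding value_function_def using t1 u by (intro Inf_lower) blast
  \<comment> \<open>\<open>c\<^sub>1 < T + 1\<close> will keep the cap on the terminal penalty
    inactive; it holds because the value is at most \<open>t\<^sub>1\<close>.\<close>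
  then obtain c\<^sub>1 where c1: "c < c\<^sub>1" "ereal c\<^sub>1 < value_function f X U K T 0 x\<^sub>0" "c\<^sub>1 < T + 1"
  proof -
    assume le: "value_function f X U K T 0 x\<^sub>0 \<le> ereal (t\<^sub>1 - 0)"
    obtain b where b: "ereal c < b" "b < value_function f X U K T 0 x\<^sub>0" using dense[OF c] by blast
    then obtain r where "b = ereal r" using le by (cases b) auto
    moreover have "b < ereal t\<^sub>1" using b(2) le by simp
    ultimately show thesis using b t1 by (intro that[of r]) auto
  qed
  \<comment> \<open>The gap above \<open>c\<^sub>2\<close> allows for an infimum over chains that is
    not attained; the gap below it is spent on the polynomial.\<close>
  obtain c\<^sub>2 where c2: "c < c\<^sub>2" "c\<^sub>2 < c\<^sub>1" using dense[OF c1(1)] by blast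
  have K_ne: "K \<noteq> {}" using u unfolding admissible_controls_def by blast
  have A: "compact ?A" "bounded ?A" using X by (auto intro!: compact_Times compact_imp_bounded)
  obtain R where R: "0 < R" "\<And>z. z \<in> ?A \<Longrightarrow> norm z \<le> R" using A(2) bounded_pos by metis
  \<comment> \<open>Composing with the projection onto a ball containing \<open>?A\<close> makes the
    dynamics bounded and keeps their Lipschitz constant, without changing them on
    \<open>?A\<close>.\<close>
  define \<pi> where "\<pi> = closest_point (cball 0 R :: (real \<times> (real^'n)) set)"
  define F where "F = (\<lambda>z v. (1 :: real, f (fst (\<pi> z)) (snd (\<pi> z)) v))"
  have cb: "convex (cball 0 R :: (real \<times> (real^'n)) set)" "closed (cball 0 R :: (real \<times> (real^'n)) set)"
    "cball 0 R \<noteq> ({} :: (real \<times> (real^'n)) set)"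
    using R(1) by auto
  have \<pi>_A: "\<pi> z = z" if "z \<in> ?A" for z
    unfolding \<pi>_def using R(2)[OF that] by (intro closest_point_self) simp
  have F_A: "F (t, x) v = (1, f t x v)" if "t \<in> {0..T}" "x \<in> X" for t x v
    using \<pi>_A[of "(t, x)"] that by (simp add: F_def)
  have L: "0 \<le> L" using f lipschitz_on_nonneg by blast
  have F_lip: "norm (F y v - F z v) \<le> L * norm (y - z)" for y z v
  proof -
    have "norm (F y v - F z v) = norm (f (fst (\<pi> y)) (snd (\<pi> y)) v - f (fst (\<pi> z)) (snd (\<pi> z)) v)"
      by (simp add: F_def norm_Pair)
    also have "\<dots> \<le> L * norm ((fst (\<pi> y), snd (\<pi> y), v) - (fst (\<pi> z), snd (\<pi> z), v))"
      using lipschitz_on_normD[OF f, of "(fst (\<pi> y), snd (\<pi> y), v)" "(fst (\<pi> z), snd (\<pi> z), v)"] by simp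
    also have "norm ((fst (\<pi> y), snd (\<pi> y), v) - (fst (\<pi> z), snd (\<pi> z), v)) = norm (\<pi> y - \<pi> z)"
      by (simp add: norm_Pair norm_prod_def)
    also have "\<dots> \<le> norm (y - z)"
      using closest_point_lipschitz[OF cb, of y z] by (simp add: \<pi>_def dist_norm)
    finally show ?thesis using L by (simp add: mult_left_mono)
  qed
  have f_cont: "continuous_on UNIV (\<lambda>(t, x, v). f t x v)" using f lipschitz_on_continuous_on by blast
  obtain B where B: "0 < B" "\<And>z v. v \<in> U \<Longrightarrow> norm (F z v) \<le> B"
  proof -
    let ?h = "\<lambda>(z, v). (1 :: real, f (fst z) (snd z) v)"
    have "continuous_on UNIV (\<lambda>w :: (real \<times> (real^'n)) \<times> (real^'m). (\<lambda>(t, x, v). f t x v) (fst (fst w), snd (fst w), snd w))"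
      by (rule continuous_on_compose2[OF f_cont]) (auto intro!: continuous_intros)
    then have "continuous_on (cball 0 R \<times> U) ?h"
      unfolding case_prod_beta using continuous_on_subset by (intro continuous_intros) force+
    then have "compact (?h ` (cball 0 R \<times> U))"
      using U(1) by (intro compact_continuous_image compact_Times) auto
    then have "bounded (?h ` (cball 0 R \<times> U))" by (rule compact_imp_bounded)
    then obtain B where B: "0 < B" "\<forall>w\<in>?h ` (cball 0 R \<times> U). norm w \<le> B" unfolding bounded_pos by blast
    show thesis
    proof (rule that[OF B(1)])
      fix z v assume "v \<in> U"
      moreover have "\<pi> z \<in> cball 0 R" unfolding \<pi>_def using cb by (intro closest_point_in_set)
      ultimately have "F z v \<in> ?h ` (cball 0 R \<times> U)" unfolding F_def by (intro image_eqI[of _ _ "(\<pi> z, v)"]) auto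
      then show "norm (F z v) \<le> B" using B(2) by blast
    qed
  qed
  interpret euler_chains F U ?A ?K L B "T + 1"
  proof
    show "closed ?A" "closed ?K" using X K(1) by (auto intro!: closed_Times intro: compact_imp_closed)
    show "?K \<noteq> {}" using K_ne T by auto
  qed (use B L T F_lip K in auto)
  have "\<exists>n. c\<^sub>2 < chain_value (real (Suc n)) (inverse (real (Suc n))) (0, x\<^sub>0)"
  proof (rule ccontr)
    assume "\<not> ?thesis"
    then have le: "chain_value (real (Suc n)) (inverse (real (Suc n))) (0, x\<^sub>0) < c\<^sub>1" for n
      using c2 by (meson le_less_trans not_le)
    have "\<exists>l\<in>chains (inverse (real (Suc n))). chain_cost (real (Suc n)) (0, x\<^sub>0) l \<le> c\<^sub>1" for n
    proof (rule ccontr)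
      assume "\<not> ?thesis"
      then have "c\<^sub>1 \<le> chain_value (real (Suc n)) (inverse (real (Suc n))) (0, x\<^sub>0)"
        by (intro chain_value_ge) force
      then show False using le[of n] by simp
    qed
    then obtain l where l: "\<And>n. l n \<in> chains (inverse (real (Suc n)))"
      "\<And>n. chain_cost (real (Suc n)) (0, x\<^sub>0) (l n) \<le> c\<^sub>1" by metis
    show False
    proof (rule near_optimal_chains_limit[OF l c1(3)])
      fix g \<tau> assume \<tau>: "0 \<le> \<tau>" "\<tau> \<le> c\<^sub>1" and g: "g 0 = (0, x\<^sub>0)" "g \<tau> \<in> ?K" "B-lipschitz_on {0..\<tau>} g"
        "\<And>s. 0 \<le> s \<Longrightarrow> s \<le> \<tau> \<Longrightarrow> g s \<in> ?A"
        and dir: "\<And>p d s s'. 0 \<le> s \<Longrightarrow> s < s' \<Longrightarrow> s' < \<tau> \<Longrightarrow> (\<And>v. v \<in> U \<Longrightarrow> p \<bullet> F (g s) v \<le> d) \<Longrightarrow>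
          p \<bullet> (g s' - g s) \<le> (d + norm p * (L * (B * (s' - s)))) * (s' - s)"
        and const: "\<And>p d s. 0 \<le> s \<Longrightarrow> s \<le> \<tau> \<Longrightarrow> (\<And>y v. v \<in> U \<Longrightarrow> p \<bullet> F y v = d) \<Longrightarrow> p \<bullet> g s = p \<bullet> (0, x\<^sub>0) + d * s"
      define y where "y = (\<lambda>s. snd (g s))"
      have g_eq: "g s = (s, y s)" if "0 \<le> s" "s \<le> \<tau>" for s
      proof -
        \<comment> \<open>The clock of the limit curve equals its parameter, so staying in
          \<open>?A\<close> also forces \<tau> \<le> T.\<close>
        have "(1, 0) \<bullet> g s = (1, 0) \<bullet> (0 :: real, x\<^sub>0) + 1 * s"
          by (rule const[OF that]) (simp add: F_def)
        then have "fst (g s) = s" by (cases "g s") simp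
        then show ?thesis by (simp add: y_def prod_eq_iff)
      qed
      have \<tau>T: "\<tau> \<le> T" using g_eq[OF \<tau>(1) order.refl] g(2) by auto
      have y_X: "y s \<in> X" if "s \<in> {0..\<tau>}" for s using g(4)[of s] g_eq[of s] that by auto
      have "\<exists>u. u \<in> admissible_controls f X U K 0 \<tau> x\<^sub>0"
      proof (rule differential_inclusion_admissible[OF f_cont U _ \<tau>(1)])
        show "convex (f t (y t) ` U)" if "t \<in> {0..\<tau>}" for t using conv[of t "y t"] y_X[OF that] that \<tau>T by auto
        show "y 0 = x\<^sub>0" using g(1) by (simp add: y_def)
        show "y \<tau> \<in> K" using g(2) by (auto simp: y_def)
        show "B-lipschitz_on {0..\<tau>} y"
        proof (rule lipschitz_onI)
          fix s t assume "s \<in> {0..\<tau>}" "t \<in> {0..\<tau>}"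
          then have "dist (g s) (g t) \<le> B * dist s t" by (rule lipschitz_onD[OF g(3)])
          then show "dist (y s) (y t) \<le> B * dist s t" using dist_snd_le[of "g s" "g t"] by (simp add: y_def)
        qed (use B in simp)
        show "y s \<in> X" if "s \<in> {0..\<tau>}" for s by (rule y_X[OF that])
        show "a \<bullet> (y s' - y s) \<le> (b + (L * B) * norm a * (s' - s)) * (s' - s)"
          if s: "0 \<le> s" "s < s'" "s' < \<tau>" and b: "\<And>v. v \<in> U \<Longrightarrow> a \<bullet> f s (y s) v \<le> b" for a b s s'
        proof -
          have gs: "g s = (s, y s)" "g s' = (s', y s')" using g_eq s by auto
          \<comment> \<open>A test direction without time component extracts the estimate for the
            original state.\<close>
          have "(0, a) \<bullet> (g s' - g s) \<le> (b + norm (0 :: real, a) * (L * (B * (s' - s)))) * (s' - s)"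
          proof (rule dir[OF s])
            fix v assume v: "v \<in> U"
            show "(0, a) \<bullet> F (g s) v \<le> b" using b[OF v] F_A[of s "y s" v] s \<tau>T y_X[of s] by (simp add: gs)
          qed
          then show ?thesis by (simp add: gs norm_Pair mult_ac)
        qed
      qed
      then have "value_function f X U K T 0 x\<^sub>0 \<le> ereal (\<tau> - 0)"
        unfolding value_function_def using \<tau>(1) \<tau>T by (intro Inf_lower) force
      also have "\<dots> \<le> ereal c\<^sub>1" using \<tau>(2) by simp
      finally show False using c1(2) by simp
    qed
  qed
  then obtain n where n: "c\<^sub>2 < chain_value (real (Suc n)) (inverse (real (Suc n))) (0, x\<^sub>0)" by blast
  let ?W = "chain_value (real (Suc n)) (inverse (real (Suc n)))"
  \<comment> \<open>At (0, x0) the loss is \<epsilon> from the approximation plus \<epsilon> T +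
    \<epsilon> from the correction in \<open>P\<close>.\<close>
  define \<epsilon> where "\<epsilon> = (c\<^sub>2 - c) / (T + 2)"
  have \<epsilon>: "0 < \<epsilon>" "\<epsilon> * (T + 2) = c\<^sub>2 - c" using c2 T by (auto simp: \<epsilon>_def)
  obtain Q where Q: "real_polynomial_function Q" "\<And>z. z \<in> ?A \<Longrightarrow> \<bar>Q z - ?W z\<bar> \<le> \<epsilon>"
    "\<And>z v D. z \<in> ?A \<Longrightarrow> v \<in> U \<Longrightarrow> (Q has_derivative D) (at z) \<Longrightarrow> - (1 + \<epsilon>) \<le> D (F z v)"
    using chain_value_polynomial[OF A(2), of "real (Suc n)" "inverse (real (Suc n))" \<epsilon>] \<epsilon>(1) by auto
  \<comment> \<open>Slope \<epsilon> in time cancels the error in the differential inequality.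
    Subtracting \<epsilon> makes the function nonpositive on the target, where \<open>Q\<close> may
    reach \<epsilon>, and the shift by \<open>T\<close> keeps the linear term nonpositive.\<close>
  define P where "P = (\<lambda>z. Q z + \<epsilon> * (fst z - T) - \<epsilon>)"
  have fst_poly: "real_polynomial_function (fst :: real \<times> (real^'n) \<Rightarrow> real)"
    by (intro real_polynomial_function.intros(1) bounded_linear_fst)
  have "real_polynomial_function P"
    unfolding P_def by (intro real_polynomial_function_diff real_polynomial_function.intros(2-4) Q(1) fst_poly)
  then obtain d where d: "(\<lambda>t x. P (t, x)) \<in> polys_upto d" using real_polynomial_function_imp_polys_upto by blast
  define V where "V = (\<lambda>t x. P (t, x))"
  have "V \<in> feasible_R f X U K T d"
    unfolding feasible_R_def
  proof (intro CollectI conjI ballI)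
    show "V \<in> polys_upto d" using d by (simp add: V_def)
    fix t x assume t: "t \<in> {0..T}"
    {
      fix v assume x: "x \<in> X" and v: "v \<in> U"
      obtain D where D: "(Q has_derivative D) (at (t, x))"
        using differentiable_at_real_polynomial_function[OF Q(1)] differentiable_def by blast
      have "((\<lambda>(t, x). V t x) has_derivative (\<lambda>h. D h + \<epsilon> * fst h)) (at (t, x))"
        unfolding V_def P_def case_prod_beta prod.collapse
        using D by (auto intro!: derivative_eq_intros)
      then have "deriv (\<lambda>s. V s x) t + gradient (V t) x \<bullet> f t x v = D (1, f t x v) + \<epsilon> * fst (1 :: real, f t x v)"
        by (rule deriv_plus_gradient)
      moreover have "- (1 + \<epsilon>) \<le> D (F (t, x) v)" using t x by (intro Q(3)[OF _ v D]) auto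
      ultimately show "deriv (\<lambda>s. V s x) t + 1 + gradient (V t) x \<bullet> f t x v \<ge> 0"
        using F_A[OF t x, of v] by simp
    }
    assume x: "x \<in> K"
    have "infdist (t, x) ?K = 0" using t x by (intro infdist_zero) auto
    then have "?W (t, x) \<le> 0"
      using chain_value_le_terminal[of "real (Suc n)" "inverse (real (Suc n))" "(t, x)"] T by simp
    moreover have "\<epsilon> * (t - T) \<le> 0" using \<epsilon>(1) t by (simp add: mult_nonneg_nonpos)
    moreover have "\<bar>Q (t, x) - ?W (t, x)\<bar> \<le> \<epsilon>" using Q(2)[of "(t, x)"] t x K(2) by blast
    ultimately show "V t x \<le> 0" unfolding V_def P_def by (simp add: abs_le_iff)
  qed
  moreover have "c < V 0 x\<^sub>0"
  proof -
    have "\<bar>Q (0, x\<^sub>0) - ?W (0, x\<^sub>0)\<bar> \<le> \<epsilon>" using Q(2)[of "(0, x\<^sub>0)"] x0 T by auto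
    then have "c\<^sub>2 - \<epsilon> * (T + 2) < V 0 x\<^sub>0" using n unfolding V_def P_def by (simp add: abs_le_iff algebra_simps)
    then show ?thesis using \<epsilon>(2) by simp
  qed
  ultimately show ?thesis by blast
qed

theorem theorem3p2:
  fixes f :: "real \<Rightarrow> real^'n \<Rightarrow> real^'m \<Rightarrow> real^'n"
    and X K :: "(real^'n) set" and U :: "(real^'m) set"
    and T t\<^sub>1 :: real and x\<^sub>0 :: "real^'n" and u :: "real \<Rightarrow> real^'m"
  assumes "T > 0"
    and "\<exists>L. L-lipschitz_on UNIV (\<lambda>(t, x, v). f t x v)"
    and "compact U" and "U \<noteq> {}"
    and "compact X" and "compact K" and "K \<subseteq> X" and "x\<^sub>0 \<in> X"
    and "\<And>t x. t \<in> {0..T} \<Longrightarrow> x \<in> X \<Longrightarrow> convex (f t x ` U)"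
    and "t\<^sub>1 \<in> {0..T}" and "u \<in> admissible_controls f X U K 0 t\<^sub>1 x\<^sub>0"
  shows "(\<lambda>d. val_R f X U K T x\<^sub>0 d) \<longlonglongrightarrow> value_function f X U K T 0 x\<^sub>0"
proof (rule order_tendstoI)
  let ?v = "value_function f X U K T 0 x\<^sub>0"
  fix a assume "?v < a"
  then show "eventually (\<lambda>d. val_R f X U K T x\<^sub>0 d < a) sequentially"
    using val_R_le_value_function[of f X U K T x\<^sub>0] by (intro always_eventually allI) (rule le_less_trans)
next
  let ?v = "value_function f X U K T 0 x\<^sub>0"
  fix a assume a: "a < ?v"
  obtain L where L: "L-lipschitz_on UNIV (\<lambda>(t, x, v). f t x v)" using assms(2) by blast
  obtain r where r: "a < ereal r" "ereal r < ?v"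
    using ereal_dense2[OF a] by blast
  obtain d V where V: "V \<in> feasible_R f X U K T d" "r < V 0 x\<^sub>0"
    using val_R_approximates_value[OF assms(1) L assms(3-7,9,8,10,11) r(2)] by blast
  have "a < val_R f X U K T x\<^sub>0 d'" if "d \<le> d'" for d'
  proof -
    have "ereal r < ereal (V 0 x\<^sub>0)" using V(2) by simp
    also have "ereal (V 0 x\<^sub>0) \<le> val_R f X U K T x\<^sub>0 d'"
      unfolding val_R_def using V(1) feasible_R_mono[OF that] by (intro SUP_upper) blast
    finally show ?thesis using r(1) by (rule less_trans[rotated])
  qed
  then show "eventually (\<lambda>d. a < val_R f X U K T x\<^sub>0 d) sequentially"
    unfolding eventually_sequentially by blast
qed

end
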